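(* For all $n,k\ge0$ there are $\mathfrak{S}_n$-module isomorphisms $V(n)\cong\bigoplus_{k\ge0}V(n,k)$ and $V(n,k)\cong\bigoplus_{s\ge0}V(n,k,s)$. Moreover, for nonnegative integers $n,k,s$ such that the sequence $\lambda=(k-s,k-s,1^{n-2k+s})$ (i.e. $k-s,k-s$ followed by $n-2k+s$ ones) is a weakly decreasing sequence of nonnegative integers, regarded as a partition of $n-s$ after deleting zero entries, there is an $\mathfrak{S}_n$-module isomorphism $$V(n,k,s)\cong \mathrm{Ind}_{\mathfrak{S}_{n-s}\times\mathfrak{S}_s}^{\mathfrak{S}_n}\big(S^{\lambda}\otimes\mathrm{triv}_{\mathfrak{S}_s}\big),$$ where $S^\lambda$ is the irreducible (Specht) $\mathfrak{S}_{n-s}$-module indexed by $\lambda$ and $\mathrm{triv}$ is the trivial representation.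
   Context: $[n]=\{1,\dots,n\}$, $s_i=(i,i+1)\in\mathfrak{S}_n$. For $w\in\mathfrak{S}_n$ and a set partition $\pi$ of $[n]$, $w(\pi)$ is the set partition in which $w(a),w(b)$ share a block iff $a,b$ share a block of $\pi$; $B_i(\pi)$ is the block of $\pi$ containing $i$. A set partition is noncrossing if whenever $a<b<c<d$ with $a,c$ in one block and $b,d$ in one block, all four are in the same block. $NC(n)$ is the set of noncrossing partitions of $[n]$, $NC(n,k)$ those with exactly $k$ blocks, $NC(n,k,s)$ those with exactly $k$ blocks of which exactly $s$ are singletons. A set partition $\pi$ is almost noncrossing if it is not noncrossing but $s_i(\pi)$ is noncrossing for some $i$; then $\pi$ crosses at $i$. Skein map: for $\pi$ almost noncrossing crossing at $i$, write $B_i(\pi)=\{i,a_1,\dots,a_k\}$, $B_{i+1}(\pi)=\{i+1,b_1,\dots,b_\ell\}$ ($k,\ell\ge1$); let $\pi_1=s_i(\pi)$ and let $\pi_2,\pi_3,\pi_4$ be obtained from $\pi$ by replacing $B_i(\pi),B_{i+1}(\pi)$ by $\{i,i+1\},\{a_1..a_k,b_1..b_\ell\}$ (for $\pi_2$), $\{i,i+1,a_1..a_k\},\{b_1..b_\ell\}$ (for $\pi_3$), $\{i,i+1,b_1..b_\ell\},\{a_1..a_k\}$ (for $\pi_4$). Then $\sigma(\pi)=\pi_1+\pi_2-\pi_3-\pi_4$ if $k,\ell\ge2$, with the $\pi_3$ term deleted if $\ell=1$ and the $\pi_4$ term deleted if $k=1$; this is independent of the chosen crossing index. $V(n)$, $V(n,k)$,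 $V(n,k,s)$ are the $\mathbb{Q}$-vector spaces with bases $NC(n)$, $NC(n,k)$, $NC(n,k,s)$. For $1\le i\le n-1$, $\tau_i$ is the linear operator on $V(n)$ defined on $\pi\in NC(n)$ by: $\tau_i(\pi)=s_i(\pi)$ if $s_i(\pi)$ is noncrossing and $B_i(\pi)\ne B_{i+1}(\pi)$; $\tau_i(\pi)=-\pi$ if $B_i(\pi)=B_{i+1}(\pi)$; $\tau_i(\pi)=\sigma(s_i(\pi))$ otherwise. The assignment $s_i\mapsto\tau_i$ defines an action of $\mathfrak{S}_n$ on $V(n)$ for which $V(n,k)$ and $V(n,k,s)$ are submodules. *)

theory Defs
  imports Complex_Main "HOL-Algebra.Sym_Groups" "HOL-Library.Disjoint_Sets" "HOL-Library.Function_Algebras"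
begin

section \<open>Rational representations\<close>

text \<open>
  All vector spaces are rational subspaces of spaces of functions \<open>'b \<Rightarrow> rat\<close> with pointwise
  operations.
\<close>

definition scl :: "rat \<Rightarrow> ('b \<Rightarrow> rat) \<Rightarrow> 'b \<Rightarrow> rat"
  where "scl c f = (\<lambda>x. c * f x)"

interpretation fn: vector_space scl
  by unfold_locales (auto simp: scl_def fun_eq_iff algebra_simps)

definition basis_vec :: "'b \<Rightarrow> 'b \<Rightarrow> rat"
  where "basis_vec b = (\<lambda>x. if x = b then 1 else 0)"

text \<open>The values of \<open>act\<close> outside \<open>space\<close> are irrelevant.\<close>

record ('g, 'b) rep =
  space :: "('b \<Rightarrow> rat) set"
  act :: "'g \<Rightarrow> ('b \<Rightarrow> rat) \<Rightarrow> ('b \<Rightarrow> rat)"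

definition is_rep :: "('g, 'm) monoid_scheme \<Rightarrow> ('g, 'b) rep \<Rightarrow> bool"
  where "is_rep G M \<longleftrightarrow>
    fn.subspace (space M) \<and>
    (\<forall>g\<in>carrier G. \<forall>v\<in>space M. act M g v \<in> space M) \<and>
    (\<forall>g\<in>carrier G. \<forall>v\<in>space M. \<forall>w\<in>space M. act M g (v + w) = act M g v + act M g w) \<and>
    (\<forall>g\<in>carrier G. \<forall>c. \<forall>v\<in>space M. act M g (scl c v) = scl c (act M g v)) \<and>
    (\<forall>v\<in>space M. act M \<one>\<^bsub>G\<^esub> v = v) \<and>
    (\<forall>g\<in>carrier G. \<forall>h\<in>carrier G. \<forall>v\<in>space M. act M (g \<otimes>\<^bsub>G\<^esub> h) v = act M g (act M h v))"

definition rep_isomorphic ::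
    "('g, 'm) monoid_scheme \<Rightarrow> ('g, 'b) rep \<Rightarrow> ('g, 'c) rep \<Rightarrow> bool"
  where "rep_isomorphic G M N \<longleftrightarrow> is_rep G M \<and> is_rep G N \<and>
    (\<exists>f. bij_betw f (space M) (space N) \<and>
      (\<forall>v\<in>space M. \<forall>w\<in>space M. f (v + w) = f v + f w) \<and>
      (\<forall>c. \<forall>v\<in>space M. f (scl c v) = scl c (f v)) \<and>
      (\<forall>g\<in>carrier G. \<forall>v\<in>space M. f (act M g v) = act N g (f v)))"

text \<open>External direct sum: a family \<open>(v\<^sub>i)\<close> is encoded as the function \<open>(i, b) \<mapsto> v\<^sub>i b\<close>.\<close>

definition direct_sum :: "('i \<Rightarrow> ('g, 'b) rep) \<Rightarrow> ('g, 'i \<times> 'b) rep"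
  where "direct_sum M = \<lparr>
    space = {f. (\<forall>i. (\<lambda>b. f (i, b)) \<in> space (M i)) \<and> finite {i. (\<lambda>b. f (i, b)) \<noteq> 0}},
    act = (\<lambda>g f. \<lambda>(i, b). act (M i) g (\<lambda>b'. f (i, b')) b) \<rparr>"

text \<open>
  Outer tensor product: the pure tensor of \<open>v\<close> and \<open>w\<close> is \<open>(a, b) \<mapsto> v a * w b\<close>, and \<open>(g, h)\<close>
  acts by applying \<open>g\<close> to every slice in the first coordinate and then \<open>h\<close> to every slice in the
  second, so that it maps the pure tensor of \<open>v\<close> and \<open>w\<close> to that of \<open>g v\<close> and \<open>h w\<close>.
\<close>

definition outer_tensor :: "('g, 'b) rep \<Rightarrow> ('h, 'c) rep \<Rightarrow> ('g \<times> 'h, 'b \<times> 'c) rep"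
  where "outer_tensor M N = \<lparr>
    space = fn.span {(\<lambda>(a, b). v a * w b) | v w. v \<in> space M \<and> w \<in> space N},
    act = (\<lambda>(g, h) f. \<lambda>(a, b). act N h (\<lambda>b'. act M g (\<lambda>a'. f (a', b')) a) b) \<rparr>"

definition triv_rep :: "('g, unit) rep"
  where "triv_rep = \<lparr> space = UNIV, act = (\<lambda>_ v. v) \<rparr>"

text \<open>
  Representation of a finite group \<open>G\<close> induced from a representation of \<open>H\<close> along an injective
  homomorphism \<open>\<iota>\<close> from \<open>H\<close> to \<open>G\<close>: the functions \<open>F\<close> from \<open>G\<close> to the given representation with
  \<open>F (g \<iota>(h)) = h\<inverse> F(g)\<close>, on which \<open>x\<close> acts by \<open>(x F)(g) = F (x\<inverse> g)\<close>.
  Such an \<open>F\<close> is encoded as \<open>(g, b) \<mapsto> F g b\<close>, extended by zero outside of \<open>G\<close>.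
\<close>

definition induced_rep ::
    "('h, 'm) monoid_scheme \<Rightarrow> ('g, 'n) monoid_scheme \<Rightarrow> ('h \<Rightarrow> 'g) \<Rightarrow> ('h, 'b) rep
      \<Rightarrow> ('g, 'g \<times> 'b) rep"
  where "induced_rep H G \<iota> M = \<lparr>
    space = {F. (\<forall>g\<in>carrier G. (\<lambda>b. F (g, b)) \<in> space M) \<and>
                (\<forall>g b. g \<notin> carrier G \<longrightarrow> F (g, b) = 0) \<and>
                (\<forall>g\<in>carrier G. \<forall>h\<in>carrier H.
                  (\<lambda>b. F (g \<otimes>\<^bsub>G\<^esub> \<iota> h, b)) = act M (inv\<^bsub>H\<^esub> h) (\<lambda>b. F (g, b)))},
    act = (\<lambda>x F. \<lambda>(g, b). if g \<in> carrier G then F (inv\<^bsub>G\<^esub> x \<otimes>\<^bsub>G\<^esub> g, b) else 0) \<rparr>"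

text \<open>The embedding of \<open>S\<^sub>m \<times> S\<^sub>r\<close> into \<open>S\<^bsub>m+r\<^esub>\<close>; the second factor permutes \<open>{m+1..m+r}\<close>.\<close>

definition young_embedding :: "nat \<Rightarrow> (nat \<Rightarrow> nat) \<times> (nat \<Rightarrow> nat) \<Rightarrow> nat \<Rightarrow> nat"
  where "young_embedding m = (\<lambda>(u, v) x. if x \<le> m then u x else m + v (x - m))"


section \<open>Specht modules\<close>

text \<open>
  A partition is a weakly decreasing list of positive integers. Cells are pairs (row, column),
  counted from 0. A tabloid is the list of the row sets of a tableau.
\<close>

definition cells :: "nat list \<Rightarrow> (nat \<times> nat) set"
  where "cells lam = {(r, c). r < length lam \<and> c < lam ! r}"

definition tableaux :: "nat list \<Rightarrow> (nat \<times> nat \<Rightarrow> nat) set"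
  where "tableaux lam = {t. bij_betw t (cells lam) {1..sum_list lam}}"

definition tabloid :: "nat list \<Rightarrow> (nat \<times> nat \<Rightarrow> nat) \<Rightarrow> nat set list"
  where "tabloid lam t = map (\<lambda>r. t ` {x \<in> cells lam. fst x = r}) [0..<length lam]"

definition column_stabilizer :: "nat list \<Rightarrow> (nat \<times> nat \<Rightarrow> nat) \<Rightarrow> (nat \<Rightarrow> nat) set"
  where "column_stabilizer lam t = {p. p permutes {1..sum_list lam} \<and>
    (\<forall>c. p ` t ` {x \<in> cells lam. snd x = c} = t ` {x \<in> cells lam. snd x = c})}"

definition polytabloid :: "nat list \<Rightarrow> (nat \<times> nat \<Rightarrow> nat) \<Rightarrow> nat set list \<Rightarrow> rat"
  where "polytabloid lam t =
    (\<Sum>p\<in>column_stabilizer lam t. scl (of_int (sign p)) (basis_vec (tabloid lam (p \<circ> t))))"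

definition specht :: "nat list \<Rightarrow> (nat \<Rightarrow> nat, nat set list) rep"
  where "specht lam = \<lparr>
    space = fn.span (polytabloid lam ` tableaux lam),
    act = (\<lambda>w f T. f (map ((`) (inv' w)) T)) \<rparr>"


section \<open>Noncrossing partitions and the skein action\<close>

definition perm_partition :: "(nat \<Rightarrow> nat) \<Rightarrow> nat set set \<Rightarrow> nat set set"
  where "perm_partition w P = (\<lambda>B. w ` B) ` P"

definition block :: "nat set set \<Rightarrow> nat \<Rightarrow> nat set"
  where "block P i = (THE B. B \<in> P \<and> i \<in> B)"

definition noncrossing :: "nat set set \<Rightarrow> bool"
  where "noncrossing P \<longleftrightarrow>
    (\<forall>a b c d. \<forall>A\<in>P. \<forall>B\<in>P. a < b \<and> b < c \<and> c < d \<and> {a, c} \<subseteq> A \<and> {b, d} \<subseteq> B \<longrightarrow> A = B)"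

definition NC :: "nat \<Rightarrow> nat set set set"
  where "NC n = {P. partition_on {1..n} P \<and> noncrossing P}"

definition NC_blocks :: "nat \<Rightarrow> nat \<Rightarrow> nat set set set"
  where "NC_blocks n k = {P \<in> NC n. card P = k}"

definition NC_blocks_singletons :: "nat \<Rightarrow> nat \<Rightarrow> nat \<Rightarrow> nat set set set"
  where "NC_blocks_singletons n k s = {P \<in> NC_blocks n k. card {B \<in> P. card B = 1} = s}"

abbreviation adj :: "nat \<Rightarrow> nat \<Rightarrow> nat"
  where "adj i \<equiv> transpose i (i + 1)"

definition crosses_at :: "nat \<Rightarrow> nat set set \<Rightarrow> nat \<Rightarrow> bool"
  where "crosses_at n P i \<longleftrightarrow> partition_on {1..n} P \<and> \<not> noncrossing P \<and>
    i \<in> {1..<n} \<and> noncrossing (perm_partition (adj i) P)"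

definition skein_at :: "nat \<Rightarrow> nat set set \<Rightarrow> nat set set \<Rightarrow> rat"
  where "skein_at i P =
    (let A = block P i - {i}; B = block P (i + 1) - {i + 1};
         R = P - {block P i, block P (i + 1)}
     in basis_vec (perm_partition (adj i) P)
        + basis_vec (R \<union> {{i, i + 1}, A \<union> B})
        - (if card B = 1 then 0 else basis_vec (R \<union> {{i, i + 1} \<union> A, B}))
        - (if card A = 1 then 0 else basis_vec (R \<union> {{i, i + 1} \<union> B, A})))"

text \<open>The value does not depend on which crossing index is chosen.\<close>

definition skein :: "nat \<Rightarrow> nat set set \<Rightarrow> nat set set \<Rightarrow> rat"
  where "skein n P = skein_at (SOME i. crosses_at n P i) P"

definition tau_basis :: "nat \<Rightarrow> nat \<Rightarrow> nat set set \<Rightarrow> nat set set \<Rightarrow> rat"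
  where "tau_basis n i P =
    (if noncrossing (perm_partition (adj i) P) \<and> block P i \<noteq> block P (i + 1)
       then basis_vec (perm_partition (adj i) P)
     else if block P i = block P (i + 1) then - basis_vec P
     else skein n (perm_partition (adj i) P))"

definition tau :: "nat \<Rightarrow> nat \<Rightarrow> (nat set set \<Rightarrow> rat) \<Rightarrow> nat set set \<Rightarrow> rat"
  where "tau n i v = (\<Sum>P\<in>NC n. scl (v P) (tau_basis n i P))"

text \<open>
  A permutation acts by the product of the operators \<open>\<tau>\<^sub>i\<close> along some expression of it as a
  product of adjacent transpositions; the result does not depend on the expression.
\<close>

definition skein_act :: "nat \<Rightarrow> (nat \<Rightarrow> nat) \<Rightarrow> (nat set set \<Rightarrow> rat) \<Rightarrow> nat set set \<Rightarrow> rat"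
  where "skein_act n w =
    foldr (tau n) (SOME is. set is \<subseteq> {1..<n} \<and> w = foldr (\<lambda>i u. adj i \<circ> u) is id)"

definition skein_rep :: "nat \<Rightarrow> nat set set set \<Rightarrow> (nat \<Rightarrow> nat, nat set set) rep"
  where "skein_rep n X = \<lparr> space = {v. \<forall>P. P \<notin> X \<longrightarrow> v P = 0}, act = skein_act n \<rparr>"

definition V :: "nat \<Rightarrow> (nat \<Rightarrow> nat, nat set set) rep"
  where "V n = skein_rep n (NC n)"

definition V_blocks :: "nat \<Rightarrow> nat \<Rightarrow> (nat \<Rightarrow> nat, nat set set) rep"
  where "V_blocks n k = skein_rep n (NC_blocks n k)"

definition V_blocks_singletons :: "nat \<Rightarrow> nat \<Rightarrow> nat \<Rightarrow> (nat \<Rightarrow> nat, nat set set) rep"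
  where "V_blocks_singletons n k s = skein_rep n (NC_blocks_singletons n k s)"

text \<open>
  The sequence \<open>(k-s, k-s, 1, ..., 1)\<close> with \<open>n-2k+s\<close> ones; \<open>lam_seq_ok\<close> says that all numbers
  occurring in it are nonnegative (the subtractions below do not truncate) and that it is weakly
  decreasing.
\<close>

definition lam_seq :: "nat \<Rightarrow> nat \<Rightarrow> nat \<Rightarrow> nat list"
  where "lam_seq n k s = [k - s, k - s] @ replicate (n + s - 2 * k) 1"

definition lam_seq_ok :: "nat \<Rightarrow> nat \<Rightarrow> nat \<Rightarrow> bool"
  where "lam_seq_ok n k s \<longleftrightarrow> s \<le> k \<and> 2 * k \<le> n + s \<and> sorted_wrt (\<ge>) (lam_seq n k s)"

end

theory Submission
  imports Defs
begin

text \<open>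
  The skein module is realised inside an honest permutation module. A set partition \<open>P\<close> is sent to a
  vector \<open>F P\<close> (\<open>pvec P\<close> below) whose coordinates are indexed by triples \<open>(X, Y, rs)\<close>:
  such a coordinate is nonzero iff \<open>X\<close> and \<open>Y\<close> are transversals of the non-singleton blocks and \<open>rs\<close> lists their other elements, and
  it is then the sign of the word \<open>x\<^sub>1 \<dots> x\<^sub>j y\<^sub>1 \<dots> y\<^sub>j rs\<close> in which \<open>x\<^sub>i\<close> and \<open>y\<^sub>i\<close> share a block. (Up to sign
  conventions, \<open>F P\<close> is the product over the blocks of the antisymmetrisations of
  \<open>x y \<theta> \<dots> \<theta>\<close> in two commuting variables \<open>x\<close>, \<open>y\<close> and one anticommuting variable \<open>\<theta>\<close>.)
  If two blocks \<open>C\<close>, \<open>D\<close> with fixed union are varied, \<open>F\<close> is proportional to a product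
  \<open>\<delta> C * \<delta>' C\<close> of two additive functions vanishing on \<open>C \<union> D\<close>, and the skein relation becomes a
  polynomial identity. Hence \<open>F\<close> intertwines \<open>\<tau>\<^sub>i\<close> with the adjacent transposition. The vectors of
  noncrossing partitions are linearly independent by triangularity: the coordinate given
  by the block minima and maxima of \<open>P\<close> vanishes on \<open>F Q\<close> unless \<open>Q = P\<close> or the sum of the
  differences of block maxima and minima is larger for \<open>Q\<close> than for \<open>P\<close>. So the operators
  \<open>\<tau>\<^sub>i\<close> satisfy the Coxeter relations, and the direct sum decompositions follow because
  they preserve the numbers of blocks and of singletons.

  On a partition without singletons consisting of the columns of a tableau of shape \<open>(j, j, 1, \<dots>, 1)\<close>,
  the vector \<open>F\<close> is the polytabloid up to sign, and the identity for \<open>\<delta>\<close> expresses every other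
  partition with the same number of blocks through such ones. The position of the singletons
  selects a coset of the Young subgroup, which gives the induced module.
\<close>

section \<open>Signs of words\<close>

text \<open>Nothing in the definitions makes the action well defined: \<open>skein\<close> picks
  some crossing index and \<open>skein_act\<close> some word in the adjacent transpositions. Both
  choices are absorbed in the same way: the image under \<open>web\<close>, the linear extension of
  \<open>F\<close>, is computed for an arbitrary choice, does not depend on it, and
  \<open>web\<close> is injective. The signs need care. An adjacent transposition reverses the sign
  of a word only if both of its letters occur, that is, if neither is a singleton block. This is the
  sign in \<open>- basis_vec P\<close>, and in the skein case it cancels the sign of the skein
  relation. It must be absent where \<open>tau_basis\<close> merely permutes, and it is, because
  there i or i + 1 is a singleton. No dimension is counted. Injectivity into the induced module
  comes from the triangularity. Surjectivity comes from lifting Specht vectors: the orbit of a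
  single noncrossing partition whose blocks are intervals reaches all polytabloids.\<close>

definition sgn_pair :: "nat \<Rightarrow> nat \<Rightarrow> rat"
  where "sgn_pair x y = (if x < y then 1 else if y < x then -1 else 0)"

text \<open>The sign of the permutation that sorts the word. The value 0 at a repeated letter keeps
  every coordinate total and later forces the parts of a triple to be disjoint.\<close>

fun wsign :: "nat list \<Rightarrow> rat" where
  "wsign [] = 1"
| "wsign (x # xs) = (\<Prod>y\<leftarrow>xs. sgn_pair x y) * wsign xs"

lemma sgn_pair_swap: "sgn_pair y x = - sgn_pair x y"
  by (simp add: sgn_pair_def)

lemma wsign_eq_0: "\<not> distinct xs \<Longrightarrow> wsign xs = 0"
  by (induction xs) (auto simp: sgn_pair_def prod_list_zero_iff)

lemma wsign_abs: "distinct xs \<Longrightarrow> wsign xs \<in> {1, -1}"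
proof (induction xs)
  case (Cons x xs)
  have "(\<Prod>y\<leftarrow>ys. sgn_pair x y) \<in> {1, -1}" if "x \<notin> set ys" for ys
    using that by (induction ys) (auto simp: sgn_pair_def)
  with Cons show ?case by fastforce
qed simp

lemma wsign_nonzero: "distinct xs \<Longrightarrow> wsign xs \<noteq> 0"
  using wsign_abs by fastforce

lemma wsign_adjacent: "wsign (us @ a # b # vs) = - wsign (us @ b # a # vs)"
  by (induction us) (auto simp: sgn_pair_swap[of b a] algebra_simps)

lemma wsign_move: "wsign (us @ vs @ a # ws) = (- 1) ^ length vs * wsign (us @ a # vs @ ws)"
proof (induction vs arbitrary: us)
  case (Cons v vs)
  have "wsign (us @ (v # vs) @ a # ws) = (- 1) ^ length vs * wsign (us @ v # a # vs @ ws)"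
    using Cons[of "us @ [v]"] by simp
  then show ?case
    using wsign_adjacent[of us v a "vs @ ws"] by simp
qed simp

lemma wsign_swap: "wsign (us @ a # vs @ b # ws) = - wsign (us @ b # vs @ a # ws)"
proof -
  have "wsign (us @ a # vs @ b # ws) = (- 1) ^ length vs * wsign (us @ a # b # vs @ ws)"
    using wsign_move[of "us @ [a]" vs b ws] by simp
  moreover have "wsign (us @ b # vs @ a # ws) = (- 1) ^ length vs * wsign (us @ b # a # vs @ ws)"
    using wsign_move[of "us @ [b]" vs a ws] by simp
  ultimately show ?thesis using wsign_adjacent[of us a b "vs @ ws"] by simp
qed

text \<open>Moving a block within the enumeration moves its two letters past equally many letters,
  so the two signs cancel. This makes \<open>pvec\<close> independent of the enumeration of the
  blocks.\<close>

lemma wsign_map_pair_perm: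
  assumes "mset bs = mset bs'"
  shows "wsign (ps @ map f bs @ qs @ map h bs @ rs) = wsign (ps @ map f bs' @ qs @ map h bs' @ rs)"
  using assms
proof (induction bs arbitrary: bs' ps qs)
  case (Cons b bs)
  from Cons.prems have "b \<in> set bs'" by (metis list.set_intros(1) mset_eq_setD)
  then obtain us vs where bs': "bs' = us @ b # vs" by (meson split_list)
  with Cons.prems have "mset bs = mset (us @ vs)" by simp
  from Cons.IH[OF this, of "ps @ [f b]" "qs @ [h b]"]
  have "wsign (ps @ map f (b # bs) @ qs @ map h (b # bs) @ rs)
      = wsign (ps @ f b # map f us @ map f vs @ qs @ h b # map h us @ map h vs @ rs)"
    by simp
  moreover have "wsign (ps @ map f bs' @ qs @ map h bs' @ rs)
      = (- 1) ^ length us * wsign (ps @ f b # map f us @ map f vs @ qs @ map h us @ h b # map h vs @ rs)"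
    using wsign_move[of ps "map f us" "f b"] by (simp add: bs')
  moreover have "wsign (ps @ f b # map f us @ map f vs @ qs @ map h us @ h b # map h vs @ rs)
      = (- 1) ^ length us * wsign (ps @ f b # map f us @ map f vs @ qs @ h b # map h us @ map h vs @ rs)"
    using wsign_move[of "ps @ f b # map f us @ map f vs @ qs" "map h us" "h b"] by simp
  ultimately show ?case by (simp flip: power_mult_distrib mult.assoc)
qed simp

lemma wsign_map_transpose:
  assumes "distinct xs" "a \<in> set xs" "b \<in> set xs" "a \<noteq> b"
  shows "wsign (map (transpose a b) xs) = - wsign xs"
proof -
  have *: "wsign (map (transpose a b) xs) = - wsign xs"
    if "xs = us @ a # vs @ b # ws" "distinct xs" for us vs ws a b
  proof -
    have "map (transpose a b) us = us" "map (transpose a b) vs = vs" "map (transpose a b) ws = ws"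
      using that by (auto intro!: map_idI simp: transpose_def)
    then show ?thesis using that by (simp add: wsign_swap[of us b])
  qed
  from assms obtain us vs ws where
    "xs = us @ a # vs @ b # ws \<or> xs = us @ b # vs @ a # ws"
    by (metis Un_iff append.assoc append_Cons in_set_conv_decomp set_append set_ConsD)
  then show ?thesis
    using *[of us a vs b ws] *[of us b vs a ws] assms(1) by (auto simp: transpose_commute)
qed

lemma wsign_map_perm:
  assumes "p permutes S" "finite S" "distinct xs" "set xs = S"
  shows "wsign (map p xs) = of_int (sign p) * wsign xs"
  using assms(1,2)
proof (induction rule: permutes_induct)
  case (swap a b p)
  have "distinct (map p xs)" "set (map p xs) = S"
    using swap.hyps assms by (auto simp: distinct_map permutes_inj_on permutes_image)
  moreover have "permutation p"
    using swap.hyps assms permutation_permutes by blast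
  ultimately have "wsign (map (transpose a b \<circ> p) xs) = - (of_int (sign p) * wsign xs)"
    using swap wsign_map_transpose[of "map p xs" a b] by (simp flip: map_map)
  also have "\<dots> = of_int (sign (transpose a b \<circ> p)) * wsign xs"
    using \<open>permutation p\<close> swap.hyps
    by (simp only: sign_compose[OF permutation_swap_id] sign_swap_id) simp
  finally show ?case .
qed simp

text \<open>The order of two letters changes under \<open>adj i\<close> only if they are
  \<open>i\<close> and \<open>i + 1\<close>. The missing sign in the other case is what lets
  singletons be moved without a sign.\<close>

lemma wsign_map_adj:
  assumes "distinct xs"
  shows "wsign (map (adj i) xs) = (if i \<in> set xs \<and> i + 1 \<in> set xs then - 1 else 1) * wsign xs"
proof (cases "i \<in> set xs \<and> i + 1 \<in> set xs")
  case True
  then show ?thesis using wsign_map_transpose[OF assms, of i "i+1"] by simp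
next
  case False
  have "wsign (map (adj i) ys) = wsign ys" if "\<not> (i \<in> set ys \<and> i + 1 \<in> set ys)" for ys
    using that
  proof (induction ys)
    case (Cons y ys)
    have "sgn_pair (adj i y) (adj i z) = sgn_pair y z" if "z \<in> set ys" for z
      using Cons.prems that by (auto simp: sgn_pair_def transpose_def split: if_splits)
    then have "map (\<lambda>z. sgn_pair (adj i y) (adj i z)) ys = map (sgn_pair y) ys" by (rule map_cong[OF refl])
    moreover have "wsign (map (adj i) ys) = wsign ys" using Cons by auto
    ultimately show ?case by (simp only: list.map wsign.simps map_map o_def)
  qed simp
  with False show ?thesis by auto
qed

section \<open>Vectors of set partitions and the skein relation\<close>

declare wsign.simps [simp del]

definition big_blocks :: "nat set set \<Rightarrow> nat set set"
  where "big_blocks P = {B \<in> P. card B \<noteq> 1}"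

definition pick :: "nat set \<Rightarrow> nat set \<Rightarrow> nat"
  where "pick X B = the_elem (X \<inter> B)"

text \<open>A tabloid of shape (j, j, 1, ..., 1) without its alphabet being fixed: two rows that are
  sets, and a list for the rows of length one.\<close>

type_synonym triple = "nat set \<times> nat set \<times> nat list"

text \<open>Disjointness of \<open>X\<close>, \<open>Y\<close> and \<open>rs\<close> is not
  demanded; where it fails, \<open>wsign\<close> is 0. The singleton blocks enter only through the
  set of letters, as its complement.\<close>

definition transv :: "nat set set \<Rightarrow> triple \<Rightarrow> bool"
  where "transv P = (\<lambda>(X, Y, rs).
    (\<forall>B\<in>big_blocks P. is_singleton (X \<inter> B) \<and> is_singleton (Y \<inter> B)) \<and>
    X \<union> Y \<union> set rs = \<Union>(big_blocks P))"

definition word_of :: "nat set list \<Rightarrow> triple \<Rightarrow> nat list"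
  where "word_of bs = (\<lambda>(X, Y, rs). map (pick X) bs @ map (pick Y) bs @ rs)"

definition pvec :: "nat set set \<Rightarrow> triple \<Rightarrow> rat"
  where "pvec P T = (if transv P T
    then wsign (word_of (SOME bs. distinct bs \<and> set bs = big_blocks P) T) else 0)"

definition tact :: "(nat \<Rightarrow> nat) \<Rightarrow> triple \<Rightarrow> triple"
  where "tact w = (\<lambda>(X, Y, rs). (w ` X, w ` Y, map w rs))"

lemma tact_comp: "tact v (tact w T) = tact (v \<circ> w) T"
  by (auto simp: tact_def image_comp split: prod.splits)

lemma tact_id [simp]: "tact id T = T"
  by (simp add: tact_def split: prod.splits)

lemma wsign_word_of_perm:
  assumes "distinct bs" "distinct bs'" "set bs = set bs'"
  shows "wsign (word_of bs T) = wsign (word_of bs' T)"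
proof -
  have "mset bs = mset bs'" using assms set_eq_iff_mset_eq_distinct by blast
  from wsign_map_pair_perm[OF this, of "[]" _ "[]"] show ?thesis
    by (simp add: word_of_def split: prod.splits)
qed

lemma pvec_eq:
  assumes "distinct bs" "set bs = big_blocks P"
  shows "pvec P T = (if transv P T then wsign (word_of bs T) else 0)"
proof -
  have "\<exists>bs. distinct bs \<and> set bs = big_blocks P" using assms by blast
  from wsign_word_of_perm[OF _ assms(1), of "SOME bs. distinct bs \<and> set bs = big_blocks P"] someI_ex[OF this]
  show ?thesis using assms(2) unfolding pvec_def by metis
qed

lemma pick_inter: "is_singleton (X \<inter> B) \<Longrightarrow> X \<inter> B = {pick X B}"
  by (simp add: pick_def is_singleton_the_elem)

lemma pick_eqI: "X \<inter> B = {x} \<Longrightarrow> pick X B = x"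
  by (simp add: pick_def)

lemma pick_in: "is_singleton (X \<inter> B) \<Longrightarrow> pick X B \<in> X \<and> pick X B \<in> B"
  using pick_inter by blast

lemma transv_pick_image:
  assumes "transv P (X, Y, rs)"
  shows "pick X ` big_blocks P = X" "pick Y ` big_blocks P = Y"
proof -
  have *: "pick Z ` big_blocks P = Z"
    if "\<forall>B\<in>big_blocks P. is_singleton (Z \<inter> B)" "Z \<subseteq> \<Union>(big_blocks P)" for Z
    using that pick_inter[of Z] by blast
  from assms show "pick X ` big_blocks P = X" "pick Y ` big_blocks P = Y"
    by (intro *; auto simp: transv_def)+
qed

lemma set_word_of:
  assumes "transv P T" "set bs = big_blocks P"
  shows "set (word_of bs T) = \<Union>(big_blocks P)"
  using assms transv_pick_image[of P "fst T" "fst (snd T)" "snd (snd T)"]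
  by (auto simp: word_of_def transv_def split: prod.splits)

lemma pvec_nonzeroD:
  assumes "pvec P T \<noteq> 0" "distinct bs" "set bs = big_blocks P"
  shows "transv P T" "distinct (word_of bs T)"
  using assms wsign_eq_0 by (auto simp: pvec_eq split: if_splits)

lemma pvec_big_blocks_cong: "big_blocks P = big_blocks Q \<Longrightarrow> pvec P = pvec Q"
  by (auto simp: pvec_def transv_def fun_eq_iff split: prod.splits)

lemma big_blocks_perm: "inj w \<Longrightarrow> big_blocks (perm_partition w P) = (`) w ` big_blocks P"
  by (auto simp: big_blocks_def perm_partition_def card_image inj_on_subset)

lemma transv_perm:
  assumes "inj w"
  shows "transv (perm_partition w P) (tact w T) \<longleftrightarrow> transv P T"
proof -
  obtain X Y rs where T: "T = (X, Y, rs)" by (cases T)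
  have 1: "is_singleton (w ` Z \<inter> w ` B) \<longleftrightarrow> is_singleton (Z \<inter> B)" for Z B
    using assms by (simp add: is_singleton_altdef card_image inj_on_subset flip: image_Int)
  have 2: "w ` X \<union> w ` Y \<union> w ` set rs = \<Union> ((`) w ` big_blocks P)
      \<longleftrightarrow> X \<union> Y \<union> set rs = \<Union>(big_blocks P)"
    using inj_image_eq_iff[OF assms, of "X \<union> Y \<union> set rs" "\<Union>(big_blocks P)"]
    by (simp add: image_Un image_Union)
  show ?thesis by (simp add: T transv_def tact_def big_blocks_perm[OF assms] 1 2)
qed

lemma word_of_perm:
  assumes "inj w" "transv P T" "set bs = big_blocks P"
  shows "word_of (map ((`) w) bs) (tact w T) = map w (word_of bs T)"
proof -
  have "pick (w ` Z) (w ` B) = w (pick Z B)" if "is_singleton (Z \<inter> B)" for Z B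
  proof (rule pick_eqI)
    show "w ` Z \<inter> w ` B = {w (pick Z B)}"
      using pick_inter[OF that] assms(1) by (simp flip: image_Int)
  qed
  then show ?thesis using assms
    by (auto simp: word_of_def tact_def transv_def split: prod.splits)
qed

lemma pvec_perm:
  assumes "inj w" "distinct bs" "set bs = big_blocks P"
  shows "pvec (perm_partition w P) (tact w T) =
    (if transv P T then wsign (map w (word_of bs T)) else 0)"
proof -
  have "distinct (map ((`) w) bs)"
    using assms by (auto simp: distinct_map inj_on_def inj_image_eq_iff)
  moreover have "set (map ((`) w) bs) = big_blocks (perm_partition w P)"
    using assms by (simp add: big_blocks_perm)
  ultimately show ?thesis
    using assms by (simp add: pvec_eq transv_perm word_of_perm)
qed

lemma inj_adj: "inj (adj i)"
  by (rule inj_transpose)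

text \<open>Relabelling the partition and the triple together relabels the letters of the word,
  which are the elements of the non-singleton blocks; the sign is then that of
  \<open>wsign_map_adj\<close>.\<close>

lemma pvec_adj:
  assumes "finite (big_blocks P)"
  shows "pvec (perm_partition (adj i) P) (tact (adj i) T) =
    (if i \<in> \<Union>(big_blocks P) \<and> i + 1 \<in> \<Union>(big_blocks P) then - 1 else 1) * pvec P T"
proof -
  obtain bs where bs: "distinct bs" "set bs = big_blocks P"
    using finite_distinct_list[OF assms] by blast
  show ?thesis
  proof (cases "transv P T \<and> distinct (word_of bs T)")
    case True
    then show ?thesis
      using set_word_of[of P T bs] bs
      unfolding pvec_perm[OF inj_adj bs] pvec_eq[OF bs] by (simp only: wsign_map_adj) simp
  next
    case False
    then have "pvec P T = 0" using pvec_nonzeroD bs by blast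
    moreover have "distinct (map (adj i) (word_of bs T)) \<longleftrightarrow> distinct (word_of bs T)"
      using inj_adj by (simp add: distinct_map inj_on_subset)
    ultimately show ?thesis
      using False unfolding pvec_perm[OF inj_adj bs] by (auto intro: wsign_eq_0)
  qed
qed

text \<open>
  If \<open>x\<close>, \<open>x'\<close> are the two elements of a transversal in \<open>C \<union> D\<close>, then \<open>delta x x' C\<close> is
  \<open>1\<close> or \<open>- 1\<close> if they are separated by \<open>C\<close>, \<open>D\<close> and \<open>0\<close> otherwise.
\<close>

definition delta :: "nat \<Rightarrow> nat \<Rightarrow> nat set \<Rightarrow> rat"
  where "delta x x' C = of_bool (x \<in> C) - of_bool (x' \<in> C)"

lemma delta_Un: "C \<inter> D = {} \<Longrightarrow> delta x x' (C \<union> D) = delta x x' C + delta x x' D"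
  by (auto simp: delta_def)

lemma delta_insert: "a \<notin> C \<Longrightarrow> delta x x' (insert a C) = delta x x' {a} + delta x x' C"
  by (auto simp: delta_def)

lemma delta_UNIV: "x \<in> U \<Longrightarrow> x' \<in> U \<Longrightarrow> delta x x' U = 0"
  by (auto simp: delta_def)

lemma delta_sum: "finite C \<Longrightarrow> delta x x' C = (\<Sum>a\<in>C. delta x x' {a})"
proof (induction rule: finite_induct)
  case empty
  then show ?case by (simp add: delta_def)
next
  case (insert a C)
  then show ?case by (simp add: delta_insert[of a C])
qed

text \<open>A single point can meet only one of two disjoint pairs. So a block of size one would
  contribute 0, which matches the terms deleted from the skein map.\<close>

lemma delta_single: "{x, x'} \<inter> {y, y'} = {} \<Longrightarrow> delta x x' {a} * delta y y' {a} = 0"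
  by (auto simp: delta_def)

section \<open>Partitions that differ only in two blocks with fixed union\<close>

lemma big_blocks_two:
  assumes "card C \<ge> 2" "card D \<ge> 2"
  shows "big_blocks (R \<union> {C, D}) = big_blocks R \<union> {C, D}"
  using assms by (auto simp: big_blocks_def)

text \<open>A nonzero coordinate requires that X and Y meet U in disjoint pairs x, x' and y, y'.
  With C and D enumerated first, the letters of each pair are adjacent in the word, so exchanging
  which of them lies in C flips the sign, as it does for \<open>delta\<close>. Hence
  \<open>c\<close> is the sign of the word with the pairs in the order x, x' and y, y'. If there are
  no such pairs, \<open>c\<close> is 0 and the points are dummies.\<close>

lemma pvec_two_blocks:
  fixes T :: triple
  assumes "finite R" "U \<inter> \<Union>R = {}"
  obtains c x x' y y' where
    "c \<noteq> 0 \<Longrightarrow> {x, x', y, y'} \<subseteq> U \<and> {x, x'} \<inter> {y, y'} = {}"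
    "\<And>C D. C \<union> D = U \<Longrightarrow> C \<inter> D = {} \<Longrightarrow> card C \<ge> 2 \<Longrightarrow> card D \<ge> 2 \<Longrightarrow>
      pvec (R \<union> {C, D}) T = c * (delta x x' C * delta y y' C)"
proof -
  obtain X Y rs where T: "T = (X, Y, rs)" by (cases T)
  have "finite (big_blocks R)" using assms by (simp add: big_blocks_def)
  then obtain br where br: "distinct br" "set br = big_blocks R"
    using finite_distinct_list by blast
  define com where "com \<longleftrightarrow> (\<forall>B\<in>big_blocks R. is_singleton (X \<inter> B) \<and> is_singleton (Y \<inter> B)) \<and>
    X \<union> Y \<union> set rs = \<Union>(big_blocks R) \<union> U"
  have transv: "transv (R \<union> {C, D}) T \<longleftrightarrow> com \<and> is_singleton (X \<inter> C) \<and> is_singleton (Y \<inter> C)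
      \<and> is_singleton (X \<inter> D) \<and> is_singleton (Y \<inter> D)"
    if "C \<union> D = U" "card C \<ge> 2" "card D \<ge> 2" for C D
    unfolding transv_def T com_def prod.case big_blocks_two[OF that(2,3)] Union_Un_distrib ball_Un
    using that(1) by simp (metis sup_assoc)
  have pv: "pvec (R \<union> {C, D}) T = (if com \<and> is_singleton (X \<inter> C) \<and> is_singleton (Y \<inter> C)
      \<and> is_singleton (X \<inter> D) \<and> is_singleton (Y \<inter> D)
      then wsign ([pick X C, pick X D] @ map (pick X) br @ [pick Y C, pick Y D] @ map (pick Y) br @ rs)
      else 0)"
    if "C \<union> D = U" "C \<inter> D = {}" "card C \<ge> 2" "card D \<ge> 2" for C D
  proof -
    have "C \<noteq> {}" "D \<noteq> {}" using that by auto
    then have "C \<notin> R" "D \<notin> R" "C \<noteq> D" using that assms by auto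
    then have bs: "distinct (C # D # br)" "set (C # D # br) = big_blocks (R \<union> {C, D})"
      unfolding big_blocks_two[OF that(3,4)] using br(2) \<open>C \<noteq> D\<close>
      by (simp_all add: br(1)) (simp_all add: big_blocks_def \<open>C \<notin> R\<close> \<open>D \<notin> R\<close>)
    show ?thesis
      unfolding pvec_eq[OF bs] transv[OF that(1,3,4)]
      by (simp add: word_of_def T)
  qed
  define ok where "ok x x' y y' \<longleftrightarrow> com \<and> X \<inter> U = {x, x'} \<and> Y \<inter> U = {y, y'} \<and> x \<noteq> x' \<and> y \<noteq> y'
    \<and> {x, x'} \<inter> {y, y'} = {}" for x x' y y'
  show ?thesis
  proof (cases "\<exists>x x' y y'. ok x x' y y'")
    case True
    then obtain x x' y y' where ok: "ok x x' y y'" by blast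
    define s where "s a a' b b' = wsign ([a, a'] @ map (pick X) br @ [b, b'] @ map (pick Y) br @ rs)"
      for a a' b b'
    have sx: "s a' a b b' = - s a a' b b'" for a a' b b'
      using wsign_adjacent[of "[]" a' a] unfolding s_def by (simp only: append_Nil append_Cons)
    have sy: "s a a' b' b = - s a a' b b'" for a a' b b'
      using wsign_adjacent[of "[a, a'] @ map (pick X) br" b' b]
      unfolding s_def by (simp only: append_Nil append_Cons append_assoc)
    have com: com and XU: "X \<inter> U = {x, x'}" "Y \<inter> U = {y, y'}" and ne: "x \<noteq> x'" "y \<noteq> y'"
      and disj: "{x, x'} \<inter> {y, y'} = {}"
      using ok unfolding ok_def by blast+
    show ?thesis
    proof (rule that[of "s x x' y y'" x x' y y'])
      show "{x, x', y, y'} \<subseteq> U \<and> {x, x'} \<inter> {y, y'} = {}"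
        using XU disj by blast
    next
      fix C D assume CD: "C \<union> D = U" "C \<inter> D = {}" "card C \<ge> 2" "card D \<ge> 2"
      have C: "X \<inter> C = {x, x'} \<inter> C" "Y \<inter> C = {y, y'} \<inter> C" "X \<inter> D = {x, x'} \<inter> D" "Y \<inter> D = {y, y'} \<inter> D"
        using XU CD(1) by blast+
      have mem: "(x \<in> D) = (x \<notin> C)" "(x' \<in> D) = (x' \<notin> C)" "(y \<in> D) = (y \<notin> C)" "(y' \<in> D) = (y' \<notin> C)"
        using XU CD(1,2) by blast+
      have sing: "is_singleton ({a, b} \<inter> E) \<longleftrightarrow> (a \<in> E) \<noteq> (b \<in> E)" if "a \<noteq> b" for a b :: nat and E
        using that by (cases "a \<in> E"; cases "b \<in> E") (simp_all add: is_singleton_altdef)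
      have the: "the_elem ({a, b} \<inter> E) = (if a \<in> E then a else b)" if "(a \<in> E) \<noteq> (b \<in> E)"
        for a b :: nat and E
      proof -
        have "{a, b} \<inter> E = {if a \<in> E then a else b}" using that by auto
        then show ?thesis by simp
      qed
      show "pvec (R \<union> {C, D}) T = s x x' y y' * (delta x x' C * delta y y' C)"
        unfolding pv[OF CD] s_def[symmetric] pick_def C sing[OF ne(1)] sing[OF ne(2)] mem
        using com ne
        by (cases "x \<in> C"; cases "x' \<in> C"; cases "y \<in> C"; cases "y' \<in> C")
           (simp_all add: the mem delta_def sx[of x' x] sy[of _ _ y' y] split del: if_split)
    qed
  next
    case False
    show ?thesis
    proof (rule that[of 0 0 0 0 0])
      fix C D assume CD: "C \<union> D = U" "C \<inter> D = {}" "card C \<ge> 2" "card D \<ge> 2"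
      have "pvec (R \<union> {C, D}) T = 0"
      proof (rule ccontr)
        assume "pvec (R \<union> {C, D}) T \<noteq> 0"
        with wsign_eq_0 have com: com and
          si: "is_singleton (X \<inter> C)" "is_singleton (Y \<inter> C)" "is_singleton (X \<inter> D)" "is_singleton (Y \<inter> D)"
          and di: "distinct ([pick X C, pick X D] @ map (pick X) br @ [pick Y C, pick Y D] @ map (pick Y) br @ rs)"
          unfolding pv[OF CD] by (metis (no_types, lifting))+
        have "X \<inter> U = {pick X C, pick X D}" "Y \<inter> U = {pick Y C, pick Y D}"
          using si[THEN pick_inter] CD by blast+
        then have "ok (pick X C) (pick X D) (pick Y C) (pick Y D)"
          using com di by (auto simp: ok_def)
        with False show False by blast
      qed
      then show "pvec (R \<union> {C, D}) T = 0 * (delta 0 0 C * delta 0 0 C)" by simp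
    qed simp
  qed
qed

text \<open>Let u, v, a, b be the values of \<open>delta x x'\<close> at i, i', A, B and p, q, r, t
  those of \<open>delta y y'\<close>. Then u + v + a + b = 0 and p + q + r + t = 0, as the union
  contains both pairs, and u p = v q = 0 by \<open>delta_single\<close>. Up to the factor
  \<open>c\<close> the claim is (u + a)(p + r) + (v + a)(q + r) + (u + v)(p + q) = a r + b
  t.\<close>

lemma skein_relation:
  assumes "finite R" "({i, i'} \<union> A \<union> B) \<inter> \<Union>R = {}" "i \<noteq> i'" "i \<notin> A \<union> B" "i' \<notin> A \<union> B"
    "A \<inter> B = {}" "finite A" "finite B" "A \<noteq> {}" "B \<noteq> {}"
  shows "pvec (R \<union> {insert i A, insert i' B}) T =
    - (pvec (R \<union> {insert i' A, insert i B}) T + pvec (R \<union> {{i, i'}, A \<union> B}) T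
      - (if card B = 1 then 0 else pvec (R \<union> {{i, i'} \<union> A, B}) T)
      - (if card A = 1 then 0 else pvec (R \<union> {{i, i'} \<union> B, A}) T))"
proof -
  let ?U = "{i, i'} \<union> A \<union> B"
  obtain c x x' y y' where
    c: "c \<noteq> 0 \<Longrightarrow> {x, x', y, y'} \<subseteq> ?U \<and> {x, x'} \<inter> {y, y'} = {}" and
    pv: "\<And>C D. C \<union> D = ?U \<Longrightarrow> C \<inter> D = {} \<Longrightarrow> card C \<ge> 2 \<Longrightarrow> card D \<ge> 2 \<Longrightarrow>
      pvec (R \<union> {C, D}) T = c * (delta x x' C * delta y y' C)"
    using pvec_two_blocks[OF assms(1,2)] by metis
  have cA: "card A \<ge> 1" "card B \<ge> 1" using assms by (simp_all add: Suc_le_eq card_gt_0_iff)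
  have p0: "pvec (R \<union> {insert i A, insert i' B}) T = c * (delta x x' (insert i A) * delta y y' (insert i A))"
    using assms cA by (intro pv) auto
  have p1: "pvec (R \<union> {insert i' A, insert i B}) T = c * (delta x x' (insert i' A) * delta y y' (insert i' A))"
    using assms cA by (intro pv) auto
  have p2: "pvec (R \<union> {{i, i'}, A \<union> B}) T = c * (delta x x' {i, i'} * delta y y' {i, i'})"
    using assms cA by (intro pv) (auto simp: card_Un_disjoint)
  have d: "delta a b ({i, i'} \<union> D) = delta a b {i} + delta a b {i'} + delta a b D"
    "delta a b {i, i'} = delta a b {i} + delta a b {i'}" if "D = A \<or> D = B" for a b D
    using that assms delta_insert[of i "insert i' D" a b] delta_insert[of i' D a b]
      delta_insert[of i "{i'}" a b] by auto
  have "delta a b ?U = delta a b {i} + delta a b {i'} + delta a b A + delta a b B" for a b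
    using delta_Un[of "{i, i'} \<union> A" B a b] d[of A a b] assms by auto
  with c have z: "c \<noteq> 0 \<Longrightarrow> delta x x' B = - (delta x x' {i} + delta x x' {i'} + delta x x' A)"
    "c \<noteq> 0 \<Longrightarrow> delta y y' B = - (delta y y' {i} + delta y y' {i'} + delta y y' A)"
    using delta_UNIV[of x ?U x'] delta_UNIV[of y ?U y'] by (simp_all add: algebra_simps)
  \<comment> \<open>A block and its complement in the union have opposite \<open>delta\<close>
    values, so the product can be read off from the complementary block B or A.\<close>
  have neg: "delta x x' ({i, i'} \<union> A) = - delta x x' B" "delta y y' ({i, i'} \<union> A) = - delta y y' B"
    "delta x x' ({i, i'} \<union> B) = - delta x x' A" "delta y y' ({i, i'} \<union> B) = - delta y y' A"
    if "c \<noteq> 0"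
    by (simp_all only: d(1) z[OF that] simp_thms)
  have s: "c \<noteq> 0 \<Longrightarrow> delta x x' D * delta y y' D = 0" if "card D = 1" for D
    using c delta_single that by (metis card_1_singletonE)
  have p3: "(if card B = 1 then 0 else pvec (R \<union> {{i, i'} \<union> A, B}) T) = c * (delta x x' B * delta y y' B)"
  proof (cases "card B = 1")
    case False
    then have "pvec (R \<union> {{i, i'} \<union> A, B}) T = c * (delta x x' ({i, i'} \<union> A) * delta y y' ({i, i'} \<union> A))"
      using assms cA by (intro pv) auto
    also have "\<dots> = c * (delta x x' B * delta y y' B)"
    proof (cases "c = 0")
      case False
      show ?thesis unfolding neg[OF False] by simp
    qed simp
    finally show ?thesis using False by simp
  qed (use s in auto)
  have p4: "(if card A = 1 then 0 else pvec (R \<union> {{i, i'} \<union> B, A}) T) = c * (delta x x' A * delta y y' A)"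
  proof (cases "card A = 1")
    case False
    then have "pvec (R \<union> {{i, i'} \<union> B, A}) T = c * (delta x x' ({i, i'} \<union> B) * delta y y' ({i, i'} \<union> B))"
      using assms cA by (intro pv) auto
    also have "\<dots> = c * (delta x x' A * delta y y' A)"
    proof (cases "c = 0")
      case False
      show ?thesis unfolding neg[OF False] by simp
    qed simp
    finally show ?thesis using False by simp
  qed (use s in auto)
  have i: "c \<noteq> 0 \<Longrightarrow> delta x x' {i} * delta y y' {i} = 0" "c \<noteq> 0 \<Longrightarrow> delta x x' {i'} * delta y y' {i'} = 0"
    using s by auto
  have ins: "delta a b (insert i A) = delta a b {i} + delta a b A"
    "delta a b (insert i' A) = delta a b {i'} + delta a b A" for a b
    using assms by (auto intro: delta_insert)
  show ?thesis
  proof (cases "c = 0")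
    case False
    note i = i[OF False] and z = z[OF False]
    show ?thesis
      unfolding p0 p1 p2 p3 p4 ins d(2)[of A, simplified] z
      using i by algebra
  qed (unfold p0 p1 p2 p3 p4, simp)
qed

text \<open>Expand the product of the two \<open>delta\<close> values of C over ordered pairs of
  elements a, b of C. The block {a, b} carries both mixed products, since the diagonal ones vanish,
  so the sum over ordered pairs counts each product twice. This trades two large blocks for a pair
  and one large block.\<close>

lemma pvec_split_pairs:
  assumes "finite R" "(C \<union> D) \<inter> \<Union>R = {}" "C \<inter> D = {}" "card C \<ge> 2" "card D \<ge> 2"
  shows "2 * pvec (R \<union> {C, D}) T =
    (\<Sum>a\<in>C. \<Sum>b\<in>C - {a}. pvec (R \<union> {{a, b}, (C \<union> D) - {a, b}}) T)"
proof -
  obtain c x x' y y' where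
    c: "c \<noteq> 0 \<Longrightarrow> {x, x', y, y'} \<subseteq> C \<union> D \<and> {x, x'} \<inter> {y, y'} = {}" and
    pv: "\<And>C' D'. C' \<union> D' = C \<union> D \<Longrightarrow> C' \<inter> D' = {} \<Longrightarrow> card C' \<ge> 2 \<Longrightarrow> card D' \<ge> 2 \<Longrightarrow>
      pvec (R \<union> {C', D'}) T = c * (delta x x' C' * delta y y' C')"
    using pvec_two_blocks[OF assms(1,2)] by metis
  have fin: "finite C" "finite D"
    using assms(4,5) by (auto intro: card_ge_0_finite)
  let ?d = "\<lambda>a. delta x x' {a}" and ?e = "\<lambda>a. delta y y' {a}"
  have dz: "c \<noteq> 0 \<Longrightarrow> ?d z * ?e z = 0" for z
    by (rule delta_single) (use c in blast)
  have pab: "pvec (R \<union> {{a, b}, (C \<union> D) - {a, b}}) T = c * (?d a * ?e b + ?d b * ?e a)"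
    if "a \<in> C" "b \<in> C - {a}" for a b
  proof -
    have "card D \<le> card ((C \<union> D) - {a, b})"
      using that assms(3) fin by (intro card_mono) auto
    with assms(5) have "card ((C \<union> D) - {a, b}) \<ge> 2" by (rule order_trans)
    moreover have "{a, b} \<union> ((C \<union> D) - {a, b}) = C \<union> D" "card {a, b} \<ge> 2"
      using that by auto
    ultimately have "pvec (R \<union> {{a, b}, (C \<union> D) - {a, b}}) T = c * (delta x x' {a, b} * delta y y' {a, b})"
      by (intro pv) blast+
    moreover note dz[of a] dz[of b]
    moreover have "delta p q {a, b} = delta p q {a} + delta p q {b}" for p q
      using that delta_insert[of a "{b}"] by simp
    ultimately show ?thesis by (cases "c = 0") (simp_all add: algebra_simps)
  qed
  have "(\<Sum>a\<in>C. \<Sum>b\<in>C - {a}. pvec (R \<union> {{a, b}, (C \<union> D) - {a, b}}) T)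
      = (\<Sum>a\<in>C. \<Sum>b\<in>C - {a}. c * (?d a * ?e b + ?d b * ?e a))"
    by (intro sum.cong refl) (use pab in auto)
  also have "\<dots> = (\<Sum>a\<in>C. \<Sum>b\<in>C. c * (?d a * ?e b + ?d b * ?e a))"
  proof (rule sum.cong[OF refl])
    fix a assume "a \<in> C"
    have "c * (?d a * ?e a) = 0" using dz by auto
    then show "(\<Sum>b\<in>C - {a}. c * (?d a * ?e b + ?d b * ?e a)) = (\<Sum>b\<in>C. c * (?d a * ?e b + ?d b * ?e a))"
      using fin \<open>a \<in> C\<close> by (simp add: sum.remove[of C a] del: mult_eq_0_iff)
  qed
  also have "\<dots> = 2 * (c * ((\<Sum>a\<in>C. ?d a) * (\<Sum>b\<in>C. ?e b)))"
  proof -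
    have eq: "(\<Sum>a\<in>C. \<Sum>b\<in>C. c * (?d b * ?e a)) = (\<Sum>a\<in>C. \<Sum>b\<in>C. c * (?d a * ?e b))"
      by (rule sum.swap)
    have "(\<Sum>a\<in>C. \<Sum>b\<in>C. c * (?d a * ?e b + ?d b * ?e a))
        = 2 * (\<Sum>a\<in>C. \<Sum>b\<in>C. c * (?d a * ?e b))"
      by (simp only: distrib_left sum.distrib eq mult_2)
    also have "(\<Sum>a\<in>C. \<Sum>b\<in>C. c * (?d a * ?e b)) = c * ((\<Sum>a\<in>C. ?d a) * (\<Sum>b\<in>C. ?e b))"
      unfolding sum_product by (simp only: sum_distrib_left)
    finally show ?thesis .
  qed
  also have "\<dots> = 2 * pvec (R \<union> {C, D}) T"
    unfolding pv[OF refl assms(3-5)] by (simp only: delta_sum[OF fin(1), symmetric])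
  finally show ?thesis by simp
qed

section \<open>Resolving crossings\<close>

definition crosses :: "nat set \<Rightarrow> nat set \<Rightarrow> bool"
  where "crosses A B \<longleftrightarrow> (\<exists>a b c d. a < b \<and> b < c \<and> c < d \<and> a \<in> A \<and> c \<in> A \<and> b \<in> B \<and> d \<in> B)"

definition uncrossed :: "nat set \<Rightarrow> nat set \<Rightarrow> bool"
  where "uncrossed A B \<longleftrightarrow> \<not> crosses A B \<and> \<not> crosses B A"

lemma crossesI: "a < b \<Longrightarrow> b < c \<Longrightarrow> c < d \<Longrightarrow> a \<in> A \<Longrightarrow> c \<in> A \<Longrightarrow> b \<in> B \<Longrightarrow> d \<in> B \<Longrightarrow> crosses A B"
  unfolding crosses_def by blast

lemma uncrossed_sym: "uncrossed A B \<longleftrightarrow> uncrossed B A"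
  by (auto simp: uncrossed_def)

lemma noncrossing_iff: "noncrossing P \<longleftrightarrow> (\<forall>A\<in>P. \<forall>B\<in>P. A \<noteq> B \<longrightarrow> uncrossed A B)"
proof -
  have "noncrossing P \<longleftrightarrow> (\<forall>A\<in>P. \<forall>B\<in>P. crosses A B \<longrightarrow> A = B)"
    unfolding noncrossing_def crosses_def by (simp only: insert_subset empty_subsetI simp_thms) blast
  then show ?thesis unfolding uncrossed_def by blast
qed

lemma noncrossing_pairD: "noncrossing P \<Longrightarrow> A \<in> P \<Longrightarrow> B \<in> P \<Longrightarrow> A \<noteq> B \<Longrightarrow> uncrossed A B"
  by (simp add: noncrossing_iff)

lemma noncrossing_mono: "noncrossing P \<Longrightarrow> Q \<subseteq> P \<Longrightarrow> noncrossing Q"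
  unfolding noncrossing_iff by blast

lemma noncrossing_two:
  assumes "noncrossing R" "\<And>E. E \<in> R \<Longrightarrow> uncrossed C E" "\<And>E. E \<in> R \<Longrightarrow> uncrossed D E" "uncrossed C D"
  shows "noncrossing (R \<union> {C, D})"
  using assms unfolding noncrossing_iff by (metis Un_iff insert_iff uncrossed_sym singletonD)

lemma uncrossed_mono: "uncrossed A B \<Longrightarrow> A' \<subseteq> A \<Longrightarrow> B' \<subseteq> B \<Longrightarrow> uncrossed A' B'"
  unfolding uncrossed_def crosses_def by blast

text \<open>Symmetric, so that one statement covers i and i + 1 in both roles.\<close>

definition adjacent :: "nat \<Rightarrow> nat \<Rightarrow> bool"
  where "adjacent p q \<longleftrightarrow> q = p + 1 \<or> p = q + 1"

text \<open>Collapsing q to p preserves all comparisons with elements of B, because none of them is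
  equal to p or q or lies between. A crossing is thus carried to one that involves only
  \<open>insert p A\<close>.\<close>

lemma uncrossed_insert_adjacent:
  assumes "uncrossed (insert p A) B" "adjacent p q" "p \<notin> B" "q \<notin> B"
  shows "uncrossed ({p, q} \<union> A) B"
proof -
  define f where "f x = (if x = q then p else x)" for x
  have mem: "f x \<in> insert p A" if "x \<in> {p, q} \<union> A" for x
    using that by (auto simp: f_def)
  have less: "f x < b \<longleftrightarrow> x < b" "b < f x \<longleftrightarrow> b < x" if "b \<in> B" for x b
  proof -
    from that have "b \<noteq> p" "b \<noteq> q" using assms by auto
    then show "f x < b \<longleftrightarrow> x < b" "b < f x \<longleftrightarrow> b < x"
      using assms(2) unfolding adjacent_def f_def by (auto split: if_splits)
  qed
  have "\<not> crosses ({p, q} \<union> A) B"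
  proof
    assume "crosses ({p, q} \<union> A) B"
    then obtain a b c d where "a < b" "b < c" "c < d" "a \<in> {p, q} \<union> A" "c \<in> {p, q} \<union> A" "b \<in> B" "d \<in> B"
      unfolding crosses_def by blast
    then have "crosses (insert p A) B"
      by (intro crossesI[of "f a" b "f c" d] mem) (simp_all add: less)
    with assms(1) show False by (simp add: uncrossed_def)
  qed
  moreover have "\<not> crosses B ({p, q} \<union> A)"
  proof
    assume "crosses B ({p, q} \<union> A)"
    then obtain a b c d where "a < b" "b < c" "c < d" "b \<in> {p, q} \<union> A" "d \<in> {p, q} \<union> A" "a \<in> B" "c \<in> B"
      unfolding crosses_def by blast
    then have "crosses B (insert p A)"
      by (intro crossesI[of a "f b" c "f d"] mem) (simp_all add: less)
    with assms(1) show False by (simp add: uncrossed_def)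
  qed
  ultimately show ?thesis by (simp add: uncrossed_def)
qed

lemma uncrossed_pair_adjacent:
  assumes "adjacent p q" "p \<notin> B" "q \<notin> B"
  shows "uncrossed {p, q} B"
proof -
  have "uncrossed (insert p {}) B" by (auto simp: uncrossed_def crosses_def)
  from uncrossed_insert_adjacent[OF this assms] show ?thesis by simp
qed

text \<open>Only a crossing that uses one element of A and one of B is new. There p or q serves as a
  third point: both lie on the same side of every element of C, and their position relative to the
  two elements of C decides which of the original blocks crosses C.\<close>

lemma uncrossed_merge:
  assumes "uncrossed (insert p A) C" "uncrossed (insert q B) C" "adjacent p q" "p \<notin> C" "q \<notin> C"
  shows "uncrossed (A \<union> B) C"
proof -
  have side: "x < p \<longleftrightarrow> x < q" "p < x \<longleftrightarrow> q < x" "x \<noteq> p" "x \<noteq> q" if "x \<in> C" for x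
  proof -
    from that have "x \<noteq> p" "x \<noteq> q" using assms by auto
    then show "x < p \<longleftrightarrow> x < q" "p < x \<longleftrightarrow> q < x" "x \<noteq> p" "x \<noteq> q"
      using assms(3) unfolding adjacent_def by auto
  qed
  have nc: False if "crosses (insert p A) C \<or> crosses C (insert p A) \<or> crosses (insert q B) C \<or> crosses C (insert q B)"
    using that assms(1,2) by (auto simp: uncrossed_def)
  have 1: False if "a < b" "b < c" "c < d" "a \<in> Z" "c \<in> Z'" "b \<in> C" "d \<in> C"
    "Z = A \<and> Z' = B \<and> z = p \<and> z' = q \<or> Z = B \<and> Z' = A \<and> z = q \<and> z' = p" for a b c d Z Z' z z'
  proof -
    have s: "b < z \<longleftrightarrow> b < z'" "z < d \<longleftrightarrow> z' < d" "z < b \<longleftrightarrow> z' < b" "d < z \<longleftrightarrow> d < z'"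
      "z \<noteq> b" "z \<noteq> d"
      using that side by blast+
    consider "b < z" "z < d" | "z < b" | "d < z" using s by linarith
    then have "crosses (insert z Z) C \<or> crosses (insert z' Z') C \<or> crosses C (insert z' Z')"
    proof cases
      case 1
      then show ?thesis using that crossesI[of a b z d "insert z Z" C] by blast
    next
      case 2
      then show ?thesis using that s crossesI[of z' b c d "insert z' Z'" C] by blast
    next
      case 3
      then show ?thesis using that s crossesI[of b c d z' C "insert z' Z'"] by blast
    qed
    then show False using nc that by blast
  qed
  have 2: False if "a < b" "b < c" "c < d" "b \<in> Z" "d \<in> Z'" "a \<in> C" "c \<in> C"
    "Z = A \<and> Z' = B \<and> z = p \<and> z' = q \<or> Z = B \<and> Z' = A \<and> z = q \<and> z' = p" for a b c d Z Z' z z'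
  proof -
    have s: "a < z \<longleftrightarrow> a < z'" "z < c \<longleftrightarrow> z' < c" "z < a \<longleftrightarrow> z' < a" "c < z \<longleftrightarrow> c < z'"
      "z \<noteq> a" "z \<noteq> c"
      using that side by blast+
    consider "a < z" "z < c" | "z < a" | "c < z" using s by linarith
    then have "crosses C (insert z' Z') \<or> crosses (insert z Z) C \<or> crosses C (insert z Z)"
    proof cases
      case 1
      then show ?thesis using that s crossesI[of a z' c d C "insert z' Z'"] by blast
    next
      case 2
      then show ?thesis using that crossesI[of z a b c "insert z Z" C] by blast
    next
      case 3
      then show ?thesis using that crossesI[of a b c z C "insert z Z"] by blast
    qed
    then show False using nc that by blast
  qed
  have "\<not> crosses (A \<union> B) C"
  proof
    assume "crosses (A \<union> B) C"
    then obtain a b c d where abcd: "a < b" "b < c" "c < d" "a \<in> A \<union> B" "c \<in> A \<union> B" "b \<in> C" "d \<in> C"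
      unfolding crosses_def by blast
    consider "a \<in> A" "c \<in> A" | "a \<in> B" "c \<in> B" | "a \<in> A" "c \<in> B" | "a \<in> B" "c \<in> A"
      using abcd by blast
    then show False
    proof cases
      case 1 then show False using abcd crossesI[of a b c d "insert p A" C] nc by blast
    next
      case 2 then show False using abcd crossesI[of a b c d "insert q B" C] nc by blast
    next
      case 3 then show False using abcd 1[of a b c d A B p q] by blast
    next
      case 4 then show False using abcd 1[of a b c d B A q p] by blast
    qed
  qed
  moreover have "\<not> crosses C (A \<union> B)"
  proof
    assume "crosses C (A \<union> B)"
    then obtain a b c d where abcd: "a < b" "b < c" "c < d" "b \<in> A \<union> B" "d \<in> A \<union> B" "a \<in> C" "c \<in> C"
      unfolding crosses_def by blast
    consider "b \<in> A" "d \<in> A" | "b \<in> B" "d \<in> B" | "b \<in> A" "d \<in> B" | "b \<in> B" "d \<in> A"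
      using abcd by blast
    then show False
    proof cases
      case 1 then show False using abcd crossesI[of a b c d C "insert p A"] nc by blast
    next
      case 2 then show False using abcd crossesI[of a b c d C "insert q B"] nc by blast
    next
      case 3 then show False using abcd 2[of a b c d A B p q] by blast
    next
      case 4 then show False using abcd 2[of a b c d B A q p] by blast
    qed
  qed
  ultimately show ?thesis by (simp add: uncrossed_def)
qed

text \<open>These are the terms pi_2 and pi_3 of the skein map; exchanging the roles of p, A and q,
  B turns the latter into pi_4.\<close>

lemma noncrossing_resolve:
  assumes nc: "noncrossing (R \<union> {insert p A, insert q B})" and adj: "adjacent p q"
    and disj: "({p, q} \<union> A \<union> B) \<inter> \<Union>R = {}" "p \<notin> A \<union> B" "q \<notin> A \<union> B" "A \<inter> B = {}"
  shows "noncrossing (R \<union> {{p, q}, A \<union> B})" "noncrossing (R \<union> {{p, q} \<union> A, B})"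
proof -
  have ne: "insert p A \<noteq> insert q B" using adj disj by (auto simp: adjacent_def)
  have out: "p \<notin> E" "q \<notin> E" "insert p A \<noteq> E" "insert q B \<noteq> E" if "E \<in> R" for E
    using that disj by auto
  have E: "uncrossed (insert p A) E" "uncrossed (insert q B) E" if "E \<in> R" for E
    using that out[OF that] by (auto intro!: noncrossing_pairD[OF nc])
  have AB: "uncrossed (insert p A) (insert q B)"
    by (rule noncrossing_pairD[OF nc _ _ ne]) simp_all
  have R: "noncrossing R" using nc noncrossing_mono by blast
  show "noncrossing (R \<union> {{p, q}, A \<union> B})"
  proof (intro noncrossing_two R uncrossed_pair_adjacent adj)
    fix X assume "X \<in> R"
    then show "p \<notin> X" "q \<notin> X" "uncrossed (A \<union> B) X"
      using out E adj by (auto intro: uncrossed_merge[of p A X q B])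
  qed (use disj in auto)
  show "noncrossing (R \<union> {{p, q} \<union> A, B})"
  proof (intro noncrossing_two R)
    fix X assume "X \<in> R"
    then show "uncrossed ({p, q} \<union> A) X" using E out adj by (intro uncrossed_insert_adjacent) auto
    show "uncrossed B X" using E(2)[OF \<open>X \<in> R\<close>] by (rule uncrossed_mono) auto
  next
    have "uncrossed (insert p A) B" using AB by (rule uncrossed_mono) auto
    then show "uncrossed ({p, q} \<union> A) B" using adj disj by (intro uncrossed_insert_adjacent) auto
  qed
qed

section \<open>Adjacent transpositions and noncrossing partitions\<close>

lemma noncrossingD:
  assumes "noncrossing P" "A \<in> P" "B \<in> P" "a \<in> A" "c \<in> A" "b \<in> B" "d \<in> B" "a < b" "b < c" "c < d"
  shows "A = B"
  using assms unfolding noncrossing_def by blast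

text \<open>In each of the six positions of a and b relative to i and i + 1, the four points cross
  either before or after the swap. So \<open>tau_basis\<close> acts by mere permutation only if i or
  i + 1 is a singleton, where \<open>pvec_adj\<close> gives no sign.\<close>

lemma crossing_adj_big:
  assumes P: "partition_on S P" "noncrossing P"
    and I: "I \<in> P" "i \<in> I" "a \<in> I" "a \<noteq> i" and J: "J \<in> P" "i + 1 \<in> J" "b \<in> J" "b \<noteq> i + 1" and "I \<noteq> J"
  shows "\<not> noncrossing (perm_partition (adj i) P)"
proof
  assume nc: "noncrossing (perm_partition (adj i) P)"
  have IJ: "I \<inter> J = {}" using P I J \<open>I \<noteq> J\<close> by (auto simp: partition_on_def disjoint_def)
  then have ab: "a \<noteq> i" "a \<noteq> i + 1" "b \<noteq> i" "b \<noteq> i + 1" "a \<noteq> b" using I J by auto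
  let ?I = "adj i ` I" and ?J = "adj i ` J"
  have mem: "?I \<in> perm_partition (adj i) P" "?J \<in> perm_partition (adj i) P"
    using I J by (auto simp: perm_partition_def)
  have "?I \<noteq> ?J" using inj_image_eq_iff[OF inj_adj] \<open>I \<noteq> J\<close> by blast
  have "adj i i \<in> ?I" "adj i (i + 1) \<in> ?J" "adj i a \<in> ?I" "adj i b \<in> ?J"
    using I J by blast+
  then have els: "i + 1 \<in> ?I" "a \<in> ?I" "i \<in> ?J" "b \<in> ?J"
    using ab by (simp_all add: transpose_def)
  note D = noncrossingD[OF P(2)] and D' = noncrossingD[OF nc]
  consider "a < i" "i + 1 < b" | "b < i" "i + 1 < a" | "i + 1 < b" "b < a" | "i + 1 < a" "a < b"
    | "a < b" "b < i" | "b < a" "a < i"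
    using ab by linarith
  then show False
  proof cases
    case 1 then show False using D'[OF mem, of a "i + 1" i b] els \<open>?I \<noteq> ?J\<close> by simp
  next
    case 2 then show False using D[OF J(1) I(1), of b "i + 1" i a] I J \<open>I \<noteq> J\<close> by simp
  next
    case 3 then show False using D'[OF mem(2,1), of i b "i + 1" a] els \<open>?I \<noteq> ?J\<close> by simp
  next
    case 4 then show False using D[OF I(1) J(1), of i a "i + 1" b] I J \<open>I \<noteq> J\<close> by simp
  next
    case 5 then show False using D[OF I(1) J(1), of a i b "i + 1"] I J \<open>I \<noteq> J\<close> by simp
  next
    case 6 then show False using D'[OF mem(2,1), of b i a "i + 1"] els \<open>?I \<noteq> ?J\<close> by simp
  qed
qed

text \<open>A singleton takes part in no crossing, and swapping it with a neighbour preserves the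
  order of all other elements.\<close>

lemma noncrossing_adj_singleton:
  assumes P: "partition_on S P" "noncrossing P" and s: "{s} \<in> P" "s = i \<or> s = i + 1"
  shows "noncrossing (perm_partition (adj i) P)"
  unfolding noncrossing_def
proof (intro allI ballI impI, elim conjE)
  fix a b c d A' B'
  assume "A' \<in> perm_partition (adj i) P" "B' \<in> perm_partition (adj i) P"
    and less: "a < b" "b < c" "c < d" and mem: "{a, c} \<subseteq> A'" "{b, d} \<subseteq> B'"
  then obtain A B where AB: "A \<in> P" "B \<in> P" "A' = adj i ` A" "B' = adj i ` B"
    by (auto simp: perm_partition_def)
  have "a \<in> adj i ` A" "c \<in> adj i ` A" "b \<in> adj i ` B" "d \<in> adj i ` B"
    using AB mem by auto
  then obtain a0 b0 c0 d0 where 0: "a = adj i a0" "b = adj i b0" "c = adj i c0" "d = adj i d0"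
    "a0 \<in> A" "c0 \<in> A" "b0 \<in> B" "d0 \<in> B"
    unfolding image_iff by metis
  have "a0 \<noteq> c0" "b0 \<noteq> d0" using 0 less by auto
  have sing: "Z = {s}" if "s \<in> Z" "Z \<in> P" for Z
  proof -
    have "Z \<inter> {s} \<noteq> {}" using that by blast
    then show ?thesis using P(1) s(1) that(2) unfolding partition_on_def disjoint_def by metis
  qed
  have ns: "a0 \<noteq> s" "c0 \<noteq> s" "b0 \<noteq> s" "d0 \<noteq> s"
    using sing AB 0 \<open>a0 \<noteq> c0\<close> \<open>b0 \<noteq> d0\<close> by blast+
  have "x < y" if "adj i x < adj i y" "x \<noteq> s" "y \<noteq> s" for x y
    using that s(2) by (auto simp: transpose_def split: if_splits)
  then have "a0 < b0" "b0 < c0" "c0 < d0" using less ns 0 by auto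
  with 0 have "A = B" using noncrossingD[OF P(2) AB(1,2)] by blast
  then show "A' = B'" using AB by simp
qed

section \<open>Blocks, relabelling and block statistics of set partitions\<close>

lemma block_eq:
  assumes "partition_on S P" "B \<in> P" "i \<in> B"
  shows "block P i = B"
  unfolding block_def
proof (rule the_equality)
  fix C assume "C \<in> P \<and> i \<in> C"
  then show "C = B" using assms unfolding partition_on_def disjoint_def by blast
qed (use assms in blast)

lemma block_in:
  assumes "partition_on S P" "i \<in> S"
  shows "block P i \<in> P" "i \<in> block P i"
proof -
  obtain B where "B \<in> P" "i \<in> B" using assms by (auto simp: partition_on_def)
  then show "block P i \<in> P" "i \<in> block P i" using block_eq[OF assms(1)] by auto
qed

lemma perm_partition_comp: "perm_partition v (perm_partition w P) = perm_partition (v \<circ> w) P"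
  by (auto simp: perm_partition_def image_comp)

lemma perm_partition_id [simp]: "perm_partition id P = P"
  by (simp add: perm_partition_def)

lemma adj_adj: "adj i \<circ> adj i = id"
  by (simp add: fun_eq_iff)

lemma perm_partition_adj_adj: "perm_partition (adj i) (perm_partition (adj i) P) = P"
  using perm_partition_comp[of "adj i" "adj i" P] by (simp only: adj_adj perm_partition_id)

lemma partition_on_perm:
  assumes "partition_on S P" "w permutes S"
  shows "partition_on S (perm_partition w P)"
proof -
  have w: "inj w" "w ` S = S" using assms permutes_inj permutes_image by blast+
  have "w ` A \<inter> w ` B = {}" if "A \<in> P" "B \<in> P" "w ` A \<noteq> w ` B" for A B
  proof -
    have "A \<inter> B = {}" using that assms(1) by (auto simp: partition_on_def disjoint_def)
    then show ?thesis using w(1) by (simp flip: image_Int)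
  qed
  moreover have "\<Union>(perm_partition w P) = w ` \<Union>P"
    by (auto simp: perm_partition_def)
  then have "\<Union>(perm_partition w P) = S"
    using assms(1) w(2) by (simp add: partition_on_def)
  moreover have "{} \<notin> perm_partition w P"
    using assms(1) by (auto simp: perm_partition_def partition_on_def)
  ultimately show ?thesis unfolding partition_on_def disjoint_def by (auto simp: perm_partition_def)
qed

lemma adj_permutes: "i \<in> {1..<n} \<Longrightarrow> adj i permutes {1..n}"
  by (rule permutes_swap_id) auto

definition block_type :: "nat set set \<Rightarrow> nat \<times> nat"
  where "block_type P = (card P, card {B \<in> P. card B = 1})"

lemma block_type_perm:
  assumes "inj w"
  shows "block_type (perm_partition w P) = block_type P"
proof -
  have inj: "inj_on ((`) w) Z" for Z using assms by (simp add: inj_on_def inj_image_eq_iff)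
  have "{B \<in> perm_partition w P. card B = 1} = (`) w ` {B \<in> P. card B = 1}"
    using assms by (auto simp: perm_partition_def card_image inj_on_subset)
  then show ?thesis by (simp add: block_type_def perm_partition_def card_image[OF inj])
qed

lemma block_type_two:
  assumes "finite R" "(C \<union> D) \<inter> \<Union>R = {}" "C \<inter> D = {}" "card C \<ge> 2" "card D \<ge> 2"
  shows "block_type (R \<union> {C, D}) = (card R + 2, card {B \<in> R. card B = 1})"
proof -
  have "C \<noteq> {}" "D \<noteq> {}" using assms by auto
  then have "C \<notin> R" "D \<notin> R" "C \<noteq> D" using assms by auto
  then have "card (R \<union> {C, D}) = card R + 2" using assms(1) by simp
  moreover have "{B \<in> R \<union> {C, D}. card B = 1} = {B \<in> R. card B = 1}" using assms(4,5) by auto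
  ultimately show ?thesis by (simp add: block_type_def)
qed

lemma partition_on_two:
  assumes "partition_on (S - (C \<union> D)) R" "C \<union> D \<subseteq> S" "C \<inter> D = {}" "C \<noteq> {}" "D \<noteq> {}"
  shows "partition_on S (R \<union> {C, D})"
proof -
  have R: "\<Union>R = S - (C \<union> D)" using assms(1) by (simp add: partition_on_def)
  have "partition_on (S - C) (insert D R)"
    using assms R by (subst partition_on_insert) (auto simp: disjnt_def Diff_eq Int_assoc)
  then have "partition_on S (insert C (insert D R))"
    using assms R by (subst partition_on_insert) (auto simp: disjnt_def)
  then show ?thesis by simp
qed

lemma partition_on_two_blocks:
  assumes "partition_on S P" "C \<in> P" "D \<in> P" "C \<noteq> D"
  shows "partition_on (S - (C \<union> D)) (P - {C, D})" "C \<inter> D = {}" "C \<union> D \<subseteq> S" "P = P - {C, D} \<union> {C, D}"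
    "(C \<union> D) \<inter> \<Union>(P - {C, D}) = {}"
  using assms unfolding partition_on_def disjoint_def by blast+

section \<open>The intertwiner on combinations of noncrossing partitions\<close>

lemma finite_NC: "finite (NC n)"
  by (rule finite_subset[OF _ finitely_many_partition_on[of "{1..n}"]]) (auto simp: NC_def)

text \<open>Values of \<open>v\<close> off \<open>NC n\<close> are ignored, so statements of
  injectivity carry the assumption that \<open>v\<close> is supported there.\<close>

definition web :: "nat \<Rightarrow> (nat set set \<Rightarrow> rat) \<Rightarrow> triple \<Rightarrow> rat"
  where "web n v T = (\<Sum>P\<in>NC n. v P * pvec P T)"

lemma web_add: "web n (u + v) T = web n u T + web n v T"
  by (simp add: web_def distrib_right sum.distrib)

lemma web_diff: "web n (u - v) T = web n u T - web n v T"
  by (simp add: web_def left_diff_distrib sum_subtractf)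

lemma web_uminus: "web n (- v) T = - web n v T"
  by (simp add: web_def sum_negf)

lemma web_scl: "web n (scl c v) T = c * web n v T"
  by (simp add: web_def scl_def sum_distrib_left mult.assoc)

lemma web_0 [simp]: "web n 0 T = 0"
  by (simp add: web_def)

lemma web_sum: "web n (\<Sum>x\<in>A. f x) T = (\<Sum>x\<in>A. web n (f x) T)"
  by (induction A rule: infinite_finite_induct)
    (simp_all only: sum.infinite sum.empty sum.insert web_0 web_add not_False_eq_True)

lemma web_basis: "Q \<in> NC n \<Longrightarrow> web n (basis_vec Q) T = pvec Q T"
  using finite_NC by (simp add: web_def basis_vec_def if_distrib[of "\<lambda>x. x * _"] sum.delta cong: if_cong)

text \<open>The value \<open>- pvec P T\<close> does not mention i: whichever crossing index
  \<open>skein\<close> picks, the image under \<open>web\<close> is the same. The block type is kept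
  since each term replaces two non-singleton blocks by two non-singleton blocks.\<close>

lemma skein_at_properties:
  assumes "crosses_at n P i"
  shows "skein_at i P Q \<noteq> 0 \<Longrightarrow> Q \<in> NC n \<and> block_type Q = block_type P"
    and "web n (skein_at i P) T = - pvec P T"
proof -
  from assms have P: "partition_on {1..n} P" and cr: "\<not> noncrossing P" and i: "i \<in> {1..<n}"
    and nc: "noncrossing (perm_partition (adj i) P)" by (auto simp: crosses_at_def)
  define I where "I = block P i"
  define J where "J = block P (i + 1)"
  define R where "R = P - {I, J}"
  define A where "A = I - {i}"
  define B where "B = J - {i + 1}"
  have I: "I \<in> P" "i \<in> I" and J: "J \<in> P" "i + 1 \<in> J"
    using block_in[OF P] i by (auto simp: I_def J_def)
  have sP: "partition_on {1..n} (perm_partition (adj i) P)"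
    using partition_on_perm[OF P adj_permutes[OF i]] .
  have "I \<noteq> J"
  proof
    assume "I = J"
    have "adj i ` E = E" if "E \<in> P" for E
    proof (cases "i \<in> E")
      case True
      then have "E = I" using block_eq[OF P that] I_def by simp
      then show ?thesis using I J \<open>I = J\<close> by simp
    next
      case False
      then have "i + 1 \<notin> E" using block_eq[OF P that, of "i + 1"] I J \<open>I = J\<close> J_def by auto
      with False show ?thesis by (simp add: transpose_image_eq)
    qed
    then have "perm_partition (adj i) P = P" by (simp add: perm_partition_def)
    with nc cr show False by simp
  qed
  note split = partition_on_two_blocks[OF P I(1) J(1) \<open>I \<noteq> J\<close>, folded R_def]
  \<comment> \<open>If i were a singleton of P, undoing the swap would only move a singleton of a
    noncrossing partition, which cannot create the crossing of P.\<close>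
  have "A \<noteq> {}"
  proof
    assume "A = {}"
    then have "I = {i}" using I by (auto simp: A_def)
    then have "adj i ` {i} \<in> perm_partition (adj i) P"
      using I(1) unfolding perm_partition_def by (intro imageI) simp
    then have "{i + 1} \<in> perm_partition (adj i) P" by simp
    from noncrossing_adj_singleton[OF sP nc this, of i] cr show False
      unfolding perm_partition_adj_adj by simp
  qed
  have "B \<noteq> {}"
  proof
    assume "B = {}"
    then have "J = {i + 1}" using J by (auto simp: B_def)
    then have "adj i ` {i + 1} \<in> perm_partition (adj i) P"
      using J(1) unfolding perm_partition_def by (intro imageI) simp
    then have "{i} \<in> perm_partition (adj i) P" by simp
    from noncrossing_adj_singleton[OF sP nc this, of i] cr show False
      unfolding perm_partition_adj_adj by simp
  qed
  have IJ: "I = insert i A" "J = insert (i + 1) B" using I J by (auto simp: A_def B_def)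
  have disj: "i \<notin> A \<union> B" "i + 1 \<notin> A \<union> B" "A \<inter> B = {}"
    using I J split(2) by (auto simp: A_def B_def)
  have sub: "A \<subseteq> {1..n}" "B \<subseteq> {1..n}" using split(3) IJ by auto
  then have fin: "finite A" "finite B" using finite_subset by auto
  then have cA: "card A \<ge> 1" "card B \<ge> 1" using \<open>A \<noteq> {}\<close> \<open>B \<noteq> {}\<close> by (simp_all add: Suc_le_eq card_gt_0_iff)
  let ?U = "{i, i + 1} \<union> A \<union> B"
  have U: "?U \<inter> \<Union>R = {}" "?U \<subseteq> {1..n}" using split(3,5) IJ by auto
  have IJU: "I \<union> J = ?U" using IJ by auto
  have finR: "finite R" using P finite_elements by (auto simp: R_def)
  have sI: "adj i ` I = insert (i + 1) A" "adj i ` J = insert i B"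
  proof -
    have "adj i ` A = A" "adj i ` B = B" using disj by (simp_all add: transpose_image_eq)
    then show "adj i ` I = insert (i + 1) A" "adj i ` J = insert i B" by (simp_all add: IJ)
  qed
  have "adj i ` E = E" if "E \<in> R" for E
    using that U(1) by (auto simp: transpose_image_eq)
  then have "(`) (adj i) ` R = R" by simp
  then have sP_eq: "perm_partition (adj i) P = R \<union> {insert (i + 1) A, insert i B}"
    using sI unfolding perm_partition_def by (subst split(4)) (simp add: image_Un)
  note ad = adjacent_def
  have nc1: "noncrossing (R \<union> {insert (i + 1) A, insert i B})" using nc by (simp only: sP_eq)
  \<comment> \<open>The same partition with its two blocks in the other order, from which the last
    term of the skein map is obtained.\<close>
  have nc1': "noncrossing (R \<union> {insert i B, insert (i + 1) A})" using nc1 by (simp add: insert_commute)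
  have nc2: "noncrossing (R \<union> {{i, i + 1}, A \<union> B})" and nc3: "noncrossing (R \<union> {{i, i + 1} \<union> A, B})"
    using noncrossing_resolve[OF nc1] disj U(1) by (auto simp: ad insert_commute)
  have nc4: "noncrossing (R \<union> {{i, i + 1} \<union> B, A})"
    using noncrossing_resolve[OF nc1'] disj U(1) by (auto simp: ad insert_commute Un_commute)
  have part: "R \<union> {C, D} \<in> NC n \<and> block_type (R \<union> {C, D}) = block_type P"
    if "C \<union> D = ?U" "C \<inter> D = {}" "card C \<ge> 2" "card D \<ge> 2" "noncrossing (R \<union> {C, D})" for C D
  proof -
    have "C \<noteq> {}" "D \<noteq> {}" using that by auto
    moreover have "partition_on ({1..n} - (C \<union> D)) R" using split(1) IJU that(1) by simp
    ultimately have "partition_on {1..n} (R \<union> {C, D})"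
      using that U by (intro partition_on_two) auto
    moreover have "block_type (R \<union> {C, D}) = (card R + 2, card {B \<in> R. card B = 1})"
      using that U finR by (intro block_type_two) auto
    moreover have "block_type (R \<union> {I, J}) = (card R + 2, card {B \<in> R. card B = 1})"
      using split cA fin disj IJ finR by (intro block_type_two) auto
    ultimately show ?thesis using that(5) split(4) by (simp add: NC_def)
  qed
  have c1: "card (insert (i + 1) A) \<ge> 2" "card (insert i B) \<ge> 2" "card {i, i + 1} \<ge> 2" "card (A \<union> B) \<ge> 2"
    "card ({i, i + 1} \<union> A) \<ge> 2" "card ({i, i + 1} \<union> B) \<ge> 2"
    using cA fin disj by (auto simp: card_Un_disjoint)
  have q1: "R \<union> {insert (i + 1) A, insert i B} \<in> NC n \<and> block_type (R \<union> {insert (i + 1) A, insert i B}) = block_type P"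
    by (rule part[OF _ _ c1(1,2) nc1]) (use disj in auto)
  have p2: "R \<union> {{i, i + 1}, A \<union> B} \<in> NC n \<and> block_type (R \<union> {{i, i + 1}, A \<union> B}) = block_type P"
    by (rule part[OF _ _ c1(3,4) nc2]) (use disj in auto)
  have p3: "R \<union> {{i, i + 1} \<union> A, B} \<in> NC n \<and> block_type (R \<union> {{i, i + 1} \<union> A, B}) = block_type P" if "card B \<noteq> 1"
    by (rule part[OF _ _ c1(5) _ nc3]) (use disj cA that in auto)
  have p4: "R \<union> {{i, i + 1} \<union> B, A} \<in> NC n \<and> block_type (R \<union> {{i, i + 1} \<union> B, A}) = block_type P" if "card A \<noteq> 1"
    by (rule part[OF _ _ c1(6) _ nc4]) (use disj cA that in auto)
  have sk: "skein_at i P = basis_vec (R \<union> {insert (i + 1) A, insert i B}) + basis_vec (R \<union> {{i, i + 1}, A \<union> B})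
        - (if card B = 1 then 0 else basis_vec (R \<union> {{i, i + 1} \<union> A, B}))
        - (if card A = 1 then 0 else basis_vec (R \<union> {{i, i + 1} \<union> B, A}))"
    unfolding skein_at_def Let_def sP_eq I_def[symmetric] J_def[symmetric] A_def[symmetric] B_def[symmetric]
      R_def[symmetric] by (rule refl)
  show "Q \<in> NC n \<and> block_type Q = block_type P" if "skein_at i P Q \<noteq> 0"
  proof -
    have "Q = R \<union> {insert (i + 1) A, insert i B} \<or> Q = R \<union> {{i, i + 1}, A \<union> B}
      \<or> card B \<noteq> 1 \<and> Q = R \<union> {{i, i + 1} \<union> A, B} \<or> card A \<noteq> 1 \<and> Q = R \<union> {{i, i + 1} \<union> B, A}"
    proof (rule ccontr)
      assume "\<not> ?thesis"
      then have "skein_at i P Q = 0" unfolding sk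
        by (cases "card A = 1"; cases "card B = 1"; simp only: fun_diff_def plus_fun_def basis_vec_def)
          (simp_all del: Un_insert_right Un_insert_left)
      with that show False by simp
    qed
    then show ?thesis using q1 p2 p3 p4 by blast
  qed
  have "web n (skein_at i P) T = pvec (R \<union> {insert (i + 1) A, insert i B}) T + pvec (R \<union> {{i, i + 1}, A \<union> B}) T
        - (if card B = 1 then 0 else pvec (R \<union> {{i, i + 1} \<union> A, B}) T)
        - (if card A = 1 then 0 else pvec (R \<union> {{i, i + 1} \<union> B, A}) T)"
    unfolding sk web_add web_diff if_distrib[of "\<lambda>v. web n v T"] web_0
    using q1 p2 p3 p4 web_basis by (simp del: Un_insert_right Un_insert_left cong: if_cong)
  also have "\<dots> = - pvec (R \<union> {insert i A, insert (i + 1) B}) T"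
    by (subst skein_relation[of R i "i + 1" A B T])
      (use finR U disj fin \<open>A \<noteq> {}\<close> \<open>B \<noteq> {}\<close> in \<open>simp_all del: Un_insert_right Un_insert_left\<close>)
  also have "R \<union> {insert i A, insert (i + 1) B} = P" using split(4) IJ by simp
  finally show "web n (skein_at i P) T = - pvec P T" .
qed

section \<open>Equivariance and leading terms\<close>

lemma perm_partition_adj_same_block:
  assumes P: "partition_on S P" and I: "I \<in> P" "i \<in> I" "i + 1 \<in> I"
  shows "perm_partition (adj i) P = P"
proof -
  have "adj i ` E = E" if "E \<in> P" for E
  proof (cases "E = I")
    case False
    then have "E \<inter> I = {}" using P I that by (auto simp: partition_on_def disjoint_def)
    then show ?thesis using I by (intro transpose_image_eq) auto
  qed (use I in simp)
  then show ?thesis by (simp add: perm_partition_def)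
qed

lemma tact_adj_adj: "tact (adj i) (tact (adj i) T) = T"
  unfolding tact_comp adj_adj by simp

text \<open>Compare with the sign \<open>eps\<close> of the relabelling. If i and i + 1 share a
  block, it is the sign of \<open>- basis_vec P\<close>. If the image is noncrossing and the blocks
  differ, it is 1 by \<open>crossing_adj_big\<close>. In the skein case neither is a singleton, and
  the sign - 1 cancels the one in \<open>skein_at_properties\<close>.\<close>

lemma tau_basis_properties:
  assumes "P \<in> NC n" and i: "i \<in> {1..<n}"
  shows "tau_basis n i P Q \<noteq> 0 \<Longrightarrow> Q \<in> NC n \<and> block_type Q = block_type P"
    and "web n (tau_basis n i P) T = pvec P (tact (adj i) T)"
proof -
  let ?P = "perm_partition (adj i) P"
  from assms have P: "partition_on {1..n} P" "noncrossing P" by (auto simp: NC_def)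
  then have P': "partition_on {1..n} ?P" using partition_on_perm adj_permutes[OF i] by blast
  define I where "I = block P i"
  define J where "J = block P (i + 1)"
  have I: "I \<in> P" "i \<in> I" and J: "J \<in> P" "i + 1 \<in> J"
    using block_in[OF P(1)] i by (auto simp: I_def J_def)
  have fin: "finite P" "finite I" "finite J"
    using P(1) I J finite_elements[OF _ P(1)] by (auto simp: partition_on_def intro: finite_subset)
  have "x \<in> \<Union>(big_blocks P) \<longleftrightarrow> card Z \<noteq> 1" if "Z \<in> P" "x \<in> Z" for x Z
    using that block_eq[OF P(1)] unfolding big_blocks_def by blast
  then have big: "i \<in> \<Union>(big_blocks P) \<longleftrightarrow> card I \<noteq> 1" "i + 1 \<in> \<Union>(big_blocks P) \<longleftrightarrow> card J \<noteq> 1"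
    using I J by blast+
  have eps: "pvec ?P T = (if card I \<noteq> 1 \<and> card J \<noteq> 1 then - 1 else 1) * pvec P (tact (adj i) T)"
    using pvec_adj[of P i "tact (adj i) T"] fin(1) unfolding tact_adj_adj big
    by (simp add: big_blocks_def)
  have sing: "\<exists>a\<in>Z. a \<noteq> z" if "card Z \<noteq> 1" "z \<in> Z" for z and Z :: "nat set"
    using that by (metis is_singletonI' is_singleton_altdef empty_iff)
  have "(tau_basis n i P Q \<noteq> 0 \<longrightarrow> Q \<in> NC n \<and> block_type Q = block_type P) \<and>
      web n (tau_basis n i P) T = pvec P (tact (adj i) T)"
  proof (cases "I = J")
    case True
    then have t: "tau_basis n i P = - basis_vec P" by (simp add: tau_basis_def I_def J_def)
    have sP: "?P = P" using perm_partition_adj_same_block[OF P(1) I] J True by simp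
    have "card I \<noteq> 1" using I J True by (auto simp: card_1_singleton_iff)
    then have "pvec P T = - pvec P (tact (adj i) T)" using eps True unfolding sP by simp
    then show ?thesis using assms(1) by (simp add: t web_uminus web_basis) (simp add: basis_vec_def)
  next
    case IJ: False
    show ?thesis
    proof (cases "noncrossing ?P")
      case True
      then have t: "tau_basis n i P = basis_vec ?P"
        using IJ by (simp add: tau_basis_def I_def J_def)
      have N: "?P \<in> NC n" using P' True by (simp add: NC_def)
      have small: "\<not> (card I \<noteq> 1 \<and> card J \<noteq> 1)"
      proof
        assume "card I \<noteq> 1 \<and> card J \<noteq> 1"
        then obtain a b where "a \<in> I" "a \<noteq> i" "b \<in> J" "b \<noteq> i + 1" using sing I J by meson
        then show False using crossing_adj_big[OF P] I J IJ True by blast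
      qed
      have "pvec ?P T = pvec P (tact (adj i) T)"
        unfolding eps by (simp only: small if_False mult_1_left)
      then show ?thesis
        unfolding t web_basis[OF N] using N block_type_perm[OF inj_adj] by (simp add: basis_vec_def)
    next
      case False
      then have t: "tau_basis n i P = skein n ?P"
        using IJ by (simp add: tau_basis_def I_def J_def)
      have "crosses_at n ?P i"
        unfolding crosses_at_def perm_partition_adj_adj using P' P False i by simp
      then have c: "crosses_at n ?P (SOME i. crosses_at n ?P i)" by (rule someI)
      have "card I \<noteq> 1 \<and> card J \<noteq> 1"
      proof (rule ccontr)
        assume "\<not> ?thesis"
        then have "I = {i} \<or> J = {i + 1}" using I J by (auto simp: card_1_singleton_iff)
        then show False
          using noncrossing_adj_singleton[OF P, of i i] noncrossing_adj_singleton[OF P, of "i + 1" i] I J False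
          by auto
      qed
      then have "- pvec ?P T = pvec P (tact (adj i) T)" using eps by simp
      then show ?thesis
        using skein_at_properties[OF c] block_type_perm[OF inj_adj] unfolding t skein_def by metis
    qed
  qed
  then show "tau_basis n i P Q \<noteq> 0 \<Longrightarrow> Q \<in> NC n \<and> block_type Q = block_type P"
    and "web n (tau_basis n i P) T = pvec P (tact (adj i) T)" by blast+
qed

lemma web_tau:
  assumes "i \<in> {1..<n}"
  shows "web n (tau n i v) T = web n v (tact (adj i) T)"
  unfolding tau_def web_sum web_scl
  using tau_basis_properties(2)[OF _ assms] by (simp add: web_def)

section \<open>Gradation by block type and the action of arbitrary permutations\<close>

definition supp_in :: "nat set set set \<Rightarrow> (nat set set \<Rightarrow> rat) set"
  where "supp_in X = {v. \<forall>P. P \<notin> X \<longrightarrow> v P = 0}"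

text \<open>The predicate allows all three families of modules to be treated by one set of
  lemmas.\<close>

definition NC_typed :: "nat \<Rightarrow> (nat \<times> nat \<Rightarrow> bool) \<Rightarrow> nat set set set"
  where "NC_typed n h = {P \<in> NC n. h (block_type P)}"

lemma NC_eq_NC_typed:
  "NC n = NC_typed n (\<lambda>_. True)" "NC_blocks n k = NC_typed n (\<lambda>t. fst t = k)"
  "NC_blocks_singletons n k s = NC_typed n (\<lambda>t. fst t = k \<and> snd t = s)"
  by (auto simp: NC_typed_def NC_blocks_def NC_blocks_singletons_def block_type_def)

lemma supp_in_NC_typed: "v \<in> supp_in (NC_typed n h) \<Longrightarrow> v \<in> supp_in (NC n)"
  by (auto simp: supp_in_def NC_typed_def)

lemma supp_in_add: "u \<in> supp_in X \<Longrightarrow> v \<in> supp_in X \<Longrightarrow> u + v \<in> supp_in X"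
  by (simp add: supp_in_def)

lemma supp_in_diff: "u \<in> supp_in X \<Longrightarrow> v \<in> supp_in X \<Longrightarrow> u - v \<in> supp_in X"
  by (simp add: supp_in_def)

lemma supp_in_scl: "v \<in> supp_in X \<Longrightarrow> scl c v \<in> supp_in X"
  by (simp add: supp_in_def scl_def)

lemma supp_in_0: "0 \<in> supp_in X"
  by (simp add: supp_in_def)

lemma supp_in_sum: "(\<And>x. x \<in> A \<Longrightarrow> f x \<in> supp_in X) \<Longrightarrow> (\<Sum>x\<in>A. f x) \<in> supp_in X"
  by (induction A rule: infinite_finite_induct)
    (simp_all only: sum.infinite sum.empty sum.insert supp_in_0 supp_in_add insertI1 insertI2 not_False_eq_True)

lemma supp_in_tau:
  assumes "v \<in> supp_in (NC_typed n h)" "i \<in> {1..<n}"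
  shows "tau n i v \<in> supp_in (NC_typed n h)"
  unfolding tau_def
proof (rule supp_in_sum)
  fix P assume P: "P \<in> NC n"
  show "scl (v P) (tau_basis n i P) \<in> supp_in (NC_typed n h)"
  proof (cases "v P = 0")
    case False
    then have "h (block_type P)" using assms(1) by (auto simp: supp_in_def NC_typed_def)
    then show ?thesis
      using tau_basis_properties(1)[OF P assms(2)]
      by (intro supp_in_scl) (unfold supp_in_def NC_typed_def, force)
  qed (simp add: supp_in_def scl_def)
qed

lemma foldr_adj: "foldr (\<lambda>i u. adj i \<circ> u) is id = apply_adj_transps is"
  by (induction "is") simp_all

lemma apply_adj_transps_append:
  "apply_adj_transps (xs @ ys) = apply_adj_transps xs \<circ> apply_adj_transps ys"
  by (induction xs) (simp_all add: o_assoc)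

lemma ex_adj_word:
  assumes "w permutes {1..n}"
  shows "\<exists>is. set is \<subseteq> {1..<n} \<and> w = apply_adj_transps is"
  using assms finite_atLeastAtMost[of 1 n]
proof (induction rule: permutes_induct)
  case id
  show ?case by (rule exI[of _ "[]"]) simp
next
  case (swap a b p)
  have *: "\<exists>js. set js \<subseteq> {1..<n} \<and> transpose a b = apply_adj_transps js"
    if "a \<in> {1..n}" "b \<in> {1..n}" "a < b" for a b
    using that adj_transp_seq_correct[of a b] set_adj_transp_seq[of a b]
    by (intro exI[of _ "adj_transp_seq a b"]) auto
  then have "\<exists>js. set js \<subseteq> {1..<n} \<and> transpose a b = apply_adj_transps js"
    using swap.hyps *[of a b] *[of b a] by (metis linorder_neqE transpose_commute)
  with swap.IH show ?case
    by (metis apply_adj_transps_append set_append Un_subset_iff)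
qed

lemma skein_act_word:
  assumes "w permutes {1..n}"
  obtains js where "set js \<subseteq> {1..<n}" "w = apply_adj_transps js" "skein_act n w = foldr (tau n) js"
proof -
  let ?js = "SOME is. set is \<subseteq> {1..<n} \<and> w = foldr (\<lambda>i u. adj i \<circ> u) is id"
  have "set ?js \<subseteq> {1..<n} \<and> w = foldr (\<lambda>i u. adj i \<circ> u) ?js id"
    by (rule someI_ex) (use ex_adj_word[OF assms] in \<open>simp only: foldr_adj\<close>)
  then show ?thesis by (intro that[of ?js]) (simp_all only: foldr_adj skein_act_def)
qed

text \<open>The right-hand side depends on the word only through the permutation that it spells.
  This removes the choice made in \<open>skein_act\<close> once \<open>web\<close> is known to be
  injective.\<close>

lemma web_foldr_tau:
  assumes "set js \<subseteq> {1..<n}"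
  shows "web n (foldr (tau n) js v) T = web n v (tact (inv' (apply_adj_transps js)) T)"
  using assms
proof (induction js arbitrary: T)
  case (Cons j js)
  have bij: "bij (adj j)" "bij (apply_adj_transps js)"
    using permutation_apply_adj_transps permutation_bijective by auto
  have step: "foldr (tau n) (j # js) v = tau n j (foldr (tau n) js v)" by simp
  have "inv' (adj j \<circ> apply_adj_transps js) = inv' (apply_adj_transps js) \<circ> adj j"
    using o_inv_distrib[OF bij] by simp
  then show ?case
    using Cons by (simp only: step apply_adj_transps_Cons tact_comp web_tau set_simps insert_subset)
qed simp

lemma web_skein_act:
  assumes "w permutes {1..n}"
  shows "web n (skein_act n w v) T = web n v (tact (inv' w) T)"
  using skein_act_word[OF assms] web_foldr_tau by metis

lemma supp_in_skein_act:
  assumes "w permutes {1..n}" "v \<in> supp_in (NC_typed n h)"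
  shows "skein_act n w v \<in> supp_in (NC_typed n h)"
proof -
  obtain js where js: "set js \<subseteq> {1..<n}" "skein_act n w = foldr (tau n) js"
    using skein_act_word[OF assms(1)] by metis
  show ?thesis unfolding js(2) using js(1) by (induction js) (simp_all add: assms(2) supp_in_tau)
qed

section \<open>Triangularity of the vectors of noncrossing partitions\<close>

lemma block_same: "partition_on S P \<Longrightarrow> B \<in> P \<Longrightarrow> x \<in> B \<Longrightarrow> y \<in> B \<Longrightarrow> block P x = block P y"
  using block_eq by metis

text \<open>
  Reading from left to right, an element that does not open a new block lies in the innermost block
  that is still open.
\<close>

lemma noncrossing_determined:
  fixes S :: "nat set"
  assumes S: "finite S" and P: "partition_on S P" "noncrossing P" and Q: "partition_on S Q" "noncrossing Q"
    and Min: "Min ` P = Min ` Q" and Max: "Max ` P = Max ` Q"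
  shows "P = Q"
proof -
  define opens where "opens P x = {m \<in> Min ` P. m < x \<and> \<not> (\<exists>y\<in>S. y < x \<and> y \<in> Max ` P \<and> Min (block P y) = m)}"
    for P :: "nat set set" and x
  have blk: "finite B \<and> B \<noteq> {} \<and> B \<subseteq> S" if "partition_on S P" "B \<in> P" for P B
  proof -
    have "B \<subseteq> S" "B \<noteq> {}" using that by (auto simp: partition_on_def)
    with S show ?thesis by (simp add: finite_subset)
  qed
  have mx: "Min (block P x) = Max (opens P x)"
    if P: "partition_on S P" "noncrossing P" and x: "x \<in> S" "x \<notin> Min ` P" for P x
  proof -
    let ?B = "block P x"
    have B: "?B \<in> P" "x \<in> ?B" using block_in[OF P(1) x(1)] by auto
    note fB = blk[OF P(1) B(1)]
    have mB: "Min ?B \<in> ?B" using fB by (simp add: Min_in)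
    have less: "Min ?B < x" using fB B x(2) by (metis Min_le image_eqI le_neq_implies_less)
    have "Min ?B \<in> opens P x"
    proof -
      have False if y: "y \<in> S" "y < x" "y \<in> Max ` P" "Min (block P y) = Min ?B" for y
      proof -
        obtain C where C: "C \<in> P" "y = Max C" using y by blast
        then have "y \<in> C" using blk[OF P(1)] Max_in by blast
        then have "block P y = C" using block_eq[OF P(1) C(1)] by simp
        then have "Min ?B \<in> C" using y(4) blk[OF P(1) C(1)] Min_in by metis
        then have "C = ?B" using block_eq[OF P(1)] C B mB by metis
        then have "x \<le> y" using C B fB by simp
        with y(2) show False by simp
      qed
      then show ?thesis using less B by (auto simp: opens_def)
    qed
    \<comment> \<open>A block C opened after the minimum of the block of x and still open at x would
      cross that block, through Min ?B < Min C < x < Max C.\<close>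
    moreover have "m \<le> Min ?B" if m: "m \<in> opens P x" for m
    proof (rule ccontr)
      assume "\<not> m \<le> Min ?B"
      obtain C where C: "C \<in> P" "m = Min C" using m by (auto simp: opens_def)
      note fC = blk[OF P(1) C(1)]
      have mem: "Min C \<in> C" "Max C \<in> C" using fC by auto
      have "C \<noteq> ?B" using C \<open>\<not> m \<le> Min ?B\<close> by auto
      have "Min (block P (Max C)) = m" using block_eq[OF P(1) C(1) mem(2)] C by simp
      moreover have "Max C \<in> S" "Max C \<in> Max ` P" using mem fC C by blast+
      ultimately have "\<not> Max C < x" using m unfolding opens_def by blast
      moreover have "Max C \<noteq> x" using block_eq[OF P(1) C(1) mem(2)] \<open>C \<noteq> ?B\<close> by metis
      ultimately have "x < Max C" by simp
      moreover have "m < x" using m by (simp add: opens_def)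
      ultimately have "?B = C"
        using noncrossingD[OF P(2) B(1) C(1) mB B(2) mem] \<open>\<not> m \<le> Min ?B\<close> C by simp
      with \<open>C \<noteq> ?B\<close> show False by simp
    qed
    moreover have "finite (opens P x)" unfolding opens_def by simp
    ultimately show ?thesis by (intro Max_eqI[symmetric]) auto
  qed
  have self: "Min (block P x) = x" if "partition_on S P" "x \<in> Min ` P" for P x
    using that blk[OF that(1)] block_eq[OF that(1)] Min_in by fastforce
  have eq: "Min (block P x) = Min (block Q x)" if "x \<in> S" for x
    using that
  proof (induction x rule: less_induct)
    case (less x)
    show ?case
    proof (cases "x \<in> Min ` P")
      case True
      then show ?thesis using self[OF P(1)] self[OF Q(1)] Min by metis
    next
      case False
      \<comment> \<open>\<open>opens\<close> looks only at minima, maxima and the blocks of smaller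
        elements, so the induction hypothesis applies.\<close>
      have "opens P x = opens Q x"
        unfolding opens_def using less.IH Min Max by auto
      then show ?thesis using mx[OF P less.prems] mx[OF Q less.prems] False Min by simp
    qed
  qed
  have sub: "P \<subseteq> Q" if P: "partition_on S P" and Q: "partition_on S Q"
    and eq: "\<And>x. x \<in> S \<Longrightarrow> Min (block P x) = Min (block Q x)" for P Q
  proof
    fix B assume B: "B \<in> P"
    have fB: "finite B" "B \<noteq> {}" "B \<subseteq> S" using blk[OF P B] by auto
    have char: "block R x = {y \<in> S. Min (block R y) = Min (block R x)}" if R: "partition_on S R" "x \<in> S" for R x
    proof (intro equalityI subsetI)
      fix y assume "y \<in> block R x"
      then show "y \<in> {y \<in> S. Min (block R y) = Min (block R x)}"
        using block_in[OF R] block_same[OF R(1), of "block R x" y x] blk[OF R(1), of "block R x"] by auto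
    next
      fix y assume y: "y \<in> {y \<in> S. Min (block R y) = Min (block R x)}"
      then have *: "block R y \<in> R" "y \<in> block R y" "block R x \<in> R" "x \<in> block R x"
        using block_in[OF R(1)] R(2) by auto
      moreover have "Min (block R z) \<in> block R z" if "block R z \<in> R" for z
        using blk[OF R(1) that] by (intro Min_in) auto
      then have "Min (block R y) \<in> block R y" "Min (block R x) \<in> block R x" using * by blast+
      ultimately show "y \<in> block R x" using y block_eq[OF R(1)] block_in[OF R] by (metis (mono_tags, lifting) mem_Collect_eq)
    qed
    obtain x where x: "x \<in> B" using fB by blast
    then have "x \<in> S" using fB by blast
    have "B = block P x" using block_eq[OF P B x] by simp
    also have "\<dots> = {y \<in> S. Min (block P y) = Min (block P x)}" by (rule char[OF P \<open>x \<in> S\<close>])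
    also have "\<dots> = {y \<in> S. Min (block Q y) = Min (block Q x)}" using eq \<open>x \<in> S\<close> by auto
    also have "\<dots> = block Q x" by (rule char[OF Q \<open>x \<in> S\<close>, symmetric])
    finally show "B \<in> Q" using block_in[OF Q \<open>x \<in> S\<close>] by simp
  qed
  show ?thesis using sub[OF P(1) Q(1)] sub[OF Q(1) P(1)] eq by auto
qed

text \<open>Sorting the remaining letters is an arbitrary choice; another order would change the
  coordinates only by a sign.\<close>

definition lead_triple :: "nat set set \<Rightarrow> triple"
  where "lead_triple P = (Min ` big_blocks P, Max ` big_blocks P,
    sorted_list_of_set (\<Union>(big_blocks P) - Min ` big_blocks P - Max ` big_blocks P))"

definition spread :: "nat set set \<Rightarrow> int"
  where "spread P = (\<Sum>B\<in>big_blocks P. int (Max B) - int (Min B))"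

lemma big_blocks_partition:
  assumes "partition_on S P" "finite S" "B \<in> big_blocks P"
  shows "finite B" "B \<noteq> {}" "B \<subseteq> S" "Min B \<in> B" "Max B \<in> B" "Min B < Max B"
proof -
  have B: "B \<in> P" "card B \<noteq> 1" using assms(3) by (auto simp: big_blocks_def)
  then show *: "B \<noteq> {}" "B \<subseteq> S" using assms(1) by (auto simp: partition_on_def)
  then show **: "finite B" using assms(2) finite_subset by blast
  show m: "Min B \<in> B" "Max B \<in> B" using * ** by auto
  have "Min B \<noteq> Max B"
  proof
    assume eq: "Min B = Max B"
    have "B = {Min B}"
    proof (intro equalityI subsetI)
      fix x assume "x \<in> B"
      then have "Min B \<le> x" "x \<le> Max B" using ** by auto
      with eq show "x \<in> {Min B}" by simp
    qed (use m in simp)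
    then show False using B(2) by (metis card_1_singleton_iff One_nat_def)
  qed
  moreover have "Min B \<le> Max B" using m ** by simp
  ultimately show "Min B < Max B" by simp
qed

lemma big_blocks_disjoint:
  assumes "partition_on S P" "B \<in> big_blocks P" "C \<in> big_blocks P" "x \<in> B" "x \<in> C"
  shows "B = C"
  using assms by (auto simp: big_blocks_def partition_on_def disjoint_def)

lemma finite_big_blocks: "partition_on S P \<Longrightarrow> finite S \<Longrightarrow> finite (big_blocks P)"
  using finite_elements[of S P] by (simp add: big_blocks_def)

lemma pvec_lead_nonzero:
  assumes P: "partition_on S P" and S: "finite S"
  shows "pvec P (lead_triple P) \<noteq> 0"
proof -
  let ?G = "big_blocks P"
  obtain bs where bs: "distinct bs" "set bs = ?G"
    using finite_distinct_list[OF finite_big_blocks[OF P S]] by blast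
  note bb = big_blocks_partition[OF P S] and dj = big_blocks_disjoint[OF P]
  have minB: "Min ` ?G \<inter> B = {Min B}" and maxB: "Max ` ?G \<inter> B = {Max B}" if "B \<in> ?G" for B
    using that bb(4,5) dj by blast+
  have sub: "Min ` ?G \<subseteq> \<Union>?G" "Max ` ?G \<subseteq> \<Union>?G" using bb(4,5) by blast+
  have "finite (\<Union>?G)" using finite_big_blocks[OF P S] bb(1) by blast
  then have "transv P (lead_triple P)"
    using sub minB maxB by (auto simp: transv_def lead_triple_def is_singleton_def)
  moreover have "distinct (word_of bs (lead_triple P))"
  proof -
    have "pick (Min ` ?G) B = Min B" "pick (Max ` ?G) B = Max B" if "B \<in> set bs" for B
      using that minB maxB bs by (auto intro!: pick_eqI)
    then have "word_of bs (lead_triple P) = map Min bs @ map Max bs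
        @ sorted_list_of_set (\<Union>?G - Min ` ?G - Max ` ?G)"
      by (simp add: word_of_def lead_triple_def)
    moreover have "inj_on Min ?G" "inj_on Max ?G"
      using bb(4,5) dj by (metis inj_onI)+
    moreover have "Min ` ?G \<inter> Max ` ?G = {}"
    proof -
      have False if "B \<in> ?G" "C \<in> ?G" "Min B = Max C" for B C
        using that bb(4)[of B] bb(5)[of C] bb(6)[of B] dj[of B C "Min B"] by auto
      then show ?thesis by blast
    qed
    ultimately show ?thesis
      using bs \<open>finite (\<Union>?G)\<close> by (auto simp: distinct_map)
  qed
  ultimately show ?thesis using wsign_nonzero by (simp add: pvec_eq[OF bs])
qed

lemma partition_on_big_blocks:
  assumes "partition_on S P" "\<And>B. B \<in> P \<Longrightarrow> finite B"
  shows "P = big_blocks P \<union> (\<lambda>x. {x}) ` (S - \<Union>(big_blocks P))"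
proof (intro equalityI subsetI)
  fix B assume B: "B \<in> P"
  show "B \<in> big_blocks P \<union> (\<lambda>x. {x}) ` (S - \<Union>(big_blocks P))"
  proof (cases "card B = 1")
    case True
    then obtain x where x: "B = {x}" by (auto simp: card_1_singleton_iff)
    then have "x \<in> S" using B assms(1) by (auto simp: partition_on_def)
    moreover have "x \<notin> C" if "C \<in> big_blocks P" for C
    proof
      assume "x \<in> C"
      then have "C \<in> P" "C \<inter> B \<noteq> {}" using that x by (auto simp: big_blocks_def)
      then have "C = B" using B assms(1) unfolding partition_on_def disjoint_def by blast
      then show False using that True by (simp add: big_blocks_def)
    qed
    ultimately show ?thesis using x by blast
  qed (use B in \<open>simp add: big_blocks_def\<close>)
next
  fix B assume "B \<in> big_blocks P \<union> (\<lambda>x. {x}) ` (S - \<Union>(big_blocks P))"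
  then consider "B \<in> big_blocks P" | x where "B = {x}" "x \<in> S" "x \<notin> \<Union>(big_blocks P)" by blast
  then show "B \<in> P"
  proof cases
    case 2
    then obtain C where C: "C \<in> P" "x \<in> C" using assms(1) by (auto simp: partition_on_def)
    then have "card C = 1" using 2 by (auto simp: big_blocks_def)
    then show ?thesis using C 2 by (auto simp: card_1_singleton_iff)
  qed (simp add: big_blocks_def)
qed

text \<open>A nonzero coordinate makes the block minima of P a transversal of the non-singleton
  blocks of Q, so each is at least the minimum of the block of Q that it lies in; dually for maxima.
  Summing over the blocks of Q gives the inequality. Equality forces the sets of minima and of
  maxima to agree, and \<open>noncrossing_determined\<close> applies.\<close>

lemma pvec_lead_spread:
  assumes P: "partition_on S P" and Q: "partition_on S Q" and S: "finite S"
    and nz: "pvec Q (lead_triple P) \<noteq> 0"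
  shows "spread P \<le> spread Q"
    and "spread P = spread Q \<Longrightarrow> noncrossing P \<Longrightarrow> noncrossing Q \<Longrightarrow> P = Q"
proof -
  let ?X = "Min ` big_blocks P" and ?Y = "Max ` big_blocks P"
  obtain rs where L: "lead_triple P = (?X, ?Y, rs)" by (simp add: lead_triple_def)
  note bP = big_blocks_partition[OF P S] and bQ = big_blocks_partition[OF Q S]
  obtain bs where bs: "distinct bs" "set bs = big_blocks Q"
    using finite_distinct_list[OF finite_big_blocks[OF Q S]] by blast
  have tr: "transv Q (?X, ?Y, rs)" and di: "distinct (word_of bs (?X, ?Y, rs))"
    using pvec_nonzeroD[OF nz bs] L by simp_all
  have inj: "inj_on (pick ?X) (big_blocks Q)" "inj_on (pick ?Y) (big_blocks Q)"
    using di bs by (auto simp: word_of_def distinct_map)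
  have injP: "inj_on Min (big_blocks P)" "inj_on Max (big_blocks P)"
    using bP(4,5) big_blocks_disjoint[OF P] by (metis inj_onI)+
  note img = transv_pick_image[OF tr]
  have mem: "pick ?X B \<in> B" "pick ?Y B \<in> B" if "B \<in> big_blocks Q" for B
    using tr that pick_in by (auto simp: transv_def)
  have sX: "(\<Sum>B\<in>big_blocks Q. int (pick ?X B)) = (\<Sum>B\<in>big_blocks P. int (Min B))"
    using sum.reindex[OF inj(1), of int] sum.reindex[OF injP(1), of int] img by simp
  have sY: "(\<Sum>B\<in>big_blocks Q. int (pick ?Y B)) = (\<Sum>B\<in>big_blocks P. int (Max B))"
    using sum.reindex[OF inj(2), of int] sum.reindex[OF injP(2), of int] img by simp
  let ?f = "\<lambda>B. (int (Max B) - int (pick ?Y B)) + (int (pick ?X B) - int (Min B))"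
  have diff: "spread Q - spread P = (\<Sum>B\<in>big_blocks Q. ?f B)"
    unfolding spread_def sum_subtractf sum.distrib sX sY by simp
  have nonneg: "int (Max B) - int (pick ?Y B) \<ge> 0" "int (pick ?X B) - int (Min B) \<ge> 0"
    if "B \<in> big_blocks Q" for B
    using mem[OF that] bQ(1)[OF that] by simp_all
  then have "(\<Sum>B\<in>big_blocks Q. ?f B) \<ge> 0" by (intro sum_nonneg add_nonneg_nonneg)
  with diff show "spread P \<le> spread Q" by simp
  assume eq: "spread P = spread Q" and nc: "noncrossing P" "noncrossing Q"
  have "?f B = 0" if "B \<in> big_blocks Q" for B
    using diff eq that nonneg sum_nonneg_eq_0_iff[OF finite_big_blocks[OF Q S], of ?f] by auto
  then have "pick ?Y B = Max B" "pick ?X B = Min B" if "B \<in> big_blocks Q" for B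
    using nonneg[OF that] that by fastforce+
  then have mm: "Min ` big_blocks Q = ?X" "Max ` big_blocks Q = ?Y"
    using img by (auto simp: image_iff)
  have "transv P (lead_triple P)"
    using pvec_lead_nonzero[OF P S] by (auto simp: pvec_def split: if_splits)
  then have U: "\<Union>(big_blocks P) = \<Union>(big_blocks Q)" using tr L by (simp add: transv_def)
  have fin: "finite B" if "B \<in> P \<or> B \<in> Q" for B
    using that P Q S finite_subset[of B S] by (auto simp: partition_on_def)
  \<comment> \<open>A singleton is its own minimum and maximum, and both partitions have the same
    singletons. This extends the agreement of the extremes from non-singleton blocks to all
    blocks.\<close>
  have dP: "f ` P = f ` big_blocks P \<union> (\<lambda>x. f {x}) ` (S - \<Union>(big_blocks P))"
    and dQ: "f ` Q = f ` big_blocks Q \<union> (\<lambda>x. f {x}) ` (S - \<Union>(big_blocks Q))" for f :: "nat set \<Rightarrow> nat"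
    using partition_on_big_blocks[OF P] partition_on_big_blocks[OF Q] fin
    by (metis image_Un image_image)+
  show "P = Q"
    by (rule noncrossing_determined[OF S P nc(1) Q nc(2)]) (simp_all only: dP dQ mm U)
qed

text \<open>At the leading coordinate of a P of maximal spread in the support, every other term
  vanishes by \<open>pvec_lead_spread\<close>.\<close>

lemma web_eq_0:
  assumes v: "v \<in> supp_in (NC n)" and 0: "\<And>T. web n v T = 0"
  shows "v = 0"
proof (rule ccontr)
  assume "v \<noteq> 0"
  let ?A = "{P \<in> NC n. v P \<noteq> 0}"
  have "?A \<noteq> {}" using \<open>v \<noteq> 0\<close> v by (auto simp: supp_in_def fun_eq_iff)
  moreover have fin: "finite ?A" using finite_NC by simp
  ultimately have "Max (spread ` ?A) \<in> spread ` ?A" by (intro Max_in) auto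
  then obtain P where P: "P \<in> ?A" "spread P = Max (spread ` ?A)" by auto
  have part: "partition_on {1..n} Q" "noncrossing Q" if "Q \<in> NC n" for Q
    using that by (auto simp: NC_def)
  have "v Q * pvec Q (lead_triple P) = 0" if "Q \<in> NC n - {P}" for Q
  proof (rule ccontr)
    assume nz: "v Q * pvec Q (lead_triple P) \<noteq> 0"
    then have "spread Q \<le> spread P" using that fin P(2) by simp
    moreover note * = pvec_lead_spread[of "{1..n}" P Q]
    ultimately show False using nz that P(1) part by (metis (no_types, lifting) DiffE antisym finite_atLeastAtMost
      insertI1 mem_Collect_eq mult_eq_0_iff)
  qed
  then have "(\<Sum>Q\<in>NC n - {P}. v Q * pvec Q (lead_triple P)) = 0" by (intro sum.neutral ballI)
  then have "web n v (lead_triple P) = v P * pvec P (lead_triple P)"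
    unfolding web_def using P(1) finite_NC by (subst sum.remove[of _ P]) auto
  moreover have "pvec P (lead_triple P) \<noteq> 0"
    using pvec_lead_nonzero part(1) P(1) by blast
  ultimately show False using 0 P(1) by simp
qed

lemma web_inj:
  assumes "u \<in> supp_in (NC n)" "v \<in> supp_in (NC n)" "\<And>T. web n u T = web n v T"
  shows "u = v"
proof -
  have "u - v = 0"
    by (rule web_eq_0[of _ n]) (use assms in \<open>simp_all only: supp_in_diff web_diff diff_self\<close>)
  then show ?thesis by simp
qed

lemma skein_act_linear:
  assumes "w permutes {1..n}" "u \<in> supp_in (NC n)" "v \<in> supp_in (NC n)"
  shows "skein_act n w (u + v) = skein_act n w u + skein_act n w v"
    and "skein_act n w (scl c v) = scl c (skein_act n w v)"
proof -
  have s: "skein_act n w x \<in> supp_in (NC n)" if "x \<in> supp_in (NC n)" for x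
    using supp_in_skein_act[OF assms(1)] that unfolding NC_eq_NC_typed(1) by blast
  show "skein_act n w (u + v) = skein_act n w u + skein_act n w v"
    by (rule web_inj[of _ n]) (intro s supp_in_add assms, intro s supp_in_add assms,
      simp only: web_skein_act[OF assms(1)] web_add)
  show "skein_act n w (scl c v) = scl c (skein_act n w v)"
    by (rule web_inj[of _ n]) (intro s supp_in_scl assms, intro s supp_in_scl assms,
      simp only: web_skein_act[OF assms(1)] web_scl)
qed

section \<open>Module structure and the direct sum decompositions\<close>

lemma space_skein_rep: "space (skein_rep n X) = supp_in X"
  by (simp add: skein_rep_def supp_in_def)

lemma act_skein_rep: "act (skein_rep n X) = skein_act n"
  by (simp add: skein_rep_def)

lemma subspace_supp_in: "fn.subspace (supp_in X)"
  unfolding fn.subspace_def using supp_in_0 supp_in_add supp_in_scl by blast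

text \<open>After applying \<open>web\<close>, each law of an action becomes one about
  \<open>tact\<close> permuting coordinates, and \<open>web_inj\<close> pulls it back.\<close>

lemma is_rep_skein_rep: "is_rep (sym_group n) (skein_rep n (NC_typed n h))"
  unfolding is_rep_def space_skein_rep act_skein_rep sym_group_carrier sym_group_mult sym_group_one
proof (intro conjI ballI allI)
  fix g v assume g: "g \<in> carrier (sym_group n)" and v: "v \<in> supp_in (NC_typed n h)"
  then show "skein_act n g v \<in> supp_in (NC_typed n h)"
    by (intro supp_in_skein_act) (simp_all add: sym_group_carrier)
  show "skein_act n g (scl c v) = scl c (skein_act n g v)" for c
    by (rule skein_act_linear(2)) (use g v supp_in_NC_typed sym_group_carrier in auto)
  show "skein_act n g (v + w) = skein_act n g v + skein_act n g w" if "w \<in> supp_in (NC_typed n h)" for w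
    by (rule skein_act_linear(1)) (use g v that supp_in_NC_typed sym_group_carrier in auto)
  show "skein_act n (g \<circ> g') v = skein_act n g (skein_act n g' v)" if "g' \<in> carrier (sym_group n)" for g'
  proof (rule web_inj[of _ n])
    have p: "g permutes {1..n}" "g' permutes {1..n}" "g \<circ> g' permutes {1..n}"
      using g that by (auto simp: sym_group_carrier intro: permutes_compose)
    show "skein_act n (g \<circ> g') v \<in> supp_in (NC n)" "skein_act n g (skein_act n g' v) \<in> supp_in (NC n)"
      using supp_in_skein_act[OF p(3) v] supp_in_skein_act[OF p(1) supp_in_skein_act[OF p(2) v]]
        supp_in_NC_typed by blast+
    have "inv' (g \<circ> g') = inv' g' \<circ> inv' g"
      using o_inv_distrib permutes_bij p by blast
    then show "web n (skein_act n (g \<circ> g') v) T = web n (skein_act n g (skein_act n g' v)) T" for T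
      by (simp only: web_skein_act[OF p(1)] web_skein_act[OF p(2)] web_skein_act[OF p(3)] tact_comp)
  qed
next
  fix v assume v: "v \<in> supp_in (NC_typed n h)"
  show "skein_act n id v = v"
  proof (rule web_inj[of _ n])
    show "skein_act n id v \<in> supp_in (NC n)" "v \<in> supp_in (NC n)"
      using supp_in_skein_act[OF permutes_id v] v supp_in_NC_typed by blast+
    show "web n (skein_act n id v) T = web n v T" for T
      using web_skein_act[OF permutes_id, of n v T] by simp
  qed
qed (rule subspace_supp_in)

lemma is_rep_direct_sum:
  assumes "\<And>i. is_rep G (M i)"
  shows "is_rep G (direct_sum M)"
proof -
  note M = assms[unfolded is_rep_def]
  have sub: "fn.subspace (space (M i))" for i using M by blast
  have act0: "act (M i) g 0 = 0" if "g \<in> carrier G" for i g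
  proof -
    have "act (M i) g (scl 0 0) = scl 0 (act (M i) g 0)" using M that fn.subspace_0[OF sub] by blast
    then show ?thesis by simp
  qed
  define S where "S = space (direct_sum M)"
  have S: "f \<in> S \<longleftrightarrow> (\<forall>i. (\<lambda>b. f (i, b)) \<in> space (M i)) \<and> finite {i. (\<lambda>b. f (i, b)) \<noteq> 0}" for f
    by (simp add: S_def direct_sum_def)
  define A where "A = act (direct_sum M)"
  have A: "(\<lambda>b. A g f (i, b)) = act (M i) g (\<lambda>b. f (i, b))" for g f i
    by (simp add: A_def direct_sum_def)
  have ext: "f = f'" if "\<And>i. (\<lambda>b. f (i, b)) = (\<lambda>b. f' (i, b))" for f f' :: "'a \<times> 'd \<Rightarrow> rat"
    using that by (auto simp: fun_eq_iff)
  have pl: "(\<lambda>b. (f + f') (i, b)) = (\<lambda>b. f (i, b)) + (\<lambda>b. f' (i, b))" for f f' :: "'a \<times> 'd \<Rightarrow> rat" and i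
    by (simp add: plus_fun_def)
  have sc: "(\<lambda>b. scl c f (i, b)) = scl c (\<lambda>b. f (i, b))" for c and f :: "'a \<times> 'd \<Rightarrow> rat" and i
    by (simp add: scl_def)
  have "fn.subspace S"
    unfolding fn.subspace_def
  proof (intro conjI ballI allI)
    have z: "(\<lambda>b. 0 (i, b)) = (0 :: 'd \<Rightarrow> rat)" for i :: 'a by (simp add: fun_eq_iff)
    show "0 \<in> S" unfolding S z using fn.subspace_0[OF sub] by simp
    fix f assume f: "f \<in> S"
    show "f + f' \<in> S" if "f' \<in> S" for f'
    proof -
      have "{i. (\<lambda>b. f (i, b)) + (\<lambda>b. f' (i, b)) \<noteq> 0} \<subseteq> {i. (\<lambda>b. f (i, b)) \<noteq> 0} \<union> {i. (\<lambda>b. f' (i, b)) \<noteq> 0}"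
        by auto
      then show ?thesis using f that fn.subspace_add[OF sub] unfolding S pl
        by (auto intro: finite_subset)
    qed
    show "scl c f \<in> S" for c
    proof -
      have "{i. scl c (\<lambda>b. f (i, b)) \<noteq> 0} \<subseteq> {i. (\<lambda>b. f (i, b)) \<noteq> 0}" by (auto simp: scl_def fun_eq_iff)
      then show ?thesis using f fn.subspace_scale[OF sub] unfolding S sc by (auto intro: finite_subset)
    qed
  qed
  moreover have "A g f \<in> S" if "g \<in> carrier G" "f \<in> S" for g f
  proof -
    have "{i. act (M i) g (\<lambda>b. f (i, b)) \<noteq> 0} \<subseteq> {i. (\<lambda>b. f (i, b)) \<noteq> 0}" using act0 that by auto
    then show ?thesis using that M unfolding S A by (auto intro: finite_subset)
  qed
  moreover have "A g (f + f') = A g f + A g f'" if "g \<in> carrier G" "f \<in> S" "f' \<in> S" for g f f'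
    by (rule ext) (use M that in \<open>simp only: A pl S\<close>)
  moreover have "A g (scl c f) = scl c (A g f)" if "g \<in> carrier G" "f \<in> S" for g c f
    by (rule ext) (use M that in \<open>simp only: A sc S\<close>)
  moreover have "A \<one>\<^bsub>G\<^esub> f = f" if "f \<in> S" for f
    by (rule ext) (use M that in \<open>simp only: A S\<close>)
  moreover have "A (g \<otimes>\<^bsub>G\<^esub> h) f = A g (A h f)" if "g \<in> carrier G" "h \<in> carrier G" "f \<in> S" for g h f
    by (rule ext) (use M that in \<open>simp only: A S\<close>)
  ultimately show ?thesis unfolding is_rep_def S_def A_def by blast
qed

text \<open>The vectors of degree i and those without a component of degree i are both stable, so
  the projection to degree i commutes with the action. The degree \<open>r\<close> will be the
  number of blocks for one decomposition and the number of singletons for the other.\<close>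

lemma rep_isomorphic_graded:
  fixes r :: "nat \<times> nat \<Rightarrow> nat"
  shows "rep_isomorphic (sym_group n) (skein_rep n (NC_typed n h))
    (direct_sum (\<lambda>i. skein_rep n (NC_typed n (\<lambda>t. h t \<and> r t = i))))"
proof -
  let ?M = "\<lambda>i. skein_rep n (NC_typed n (\<lambda>t. h t \<and> r t = i))"
  define proj where "proj i v = (\<lambda>P. if r (block_type P) = i then v P else (0 :: rat))" for i v
  define f where "f v = (\<lambda>(i, P). proj i v P)" for v
  have sD: "F \<in> space (direct_sum ?M) \<longleftrightarrow> (\<forall>i. (\<lambda>P. F (i, P)) \<in> supp_in (NC_typed n (\<lambda>t. h t \<and> r t = i)))
      \<and> finite {i. (\<lambda>P. F (i, P)) \<noteq> 0}" for F
    by (simp add: direct_sum_def space_skein_rep)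
  have proj_in: "proj i v \<in> supp_in (NC_typed n (\<lambda>t. h t \<and> r t = i))" if "v \<in> supp_in (NC_typed n h)" for i v
    using that by (auto simp: proj_def supp_in_def NC_typed_def)
  have finr: "finite ((\<lambda>P. r (block_type P)) ` NC n)" using finite_NC by simp
  have fS: "f v \<in> space (direct_sum ?M)" if "v \<in> supp_in (NC_typed n h)" for v
  proof -
    have "{i. proj i v \<noteq> 0} \<subseteq> (\<lambda>P. r (block_type P)) ` NC n"
    proof
      fix i assume "i \<in> {i. proj i v \<noteq> 0}"
      then obtain P where "proj i v P \<noteq> 0" by (auto simp: fun_eq_iff)
      then have "r (block_type P) = i" "v P \<noteq> 0" by (auto simp: proj_def split: if_splits)
      then show "i \<in> (\<lambda>P. r (block_type P)) ` NC n" using that by (auto simp: supp_in_def NC_typed_def)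
    qed
    then show ?thesis unfolding sD using proj_in[OF that] finr by (simp add: f_def finite_subset)
  qed
  define g where "g F = (\<lambda>P. F (r (block_type P), P))" for F :: "nat \<times> nat set set \<Rightarrow> rat"
  have "bij_betw f (supp_in (NC_typed n h)) (space (direct_sum ?M))"
  proof (rule bij_betw_byWitness[where f' = g])
    show "\<forall>v\<in>supp_in (NC_typed n h). g (f v) = v" by (simp add: g_def f_def proj_def)
    show "\<forall>F\<in>space (direct_sum ?M). f (g F) = F"
    proof
      fix F assume F: "F \<in> space (direct_sum ?M)"
      have "f (g F) (i, P) = F (i, P)" for i P
        using F unfolding sD by (auto simp: f_def g_def proj_def supp_in_def NC_typed_def)
      then show "f (g F) = F" by auto
    qed
    show "f ` supp_in (NC_typed n h) \<subseteq> space (direct_sum ?M)" using fS by blast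
    show "g ` space (direct_sum ?M) \<subseteq> supp_in (NC_typed n h)"
    proof
      fix v assume "v \<in> g ` space (direct_sum ?M)"
      then obtain F where "F \<in> space (direct_sum ?M)" "v = g F" by blast
      then show "v \<in> supp_in (NC_typed n h)" unfolding sD by (auto simp: g_def supp_in_def NC_typed_def)
    qed
  qed
  moreover have "f (u + v) = f u + f v" for u v by (auto simp: f_def proj_def fun_eq_iff)
  moreover have "f (scl c v) = scl c (f v)" for c v by (auto simp: f_def proj_def scl_def fun_eq_iff)
  moreover have "f (skein_act n w v) = act (direct_sum ?M) w (f v)"
    if w: "w permutes {1..n}" and v: "v \<in> supp_in (NC_typed n h)" for w v
  proof -
    have "proj i (skein_act n w v) = skein_act n w (proj i v)" for i
    proof -
      have rest: "v - proj i v \<in> supp_in (NC_typed n (\<lambda>t. h t \<and> r t \<noteq> i))"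
        using v by (auto simp: proj_def supp_in_def NC_typed_def)
      have "skein_act n w v = skein_act n w (proj i v + (v - proj i v))" by simp
      also have "\<dots> = skein_act n w (proj i v) + skein_act n w (v - proj i v)"
        using proj_in[OF v] rest supp_in_NC_typed by (intro skein_act_linear(1)[OF w]) blast+
      finally have "skein_act n w v = skein_act n w (proj i v) + skein_act n w (v - proj i v)" .
      moreover have "proj i (skein_act n w (proj i v)) = skein_act n w (proj i v)"
        using supp_in_skein_act[OF w proj_in[OF v]] by (auto simp: proj_def supp_in_def NC_typed_def fun_eq_iff)
      moreover have "proj i (skein_act n w (v - proj i v)) = 0"
        using supp_in_skein_act[OF w rest] by (auto simp: proj_def supp_in_def NC_typed_def fun_eq_iff)
      moreover have "proj i (a + b) = proj i a + proj i b" for a b by (auto simp: proj_def fun_eq_iff)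
      ultimately show ?thesis by simp
    qed
    then show ?thesis by (auto simp: f_def direct_sum_def act_skein_rep fun_eq_iff)
  qed
  ultimately show ?thesis
    unfolding rep_isomorphic_def space_skein_rep act_skein_rep sym_group_carrier
    using is_rep_skein_rep is_rep_direct_sum[OF is_rep_skein_rep]
    by (intro conjI exI[of _ f]) (auto simp: sym_group_carrier)
qed

lemma V_decompositions:
  "rep_isomorphic (sym_group n) (V n) (direct_sum (\<lambda>k. V_blocks n k))"
  "rep_isomorphic (sym_group n) (V_blocks n k) (direct_sum (\<lambda>s. V_blocks_singletons n k s))"
  using rep_isomorphic_graded[of n "\<lambda>_. True" fst] rep_isomorphic_graded[of n "\<lambda>t. fst t = k" snd]
  by (simp_all add: V_def V_blocks_def V_blocks_singletons_def NC_eq_NC_typed)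

section \<open>Polytabloids as vectors of set partitions\<close>

lemma wsign_square: "distinct xs \<Longrightarrow> wsign xs * wsign xs = 1"
  using wsign_abs[of xs] by auto

text \<open>For j = 0 a weakly decreasing sequence has no ones after the zeros. Hence the assumption
  \<open>j = 0 \<longrightarrow> q = 0\<close> below, under which the shape is empty or starts with
  two rows of length j.\<close>

definition shape :: "nat \<Rightarrow> nat \<Rightarrow> nat list"
  where "shape j q = filter (\<lambda>x. x > 0) ([j, j] @ replicate q 1)"

lemma shape_pos: "j > 0 \<Longrightarrow> shape j q = [j, j] @ replicate q 1"
  by (simp add: shape_def)

lemma shape_0: "shape 0 0 = []"
  by (simp add: shape_def)

lemma cells_shape:
  assumes "j = 0 \<longrightarrow> q = 0"
  shows "cells (shape j q) = {(r, c). c < j \<and> r < (if c = 0 then q + 2 else 2)}"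
proof (cases "j = 0")
  case True
  then show ?thesis using assms by (simp add: shape_0 cells_def)
next
  case False
  have "(r < length (shape j q) \<and> c < shape j q ! r) \<longleftrightarrow> (c < j \<and> r < (if c = 0 then q + 2 else 2))" for r c
  proof -
    consider "r = 0" | "r = 1" | r' where "r = r' + 2"
      by (metis One_nat_def add_2_eq_Suc' not0_implies_Suc)
    then show ?thesis using False by cases (auto simp: shape_pos nth_append)
  qed
  then show ?thesis by (simp add: cells_def)
qed

lemma sum_list_shape: "sum_list (shape j q) = 2 * j + q"
  by (cases "j = 0") (simp_all add: shape_def sum_list_replicate)

text \<open>The order of the cells is that of the letters in \<open>word_of\<close>: first row,
  second row, then the rest of the first column. A tableau read along it is the word of its own
  \<open>row_triple\<close> for its columns taken in order.\<close>

definition cellseq :: "nat \<Rightarrow> nat \<Rightarrow> (nat \<times> nat) list"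
  where "cellseq j q = map (Pair 0) [0..<j] @ map (Pair 1) [0..<j] @ map (\<lambda>r. (r + 2, 0)) [0..<q]"

lemma distinct_cellseq: "distinct (cellseq j q)"
  by (auto simp: cellseq_def distinct_map inj_on_def)

lemma set_cellseq:
  assumes "j = 0 \<longrightarrow> q = 0"
  shows "set (cellseq j q) = cells (shape j q)"
  unfolding cells_shape[OF assms]
proof (intro equalityI subsetI)
  fix x assume "x \<in> {(r, c). c < j \<and> r < (if c = 0 then q + 2 else 2)}"
  then obtain r c where x: "x = (r, c)" "c < j" "r < (if c = 0 then q + 2 else 2)" by auto
  then consider "r = 0" | "r = 1" | r' where "r = r' + 2" "c = 0" "r' < q"
  proof (cases "r < 2")
    case True
    with that show ?thesis by linarith
  next
    case False
    then have "r = (r - 2) + 2" by simp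
    moreover have "c = 0" "r - 2 < q" using False x(3) by (auto split: if_splits)
    ultimately show ?thesis using that by blast
  qed
  then show "x \<in> set (cellseq j q)" using x by cases (auto simp: cellseq_def)
qed (use assms in \<open>auto simp: cellseq_def\<close>)

definition row_triple :: "nat \<Rightarrow> nat \<Rightarrow> (nat \<times> nat \<Rightarrow> nat) \<Rightarrow> triple"
  where "row_triple j q t = (t ` Pair 0 ` {..<j}, t ` Pair 1 ` {..<j}, map (\<lambda>r. t (r + 2, 0)) [0..<q])"

text \<open>
  For \<open>j = 0\<close> the shape is empty, so the two empty rows of the triple are dropped from the tabloid.
\<close>

definition of_triple :: "nat \<Rightarrow> triple \<Rightarrow> nat set list"
  where "of_triple j = (\<lambda>(X, Y, rs). if j = 0 then [] else X # Y # map (\<lambda>r. {r}) rs)"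

definition to_triple :: "nat set list \<Rightarrow> triple"
  where "to_triple T = (if T = [] then {} else hd T, if T = [] then {} else hd (tl T), map the_elem (drop 2 T))"

lemma tabloid_shape:
  assumes "j = 0 \<longrightarrow> q = 0"
  shows "tabloid (shape j q) t = of_triple j (row_triple j q t)"
proof (cases "j = 0")
  case True
  then show ?thesis using assms by (simp add: shape_0 tabloid_def of_triple_def row_triple_def)
next
  case False
  have "[0..<length (shape j q)] = 0 # 1 # map (\<lambda>r. r + 2) [0..<q]"
  proof -
    have "[0..<q + 2] = 0 # 1 # [2..<q + 2]" by (simp add: upt_conv_Cons numeral_2_eq_2 del: upt_Suc)
    then show ?thesis using False by (simp only: map_add_upt) (simp add: shape_pos del: upt_Suc)
  qed
  moreover have "{x \<in> cells (shape j q). fst x = 0} = Pair 0 ` {..<j}"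
    "{x \<in> cells (shape j q). fst x = 1} = Pair 1 ` {..<j}"
    unfolding cells_shape[OF assms] by (auto split: if_splits)
  moreover have "{x \<in> cells (shape j q). fst x = r + 2} = {(r + 2, 0)}" if "r < q" for r
    unfolding cells_shape[OF assms] using that False by (auto split: if_splits)
  ultimately show ?thesis using False by (simp add: tabloid_def of_triple_def row_triple_def)
qed

lemma to_triple_of_triple: "j > 0 \<Longrightarrow> to_triple (of_triple j T) = T"
  by (auto simp: to_triple_def of_triple_def o_def split: prod.splits)

lemma to_triple_tabloid:
  assumes "j = 0 \<longrightarrow> q = 0"
  shows "to_triple (tabloid (shape j q) t) = row_triple j q t"
proof (cases "j = 0")
  case True
  then show ?thesis using assms by (simp add: shape_0 tabloid_def to_triple_def row_triple_def)
qed (simp add: tabloid_shape[OF assms] to_triple_of_triple)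

lemma tabloid_eq_iff:
  assumes "j = 0 \<longrightarrow> q = 0"
  shows "tabloid (shape j q) t = tabloid (shape j q) t' \<longleftrightarrow> row_triple j q t = row_triple j q t'"
  by (metis to_triple_tabloid[OF assms] tabloid_shape[OF assms])

lemma tableaux_shape:
  assumes "j = 0 \<longrightarrow> q = 0"
  shows "t \<in> tableaux (shape j q) \<longleftrightarrow>
    distinct (map t (cellseq j q)) \<and> set (map t (cellseq j q)) = {1..2 * j + q}"
  using distinct_cellseq[of j q]
  by (simp add: tableaux_def bij_betw_def sum_list_shape distinct_map set_cellseq[OF assms])

section \<open>Columns of a tableau and its polytabloid\<close>

definition colset :: "nat \<Rightarrow> nat \<Rightarrow> nat \<Rightarrow> (nat \<times> nat) set"
  where "colset j q c = {x \<in> cells (shape j q). snd x = c}"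

definition colpart :: "nat \<Rightarrow> nat \<Rightarrow> (nat \<times> nat \<Rightarrow> nat) \<Rightarrow> nat set set"
  where "colpart j q t = (\<lambda>c. t ` colset j q c) ` {..<j}"

text \<open>\<open>pvec\<close> read in the coordinates of the permutation module on tabloids. Other
  lists are given the value 0 because \<open>to_triple\<close> also decodes lists that are not
  tabloids.\<close>

definition tvec :: "nat \<Rightarrow> nat \<Rightarrow> nat set set \<Rightarrow> nat set list \<Rightarrow> rat"
  where "tvec j q P T = (if T \<in> tabloid (shape j q) ` tableaux (shape j q) then pvec P (to_triple T) else 0)"

context
  fixes j q :: nat
  assumes jq: "j = 0 \<longrightarrow> q = 0"
begin

lemma colset_mem: "(r, c') \<in> colset j q c \<longleftrightarrow> c' = c \<and> c < j \<and> r < (if c = 0 then q + 2 else 2)"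
  unfolding colset_def cells_shape[OF jq] by auto

lemma colset_sub: "colset j q c \<subseteq> cells (shape j q)"
  by (auto simp: colset_def)

lemma finite_cells: "finite (cells (shape j q))"
  using set_cellseq[OF jq] by (metis List.finite_set)

lemma tableau_inj: "t \<in> tableaux (shape j q) \<Longrightarrow> inj_on t (cells (shape j q))"
  and tableau_image: "t \<in> tableaux (shape j q) \<Longrightarrow> t ` cells (shape j q) = {1..2 * j + q}"
  by (simp_all add: tableaux_def bij_betw_def sum_list_shape)

lemma Union_colset: "(\<Union>c<j. colset j q c) = cells (shape j q)"
  using colset_mem cells_shape[OF jq] by (auto simp: colset_def)

lemma Union_colpart:
  assumes "t \<in> tableaux (shape j q)"
  shows "\<Union>(colpart j q t) = {1..2 * j + q}"
  using tableau_image[OF assms] by (simp add: colpart_def flip: Union_colset image_UN)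

lemma colset_cells: "c < j \<Longrightarrow> (0, c) \<in> colset j q c" "c < j \<Longrightarrow> (1, c) \<in> colset j q c"
  by (auto simp: colset_mem)

lemma colset_image_disjoint:
  assumes "t \<in> tableaux (shape j q)" "x \<in> t ` colset j q c" "x \<in> t ` colset j q c'"
  shows "c = c'"
proof -
  obtain u v where "u \<in> colset j q c" "v \<in> colset j q c'" "t u = t v" using assms(2,3) by force
  then show ?thesis using tableau_inj[OF assms(1)] by (auto simp: colset_def dest: inj_onD)
qed

lemma big_blocks_colpart:
  assumes "t \<in> tableaux (shape j q)"
  shows "big_blocks (colpart j q t) = colpart j q t"
proof -
  have "card (t ` colset j q c) \<noteq> 1" if "c < j" for c
  proof
    assume "card (t ` colset j q c) = 1"
    then have "card (colset j q c) = 1"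
      using tableau_inj[OF assms] colset_sub card_image inj_on_subset by metis
    then obtain z where "colset j q c = {z}" by (auto simp: card_1_singleton_iff)
    then show False using colset_cells[OF that] by auto
  qed
  then show ?thesis by (auto simp: big_blocks_def colpart_def)
qed

lemma colpart_enum:
  assumes "t \<in> tableaux (shape j q)"
  shows "distinct (map (\<lambda>c. t ` colset j q c) [0..<j])"
    "set (map (\<lambda>c. t ` colset j q c) [0..<j]) = big_blocks (colpart j q t)"
proof -
  have "inj_on (\<lambda>c. t ` colset j q c) {0..<j}"
  proof (rule inj_onI)
    fix c c' assume "c \<in> {0..<j}" "c' \<in> {0..<j}" and eq: "t ` colset j q c = t ` colset j q c'"
    then have "t (0, c) \<in> t ` colset j q c" using colset_cells by auto
    with eq show "c = c'" using colset_image_disjoint[OF assms] by blast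
  qed
  then show "distinct (map (\<lambda>c. t ` colset j q c) [0..<j])" by (simp add: distinct_map)
  show "set (map (\<lambda>c. t ` colset j q c) [0..<j]) = big_blocks (colpart j q t)"
    unfolding big_blocks_colpart[OF assms] by (simp add: colpart_def atLeast0LessThan)
qed

lemma column_stabilizer_iff:
  "p \<in> column_stabilizer (shape j q) t \<longleftrightarrow> p permutes {1..2 * j + q} \<and>
    (\<forall>c. p ` t ` colset j q c = t ` colset j q c)"
  by (simp add: column_stabilizer_def sum_list_shape colset_def)

lemma tableau_comp:
  assumes "t \<in> tableaux (shape j q)" "p permutes {1..2 * j + q}"
  shows "p \<circ> t \<in> tableaux (shape j q)"
  using assms(1) permutes_imp_bij[OF assms(2)]
  by (auto simp: tableaux_def sum_list_shape intro: bij_betw_trans)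

lemma word_of_column:
  assumes t: "t \<in> tableaux (shape j q)" and u: "u \<in> tableaux (shape j q)"
    and col: "\<And>c. u ` colset j q c \<subseteq> t ` colset j q c"
  shows "transv (colpart j q t) (row_triple j q u)"
    "word_of (map (\<lambda>c. t ` colset j q c) [0..<j]) (row_triple j q u) = map u (cellseq j q)"
proof -
  have in0: "u (r, c) \<in> t ` colset j q c" if "(r, c) \<in> colset j q c" for r c
    using col that by blast
  have int: "u ` Pair i ` {..<j} \<inter> t ` colset j q c = {u (i, c)}"
    if "c < j" "i = 0 \<or> i = 1" for i c
  proof (intro equalityI subsetI)
    fix x assume x: "x \<in> u ` Pair i ` {..<j} \<inter> t ` colset j q c"
    then obtain c' where c': "c' < j" "x = u (i, c')" by auto
    then have "x \<in> t ` colset j q c'" using in0 colset_cells that by auto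
    then have "c = c'" using colset_image_disjoint[OF t] x by blast
    then show "x \<in> {u (i, c)}" using c' by simp
  next
    fix x assume "x \<in> {u (i, c)}"
    then show "x \<in> u ` Pair i ` {..<j} \<inter> t ` colset j q c"
      using that in0[of i c] colset_cells[of c] by auto
  qed
  have "u ` Pair 0 ` {..<j} \<union> u ` Pair 1 ` {..<j} \<union> set (map (\<lambda>r. u (r + 2, 0)) [0..<q])
      = set (map u (cellseq j q))"
    by (simp add: cellseq_def image_image image_Un atLeast0LessThan Un_assoc)
  also have "\<dots> = \<Union>(big_blocks (colpart j q t))"
    using u tableaux_shape[OF jq] Union_colpart[OF t] big_blocks_colpart[OF t] by simp
  finally show "transv (colpart j q t) (row_triple j q u)"
    using int unfolding transv_def row_triple_def big_blocks_colpart[OF t]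
    by (auto simp: colpart_def is_singleton_def)
  show "word_of (map (\<lambda>c. t ` colset j q c) [0..<j]) (row_triple j q u) = map u (cellseq j q)"
    using int by (simp add: word_of_def row_triple_def cellseq_def pick_def)
qed

text \<open>The transversals give each column of t a first and a second entry, and \<open>rs\<close>
  fills the rest of the first column. The resulting filling u is a tableau because its word is
  distinct and has the right letters. It has the same column sets as t, so the permutation p that
  carries t to u stabilises them.\<close>

lemma ex_column_perm:
  assumes t: "t \<in> tableaux (shape j q)" and t': "t' \<in> tableaux (shape j q)"
    and nz: "pvec (colpart j q t) (row_triple j q t') \<noteq> 0"
  shows "\<exists>p\<in>column_stabilizer (shape j q) t. tabloid (shape j q) t' = tabloid (shape j q) (p \<circ> t)"
proof -
  let ?m = "2 * j + q" and ?C = "cells (shape j q)" and ?bs = "map (\<lambda>c. t ` colset j q c) [0..<j]"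
  obtain X Y rs where T: "row_triple j q t' = (X, Y, rs)" by (cases "row_triple j q t'")
  have len: "length rs = q" using T by (auto simp: row_triple_def)
  have tr: "transv (colpart j q t) (X, Y, rs)" and di: "distinct (word_of ?bs (X, Y, rs))"
    using pvec_nonzeroD[OF nz colpart_enum[OF t]] T by simp_all
  define u where "u = (\<lambda>(r, c). if r = 0 then pick X (t ` colset j q c)
    else if r = (1::nat) then pick Y (t ` colset j q c) else rs ! (r - 2))"
  have rs: "map (\<lambda>r. u (r + 2, 0)) [0..<q] = rs"
    using len map_nth[of rs] by (simp add: u_def)
  have w: "map u (cellseq j q) = word_of ?bs (X, Y, rs)"
    using rs by (simp add: cellseq_def word_of_def o_def) (simp add: u_def)
  have U: "set (map u (cellseq j q)) = {1..?m}"
    unfolding w set_word_of[OF tr colpart_enum(2)[OF t]]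
    using Union_colpart[OF t] big_blocks_colpart[OF t] by simp
  then have u: "u \<in> tableaux (shape j q)"
    using di U unfolding tableaux_shape[OF jq] w by blast
  define p where "p x = (if x \<in> {1..?m} then u (inv_into ?C t x) else x)" for x
  have bt: "bij_betw t ?C {1..?m}" and bu: "bij_betw u ?C {1..?m}"
    using t u by (simp_all add: tableaux_def sum_list_shape)
  have p: "p permutes {1..?m}"
  proof (rule bij_imp_permutes)
    have "bij_betw (u \<circ> inv_into ?C t) {1..?m} {1..?m}"
      using bij_betw_trans[OF bij_betw_inv_into[OF bt] bu] .
    then show "bij_betw p {1..?m} {1..?m}"
      by (rule bij_betw_cong[THEN iffD1, rotated]) (simp add: p_def)
  qed (auto simp: p_def)
  have pt: "p (t x) = u x" if "x \<in> ?C" for x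
    using that bij_betw_inv_into_left[OF bt] bij_betwE[OF bt] by (auto simp: p_def)
  have pick_mem: "pick X (t ` colset j q c) \<in> t ` colset j q c" "pick Y (t ` colset j q c) \<in> t ` colset j q c"
    if "c < j" for c
    using tr that pick_in unfolding transv_def big_blocks_colpart[OF t] by (auto simp: colpart_def)
  have sub: "u ` colset j q c \<subseteq> t ` colset j q c" for c
  proof
    fix x assume "x \<in> u ` colset j q c"
    then obtain r where r: "(r, c) \<in> colset j q c" "x = u (r, c)" by (auto simp: colset_def)
    then have c: "c < j" by (simp add: colset_mem)
    consider "r = 0" | "r = 1" | "r \<ge> 2" by linarith
    then show "x \<in> t ` colset j q c"
    proof cases
      case 3
      with r have c0: "c = 0" "r < q + 2" by (auto simp: colset_mem split: if_splits)
      have "x \<in> {1..?m}" using r bij_betwE[OF bu] colset_sub by blast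
      then have "x \<in> t ` (\<Union>c<j. colset j q c)" unfolding Union_colset using tableau_image[OF t] by simp
      then obtain c' where c': "c' < j" "x \<in> t ` colset j q c'" by blast
      \<comment> \<open>A column other than the first has only two entries, and both are taken by
        the letters that the transversals pick there, so no letter of \<open>rs\<close> lies in
        it.\<close>
      have "c' = 0"
      proof (rule ccontr)
        assume "c' \<noteq> 0"
        then have "colset j q c' = {(0, c'), (1, c')}" using c' by (auto simp: colset_mem)
        then have two: "t ` colset j q c' = {t (0, c'), t (1, c')}" by simp
        have cell: "(0, c') \<in> ?C" "(1, c') \<in> ?C" "(r, c) \<in> ?C"
          using colset_cells[OF c'(1)] r(1) colset_sub by blast+
        have "u (0, c') \<noteq> u (1, c')" "u (0, c') \<noteq> x" "u (1, c') \<noteq> x"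
          using cell r(2) 3 c0 \<open>c' \<noteq> 0\<close> inj_on_eq_iff[OF tableau_inj[OF u]] by simp_all
        moreover have "u (0, c') \<in> t ` colset j q c'" "u (1, c') \<in> t ` colset j q c'"
          using pick_mem[OF c'(1)] by (simp_all add: u_def)
        ultimately show False using c'(2) unfolding two insert_iff empty_iff by metis
      qed
      then show ?thesis using c'(2) c0 by simp
    qed (use r pick_mem[OF c] in \<open>simp_all add: u_def\<close>)
  qed
  have "p ` t ` colset j q c = t ` colset j q c" for c
  proof (rule card_subset_eq)
    have "p ` t ` colset j q c = u ` colset j q c"
      unfolding image_image using pt colset_sub by (intro image_cong refl) blast
    then show "p ` t ` colset j q c \<subseteq> t ` colset j q c" using sub by simp
    show "finite (t ` colset j q c)" using finite_subset[OF colset_sub finite_cells] by simp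
    show "card (p ` t ` colset j q c) = card (t ` colset j q c)"
      using permutes_inj[OF p] by (simp add: card_image inj_on_subset)
  qed
  then have "p \<in> column_stabilizer (shape j q) t" using p column_stabilizer_iff by simp
  moreover have "row_triple j q (p \<circ> t) = (X, Y, rs)"
  proof -
    have "row_triple j q (p \<circ> t) = row_triple j q u"
    proof -
      have "map (p \<circ> t) (cellseq j q) = map u (cellseq j q)"
        using pt set_cellseq[OF jq] by simp
      then show ?thesis
        by (simp add: row_triple_def cellseq_def image_image atLeast0LessThan cong: image_cong_simp)
    qed
    also have "\<dots> = (X, Y, rs)"
    proof -
      have "pick Z ` big_blocks (colpart j q t) = (\<lambda>c. pick Z (t ` colset j q c)) ` {..<j}" for Z
        unfolding big_blocks_colpart[OF t] by (simp add: colpart_def image_image)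
      then show ?thesis using transv_pick_image[OF tr] rs
        by (simp add: row_triple_def image_image) (simp add: u_def)
    qed
    finally show ?thesis .
  qed
  ultimately show ?thesis using T tabloid_eq_iff[OF jq] by metis
qed

text \<open>Both sides live on the tabloids of \<open>p \<circ> t\<close> with p in the column
  stabilizer. There \<open>pvec\<close> is the sign of the reading word of
  \<open>p \<circ> t\<close>, which is \<open>sign p\<close> times that of t, and the latter squares
  to 1.\<close>

lemma polytabloid_eq:
  assumes t: "t \<in> tableaux (shape j q)"
  shows "polytabloid (shape j q) t = scl (wsign (map t (cellseq j q))) (tvec j q (colpart j q t))"
proof
  fix T
  let ?S = "column_stabilizer (shape j q) t" and ?tb = "tabloid (shape j q)"
  let ?w = "map t (cellseq j q)"
  have w: "distinct ?w" "set ?w = {1..2 * j + q}" using t tableaux_shape[OF jq] by auto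
  have "finite ?S"
    by (rule finite_subset[OF _ finite_permutations[of "{1..2 * j + q}"]]) (auto simp: column_stabilizer_iff)
  have sum_apply: "(\<Sum>p\<in>A. f p) T = (\<Sum>p\<in>A. f p T)" for A and f :: "(nat \<Rightarrow> nat) \<Rightarrow> nat set list \<Rightarrow> rat"
    by (induction A rule: infinite_finite_induct) auto
  have L: "polytabloid (shape j q) t T = (\<Sum>p\<in>?S. if T = ?tb (p \<circ> t) then of_int (sign p) else 0)"
    unfolding polytabloid_def sum_apply by (intro sum.cong refl) (simp add: scl_def basis_vec_def)
  show "polytabloid (shape j q) t T = scl (wsign ?w) (tvec j q (colpart j q t)) T"
  proof (cases "\<exists>p\<in>?S. T = ?tb (p \<circ> t)")
    case True
    then obtain p where p: "p \<in> ?S" "T = ?tb (p \<circ> t)" by blast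
    then have pp: "p permutes {1..2 * j + q}" by (simp add: column_stabilizer_iff)
    have word: "word_of (map (\<lambda>c. t ` colset j q c) [0..<j]) (row_triple j q (p' \<circ> t)) = map (p' \<circ> t) (cellseq j q)"
      "transv (colpart j q t) (row_triple j q (p' \<circ> t))" "p' \<circ> t \<in> tableaux (shape j q)"
      if "p' \<in> ?S" for p'
    proof -
      have "p' \<circ> t \<in> tableaux (shape j q)" "\<And>c. (p' \<circ> t) ` colset j q c \<subseteq> t ` colset j q c"
        using that tableau_comp[OF t] unfolding image_comp[symmetric] by (simp_all add: column_stabilizer_iff)
      then show "word_of (map (\<lambda>c. t ` colset j q c) [0..<j]) (row_triple j q (p' \<circ> t)) = map (p' \<circ> t) (cellseq j q)"
        "transv (colpart j q t) (row_triple j q (p' \<circ> t))" "p' \<circ> t \<in> tableaux (shape j q)"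
        using word_of_column[OF t] by blast+
    qed
    \<comment> \<open>Given the columns of t, the tabloid determines the reading word and hence p,
      so a single summand survives.\<close>
    have uniq: "p' = p" if "p' \<in> ?S" "T = ?tb (p' \<circ> t)" for p'
    proof
      fix x
      have "row_triple j q (p' \<circ> t) = row_triple j q (p \<circ> t)"
        using that p tabloid_eq_iff[OF jq] by metis
      then have "map p' ?w = map p ?w" using word(1)[OF that(1)] word(1)[OF p(1)] by (metis map_map)
      then have "\<forall>y\<in>{1..2 * j + q}. p' y = p y" using w(2) by (metis map_eq_conv)
      moreover have "p' permutes {1..2 * j + q}" using that by (simp add: column_stabilizer_iff)
      ultimately show "p' x = p x" using pp by (cases "x \<in> {1..2 * j + q}") (auto simp: permutes_not_in)
    qed
    have "polytabloid (shape j q) t T = (\<Sum>p'\<in>?S. if p' = p then of_int (sign p) else 0)"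
      unfolding L by (intro sum.cong refl) (use uniq p in auto)
    also have "\<dots> = of_int (sign p)" using p \<open>finite ?S\<close> by simp
    finally have lhs: "polytabloid (shape j q) t T = of_int (sign p)" .
    have "tvec j q (colpart j q t) T = pvec (colpart j q t) (row_triple j q (p \<circ> t))"
      using p word(3)[OF p(1)] by (simp add: tvec_def to_triple_tabloid[OF jq])
    also have "\<dots> = wsign (map p ?w)"
      unfolding pvec_eq[OF colpart_enum[OF t]] using word[OF p(1)] by simp
    also have "\<dots> = of_int (sign p) * wsign ?w"
      using wsign_map_perm[OF pp _ w] by simp
    finally show ?thesis using lhs wsign_square[OF w(1)] by (simp add: scl_def algebra_simps)
  next
    case False
    then have "polytabloid (shape j q) t T = 0" unfolding L by (intro sum.neutral) auto
    moreover have "tvec j q (colpart j q t) T = 0"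
    proof (rule ccontr)
      assume nz: "tvec j q (colpart j q t) T \<noteq> 0"
      then obtain t' where t': "t' \<in> tableaux (shape j q)" "T = ?tb t'" by (auto simp: tvec_def split: if_splits)
      then have "pvec (colpart j q t) (row_triple j q t') \<noteq> 0"
        using nz by (simp add: tvec_def to_triple_tabloid[OF jq])
      then show False using ex_column_perm[OF t t'(1)] False t'(2) by metis
    qed
    ultimately show ?thesis by (simp add: scl_def)
  qed
qed

lemma tvec_colpart_in_specht:
  assumes "t \<in> tableaux (shape j q)"
  shows "tvec j q (colpart j q t) \<in> space (specht (shape j q))"
proof -
  have "distinct (map t (cellseq j q))" using assms tableaux_shape[OF jq] by simp
  then have "scl (wsign (map t (cellseq j q))) (polytabloid (shape j q) t) = tvec j q (colpart j q t)"
    using wsign_square unfolding polytabloid_eq[OF assms] by (simp add: scl_def flip: mult.assoc)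
  then show ?thesis using assms fn.span_scale[OF fn.span_base]
    by (metis specht_def rep.select_convs(1) image_eqI)
qed

end

text \<open>Counting elements gives \<open>B0\<close> the size q + 2, so it can serve as the first
  column and the remaining blocks as the columns of length two.\<close>

lemma ex_tableau_colpart:
  assumes jq: "j = 0 \<longrightarrow> q = 0" and P: "partition_on {1..2 * j + q} P" "card P = j"
    and B0: "j > 0 \<Longrightarrow> B0 \<in> P" "\<And>B. B \<in> P \<Longrightarrow> B \<noteq> B0 \<Longrightarrow> card B = 2"
  shows "\<exists>t\<in>tableaux (shape j q). colpart j q t = P"
proof (cases "j = 0")
  case True
  then have "finite P" using P(1) jq finite_elements[of "{1..2 * j + q}" P] by simp
  then have "P = {}" using P(2) True by simp
  moreover have "id \<circ> fst \<in> tableaux (shape j q)"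
    using True jq by (simp add: tableaux_def shape_0 cells_def bij_betw_def)
  moreover have "colpart j q t = {}" for t using True by (simp add: colpart_def)
  ultimately show ?thesis by blast
next
  case False
  then have B0P: "B0 \<in> P" using B0(1) by simp
  have finP: "finite P" using P(1) finite_elements[of "{1..2 * j + q}" P] by simp
  have finB: "finite B" if "B \<in> P" for B
    using that P(1) finite_subset[of B "{1..2 * j + q}"] by (auto simp: partition_on_def)
  obtain bs' where bs': "distinct bs'" "set bs' = P - {B0}"
    using finite_distinct_list[of "P - {B0}"] finP by auto
  define bs where "bs = B0 # bs'"
  have bs: "distinct bs" "set bs = P" using bs' B0P by (auto simp: bs_def)
  then have len: "length bs = j" using distinct_card[of bs] P(2) by simp
  have "2 * j + q = (\<Sum>B\<in>P. card B)"
    using product_partition[OF P(1) finB] by simp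
  also have "\<dots> = card B0 + (\<Sum>B\<in>P - {B0}. card B)"
    using sum.remove[OF finP B0P] .
  also have "(\<Sum>B\<in>P - {B0}. card B) = 2 * (j - 1)"
    using B0(2) P(2) B0P finP by simp
  finally have "card B0 = q + 2" using False by simp
  then have cards: "card (bs ! c) = (if c = 0 then q + 2 else 2)" if "c < j" for c
  proof (cases c)
    case (Suc c')
    then have "bs ! c \<in> P - {B0}" using that len bs' nth_mem[of c' bs'] by (simp add: bs_def)
    then show ?thesis using B0(2) Suc by simp
  qed (simp add: bs_def)
  define els where "els c = sorted_list_of_set (bs ! c)" for c
  have mem: "bs ! c \<in> P" if "c < j" for c using that len bs nth_mem by metis
  have els: "set (els c) = bs ! c" "distinct (els c)" "length (els c) = (if c = 0 then q + 2 else 2)"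
    if "c < j" for c
    using finB[OF mem[OF that]] cards[OF that] by (simp_all add: els_def)
  define t where "t = (\<lambda>(r, c). els c ! r)"
  have img: "t ` colset j q c = bs ! c" if "c < j" for c
  proof -
    have "t ` colset j q c = (\<lambda>r. els c ! r) ` {..<length (els c)}"
      using that unfolding els(3)[OF that] by (force simp: colset_mem[OF jq] t_def image_iff)
    then show ?thesis using els(1)[OF that] by (auto simp: set_conv_nth)
  qed
  have "inj_on t (cells (shape j q))"
  proof (rule inj_onI)
    fix u v assume u: "u \<in> cells (shape j q)" and v: "v \<in> cells (shape j q)" and eq: "t u = t v"
    obtain r c r' c' where uv: "u = (r, c)" "v = (r', c')" by (cases u, cases v)
    have c: "c < j" "c' < j" and r: "r < length (els c)" "r' < length (els c')"
      using u v els(3) unfolding uv cells_shape[OF jq] by auto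
    have "t u \<in> set (els c)" "t v \<in> set (els c')" using r by (simp_all add: uv t_def)
    then have "t u \<in> bs ! c" "t u \<in> bs ! c'" using els(1) c eq by simp_all
    moreover have "bs ! c \<in> P" "bs ! c' \<in> P" using mem c by simp_all
    ultimately have "bs ! c = bs ! c'"
      using disjointD[OF partition_onD2[OF P(1)], of "bs ! c" "bs ! c'"] by blast
    then have "c = c'" using bs(1) len c nth_eq_iff_index_eq by blast
    then show "u = v" using eq r els(2)[OF c(1)] by (simp add: uv t_def nth_eq_iff_index_eq)
  qed
  moreover have "t ` cells (shape j q) = {1..2 * j + q}"
  proof -
    have "t ` cells (shape j q) = (\<Union>c<j. bs ! c)"
      unfolding Union_colset[OF jq, symmetric] image_UN using img by simp
    also have "\<dots> = \<Union>(set bs)" using len by (auto simp: set_conv_nth)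
    also have "\<dots> = {1..2 * j + q}" using bs P(1) by (simp add: partition_on_def)
    finally show ?thesis .
  qed
  ultimately have "t \<in> tableaux (shape j q)" by (simp add: tableaux_def bij_betw_def sum_list_shape)
  moreover have "colpart j q t = P"
  proof -
    have "colpart j q t = (\<lambda>c. bs ! c) ` {..<j}" using img by (simp add: colpart_def)
    also have "\<dots> = set bs" using len by (auto simp: set_conv_nth)
    finally show ?thesis using bs by simp
  qed
  ultimately show ?thesis by blast
qed

lemma space_specht: "space (specht lam) = fn.span (polytabloid lam ` tableaux lam)"
  by (simp add: specht_def)

text \<open>Straightening by induction on the number of blocks with at least three elements. While
  there are two of them, \<open>pvec_split_pairs\<close> replaces them by a pair and one other
  block; with at most one left, the blocks are the columns of a tableau.\<close>

lemma tvec_in_specht: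
  assumes jq: "j = 0 \<longrightarrow> q = 0" and P: "partition_on {1..2 * j + q} P" "card P = j"
    "\<And>B. B \<in> P \<Longrightarrow> card B \<ge> 2"
  shows "tvec j q P \<in> space (specht (shape j q))"
  using P
proof (induction "card {B \<in> P. card B \<ge> 3}" arbitrary: P rule: less_induct)
  case less
  let ?S = "{1..2 * j + q}"
  have finP: "finite P" using less.prems(1) finite_elements[of ?S P] by simp
  show ?case
  proof (cases "\<exists>C D. C \<in> P \<and> D \<in> P \<and> C \<noteq> D \<and> card C \<ge> 3 \<and> card D \<ge> 3")
    case False
    obtain B0 where B0: "j > 0 \<Longrightarrow> B0 \<in> P" "\<And>B. B \<in> P \<Longrightarrow> B \<noteq> B0 \<Longrightarrow> card B = 2"
    proof (cases "\<exists>B\<in>P. card B \<ge> 3")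
      case True
      then obtain B0 where "B0 \<in> P" "card B0 \<ge> 3" by blast
      moreover have "card B = 2" if "B \<in> P" "B \<noteq> B0" for B
      proof -
        have "\<not> card B \<ge> 3" using False \<open>B0 \<in> P\<close> \<open>card B0 \<ge> 3\<close> that by blast
        then show ?thesis using less.prems(3)[OF that(1)] by linarith
      qed
      ultimately show ?thesis using that by blast
    next
      case no: False
      have "card B = 2" if "B \<in> P" for B
        using no less.prems(3)[OF that] that by fastforce
      moreover have "j > 0 \<Longrightarrow> P \<noteq> {}" using less.prems(2) by auto
      ultimately show ?thesis using that by blast
    qed
    then obtain t where "t \<in> tableaux (shape j q)" "colpart j q t = P"
      using ex_tableau_colpart[OF jq less.prems(1,2), of B0] by blast
    then show ?thesis using tvec_colpart_in_specht[OF jq] by blast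
  next
    case True
    then obtain C D where CD: "C \<in> P" "D \<in> P" "C \<noteq> D" "card C \<ge> 3" "card D \<ge> 3" by blast
    define R where "R = P - {C, D}"
    note sp = partition_on_two_blocks[OF less.prems(1) CD(1-3), folded R_def]
    have finR: "finite R" using finP by (simp add: R_def)
    have fin: "finite C" "finite D" using CD(4,5) by (auto intro: card_ge_0_finite)
    let ?Q = "\<lambda>a b. R \<union> {{a, b}, (C \<union> D) - {a, b}}"
    have IH: "tvec j q (?Q a b) \<in> space (specht (shape j q))" if ab: "a \<in> C" "b \<in> C - {a}" for a b
    proof (rule less.hyps)
      let ?E = "(C \<union> D) - {a, b}"
      have un: "{a, b} \<union> ?E = C \<union> D" "{a, b} \<inter> ?E = {}" using ab by auto
      have cE: "card ?E \<ge> 2"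
      proof -
        have "card D \<le> card ?E" using ab sp(2) fin by (intro card_mono) auto
        then show ?thesis using CD(5) by simp
      qed
      have cab: "card {a, b} = 2" using ab by simp
      have ne: "?E \<noteq> {}" using cE by (metis card.empty not_numeral_le_zero)
      show part: "partition_on ?S (?Q a b)"
        using sp un ne by (intro partition_on_two) auto
      have notR: "{a, b} \<notin> R" "?E \<notin> R" "{a, b} \<noteq> ?E"
        using sp(5) ab ne un(2) by auto
      have "C \<notin> R" "D \<notin> R" by (auto simp: R_def)
      then have "card P = card R + 2" using finR CD(3) by (subst sp(4)) simp
      then show "card (?Q a b) = j" using less.prems(2) notR finR by simp
      show "card B \<ge> 2" if "B \<in> ?Q a b" for B
        using that cE cab less.prems(3) by (auto simp: R_def)
      \<comment> \<open>Of the two new blocks only the complement of {a, b} can have three elements,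
        while both C and D were counted before.\<close>
      have "{B \<in> ?Q a b. card B \<ge> 3} \<subseteq> insert ?E {B \<in> R. card B \<ge> 3}" using cab by auto
      then have "card {B \<in> ?Q a b. card B \<ge> 3} \<le> card (insert ?E {B \<in> R. card B \<ge> 3})"
        using finR by (intro card_mono) auto
      also have "\<dots> \<le> card {B \<in> R. card B \<ge> 3} + 1" by (simp add: card_insert_if finR)
      also have "\<dots> < card {B \<in> P. card B \<ge> 3}"
      proof -
        have "{B \<in> P. card B \<ge> 3} = {B \<in> R. card B \<ge> 3} \<union> {C, D}" using CD by (auto simp: R_def)
        then show ?thesis using finR CD(3) \<open>C \<notin> R\<close> \<open>D \<notin> R\<close> by simp
      qed
      finally show "card {B \<in> ?Q a b. card B \<ge> 3} < card {B \<in> P. card B \<ge> 3}" .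
    qed
    have "2 * pvec P T = (\<Sum>a\<in>C. \<Sum>b\<in>C - {a}. pvec (?Q a b) T)" for T
      using pvec_split_pairs[OF finR sp(5,2), of T] CD sp(4) by simp
    then have half: "pvec P T = (1 / 2) * (\<Sum>a\<in>C. \<Sum>b\<in>C - {a}. pvec (?Q a b) T)" for T
      by (metis (no_types, lifting) mult.assoc mult_1 divide_self_if times_divide_eq_left zero_neq_numeral)
    have sum_apply: "(\<Sum>x\<in>A. f x) T = (\<Sum>x\<in>A. f x T)" for A and f :: "nat \<Rightarrow> nat set list \<Rightarrow> rat" and T
      by (induction A rule: infinite_finite_induct) auto
    have "tvec j q P = scl (1 / 2) (\<Sum>a\<in>C. \<Sum>b\<in>C - {a}. tvec j q (?Q a b))"
    proof
      fix T
      show "tvec j q P T = scl (1 / 2) (\<Sum>a\<in>C. \<Sum>b\<in>C - {a}. tvec j q (?Q a b)) T"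
        using half[of "to_triple T"] unfolding scl_def sum_apply by (simp add: tvec_def)
    qed
    then show ?thesis
      using IH unfolding space_specht by (auto intro!: fn.span_scale fn.span_sum)
  qed
qed

section \<open>Young subgroups and standard tableaux\<close>

text \<open>The signs of \<open>pvec_adj\<close> multiply along a word for w. Each depends on the
  partition alone, hence c does not depend on T.\<close>

lemma pvec_perm_sign:
  assumes w: "w permutes {1..n}" and P: "finite P"
  obtains c where "c \<noteq> 0" "\<And>T. pvec (perm_partition w P) (tact w T) = c * pvec P T"
proof -
  obtain js where js: "w = apply_adj_transps js" using ex_adj_word[OF w] by blast
  have "\<exists>c. c \<noteq> 0 \<and> (\<forall>T. pvec (perm_partition (apply_adj_transps js) P) (tact (apply_adj_transps js) T) = c * pvec P T)"
  proof (induction js)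
    case Nil
    show ?case unfolding apply_adj_transps_Nil perm_partition_id tact_id by (rule exI[of _ 1]) simp
  next
    case (Cons i js)
    let ?w = "apply_adj_transps js"
    obtain c where c: "c \<noteq> 0" "\<forall>T. pvec (perm_partition ?w P) (tact ?w T) = c * pvec P T"
      using Cons by blast
    let ?Q = "perm_partition ?w P"
    have fin: "finite (big_blocks ?Q)" using P by (simp add: big_blocks_def perm_partition_def)
    define e :: rat where "e = (if i \<in> \<Union>(big_blocks ?Q) \<and> i + 1 \<in> \<Union>(big_blocks ?Q) then - 1 else 1)"
    have "pvec (perm_partition (adj i \<circ> ?w) P) (tact (adj i \<circ> ?w) T) = e * c * pvec P T" for T
      unfolding perm_partition_comp[symmetric] tact_comp[symmetric] pvec_adj[OF fin] e_def[symmetric]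
      using c(2) by (simp only: mult.assoc)
    moreover have "e * c \<noteq> 0" using c(1) by (simp add: e_def)
    ultimately show ?case unfolding apply_adj_transps_Cons by blast
  qed
  then show ?thesis using that js by blast
qed

lemma ex_perm_map:
  assumes "distinct xs" "distinct ys" "length xs = length ys" "set xs \<subseteq> S" "set ys \<subseteq> S" "finite S"
  shows "\<exists>g. g permutes S \<and> map g xs = ys"
proof -
  define f where "f x = the (map_of (zip xs ys) x)" for x
  have f: "f (xs ! i) = ys ! i" if "i < length xs" for i
    using that assms by (simp add: f_def map_of_zip_nth)
  then have fm: "map f xs = ys" using assms(3) by (simp add: list_eq_iff_nth_eq)
  then have "inj_on f (set xs)" "f ` set xs = set ys"
    using assms(2) by (metis distinct_map, metis set_map)
  then have bf: "bij_betw f (set xs) (set ys)" by (simp add: bij_betw_def)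
  have "card (S - set xs) = card (S - set ys)"
    using assms by (simp add: card_Diff_subset distinct_card)
  then obtain h where bh: "bij_betw h (S - set xs) (S - set ys)"
    using assms(6) finite_same_card_bij by blast
  define g where "g x = (if x \<in> set xs then f x else if x \<in> S then h x else x)" for x
  have "bij_betw g (set xs) (set ys)" using bf by (rule bij_betw_cong[THEN iffD1, rotated]) (simp add: g_def)
  moreover have "bij_betw g (S - set xs) (S - set ys)"
    using bh by (rule bij_betw_cong[THEN iffD1, rotated]) (simp add: g_def)
  ultimately have "bij_betw g (set xs \<union> (S - set xs)) (set ys \<union> (S - set ys))"
    by (rule bij_betw_combine) blast
  then have "bij_betw g S S" using assms(4,5) by (simp add: Un_absorb1)
  then have "g permutes S" using assms(4) by (intro bij_imp_permutes) (auto simp: g_def)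
  moreover have "map g xs = ys" using fm by (auto simp: g_def)
  ultimately show ?thesis by blast
qed

section \<open>Elements of the Young subgroup\<close>

lemma young_embedding_apply: "x \<le> m \<Longrightarrow> young_embedding m (u, v) x = u x"
  by (simp add: young_embedding_def)

lemma permutes_le: "u permutes {1..m} \<Longrightarrow> x \<le> m \<Longrightarrow> u x \<le> (m :: nat)"
proof (cases "x = 0")
  case False
  assume "u permutes {1..m}" "x \<le> m"
  then have "u x \<in> {1..m}" using False by (subst permutes_in_image) auto
  then show ?thesis by simp
qed (simp add: permutes_not_in)

lemma permutes_pos: "u permutes {1..m} \<Longrightarrow> x > 0 \<Longrightarrow> u x > (0 :: nat)"
proof (cases "x \<le> m")
  case True
  assume "u permutes {1..m}" "x > 0"
  then have "u x \<in> {1..m}" using True by (subst permutes_in_image) auto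
  then show ?thesis by simp
qed (simp add: permutes_not_in)

lemma young_embedding_comp:
  assumes "u' permutes {1..m}" "v' permutes {1..s}"
  shows "young_embedding m (u, v) \<circ> young_embedding m (u', v') = young_embedding m (u \<circ> u', v \<circ> v')"
proof
  fix x
  show "(young_embedding m (u, v) \<circ> young_embedding m (u', v')) x = young_embedding m (u \<circ> u', v \<circ> v') x"
  proof (cases "x \<le> m")
    case True
    then show ?thesis using permutes_le[OF assms(1) True] by (simp add: young_embedding_def)
  next
    case False
    then have "v' (x - m) > 0" using permutes_pos[OF assms(2)] by simp
    then show ?thesis using False by (simp add: young_embedding_def)
  qed
qed

lemma young_embedding_permutes:
  assumes u: "u permutes {1..m}" and v: "v permutes {1..s}"
  shows "young_embedding m (u, v) permutes {1..m + s}"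
proof -
  have id: "young_embedding m (id, id) = id" by (auto simp: young_embedding_def)
  have "young_embedding m (u, v) \<circ> young_embedding m (inv' u, inv' v) = id"
    "young_embedding m (inv' u, inv' v) \<circ> young_embedding m (u, v) = id"
    using young_embedding_comp[OF permutes_inv[OF u] permutes_inv[OF v], of u v]
      young_embedding_comp[OF u v, of "inv' u" "inv' v"] u v
    by (simp_all add: permutes_inv_o id)
  then have "bij (young_embedding m (u, v))" by (intro o_bij)
  moreover have "young_embedding m (u, v) x = x" if "x \<notin> {1..m + s}" for x
  proof (cases "x = 0")
    case True
    then show ?thesis using u by (simp add: young_embedding_def permutes_not_in)
  next
    case False
    then have "x > m + s" using that by simp
    then have "x - m \<notin> {1..s}" by auto
    from permutes_not_in[OF v this] show ?thesis using \<open>x > m + s\<close> by (simp add: young_embedding_def)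
  qed
  ultimately show ?thesis
    unfolding permutes_def by (metis bij_pointE)
qed

lemma young_embedding_split:
  assumes w: "w permutes {1..m + s}" and Z: "w ` {m + 1..m + s} = {m + 1..m + s}"
  obtains u v where "u permutes {1..m}" "v permutes {1..s}" "w = young_embedding m (u, v)"
proof -
  have inj: "inj w" using permutes_inj[OF w] .
  have S: "{1..m + s} - {m + 1..m + s} = {1..m}" by auto
  have "w ` ({1..m + s} - {m + 1..m + s}) = {1..m + s} - {m + 1..m + s}"
    using image_set_diff[OF inj] permutes_image[OF w] Z by metis
  then have L: "w ` {1..m} = {1..m}" unfolding S .
  have w0: "w 0 = 0" using w by (simp add: permutes_not_in)
  have wbig: "w x = x" if "x > m + s" for x using that w by (simp add: permutes_not_in)
  define u where "u x = (if x \<le> m then w x else x)" for x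
  \<comment> \<open>The argument 0 lies outside {1..s}, but \<open>m + 0\<close> belongs to the
    first part, so its value is set separately.\<close>
  define v where "v x = (if x = 0 then 0 else w (m + x) - m)" for x
  have "bij_betw u {1..m} {1..m}"
  proof (rule bij_betw_cong[THEN iffD1])
    show "bij_betw w {1..m} {1..m}" using L inj_on_subset[OF inj subset_UNIV] by (simp add: bij_betw_def)
  qed (simp add: u_def)
  then have pu: "u permutes {1..m}"
    by (rule bij_imp_permutes) (auto simp: u_def w0 Suc_le_eq)
  have "bij_betw (\<lambda>x. x - m) {m + 1..m + s} {1..s}"
    by (rule bij_betw_byWitness[where f' = "\<lambda>x. m + x"]) auto
  moreover have "bij_betw w {m + 1..m + s} {m + 1..m + s}"
    using Z inj_on_subset[OF inj subset_UNIV] by (simp add: bij_betw_def)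
  moreover have "bij_betw (\<lambda>x. m + x) {1..s} {m + 1..m + s}"
    by (rule bij_betw_byWitness[where f' = "\<lambda>x. x - m"]) auto
  ultimately have "bij_betw ((\<lambda>x. x - m) \<circ> (w \<circ> (\<lambda>x. m + x))) {1..s} {1..s}"
    by (meson bij_betw_trans)
  then have "bij_betw v {1..s} {1..s}"
    by (rule bij_betw_cong[THEN iffD1, rotated]) (simp add: v_def)
  then have pv: "v permutes {1..s}"
    by (rule bij_imp_permutes) (auto simp: v_def wbig Suc_le_eq)
  have "w x = young_embedding m (u, v) x" for x
  proof (cases "x \<le> m")
    case True
    then show ?thesis by (simp add: young_embedding_def u_def)
  next
    case False
    have "w x > m"
    proof (cases "x \<le> m + s")
      case True
      then have "w x \<in> {m + 1..m + s}" using Z False by (metis Suc_eq_plus1 atLeastAtMost_iff image_eqI not_less_eq_eq)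
      then show ?thesis by simp
    qed (use wbig in simp)
    then show ?thesis using False by (simp add: young_embedding_def v_def)
  qed
  then show ?thesis using that pu pv by blast
qed

section \<open>Tabloids under permutations and the standard filling\<close>

context
  fixes j q s :: nat
  assumes jq: "j = 0 \<longrightarrow> q = 0"
begin

lemma tabloid_act:
  assumes u: "u permutes {1..2 * j + q}" and T: "T \<in> tabloid (shape j q) ` tableaux (shape j q)"
  shows "map ((`) u) T \<in> tabloid (shape j q) ` tableaux (shape j q)" "to_triple (map ((`) u) T) = tact u (to_triple T)"
proof -
  obtain t where t: "t \<in> tableaux (shape j q)" "T = tabloid (shape j q) t" using T by blast
  have ut: "u \<circ> t \<in> tableaux (shape j q)" using tableau_comp[OF jq t(1) u] .
  have eq: "map ((`) u) T = tabloid (shape j q) (u \<circ> t)" unfolding t(2) tabloid_def by (simp add: image_comp)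
  then show "map ((`) u) T \<in> tabloid (shape j q) ` tableaux (shape j q)" using ut by blast
  show "to_triple (map ((`) u) T) = tact u (to_triple T)"
    unfolding eq unfolding t(2) to_triple_tabloid[OF jq] by (simp add: row_triple_def tact_def image_comp)
qed

lemma tabloid_act_iff:
  assumes "u permutes {1..2 * j + q}"
  shows "map ((`) u) T \<in> tabloid (shape j q) ` tableaux (shape j q) \<longleftrightarrow> T \<in> tabloid (shape j q) ` tableaux (shape j q)"
proof
  assume "map ((`) u) T \<in> tabloid (shape j q) ` tableaux (shape j q)"
  from tabloid_act(1)[OF permutes_inv[OF assms] this]
  have "map ((`) (inv' u)) (map ((`) u) T) \<in> tabloid (shape j q) ` tableaux (shape j q)" .
  moreover have "(`) (inv' u) \<circ> (`) u = id"
    using permutes_inv_o(2)[OF assms] by (simp add: fun_eq_iff image_comp)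
  then have "map ((`) (inv' u)) (map ((`) u) T) = T" by simp
  ultimately show "T \<in> tabloid (shape j q) ` tableaux (shape j q)" by simp
qed (rule tabloid_act(1)[OF assms])

lemma row_triple_union:
  assumes "t \<in> tableaux (shape j q)" "row_triple j q t = (X, Y, rs)"
  shows "X \<union> Y \<union> set rs = {1..2 * j + q}"
proof -
  have "X \<union> Y \<union> set rs = set (map t (cellseq j q))"
    using assms(2) by (auto simp: row_triple_def cellseq_def image_image atLeast0LessThan)
  then show ?thesis using assms(1) tableaux_shape[OF jq] by simp
qed

text \<open>Filled column by column: 1, ..., q + 2 go to the first column and q + 2c + 1, q + 2c + 2
  to column c > 0. This makes every column an interval, hence the column partition
  noncrossing.\<close>

definition std_tab :: "nat \<times> nat \<Rightarrow> nat"
  where "std_tab = (\<lambda>(r, c). if c = 0 then r + 1 else q + 2 * c + r + 1)"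

lemma std_tab: "std_tab \<in> tableaux (shape j q)"
proof -
  have inj: "inj_on std_tab (cells (shape j q))"
  proof (rule inj_onI)
    fix x y assume xy: "x \<in> cells (shape j q)" "y \<in> cells (shape j q)" "std_tab x = std_tab y"
    obtain r c r' c' where *: "x = (r, c)" "y = (r', c')" by (cases x, cases y)
    have r: "r < (if c = 0 then q + 2 else 2)" "r' < (if c' = 0 then q + 2 else 2)"
      using xy(1,2) unfolding * cells_shape[OF jq] by auto
    have e: "(if c = 0 then r + 1 else q + 2 * c + r + 1) = (if c' = 0 then r' + 1 else q + 2 * c' + r' + 1)"
      using xy(3) unfolding * std_tab_def by simp
    have "c = c' \<and> r = r'"
    proof (cases "c = 0 \<or> c' = 0")
      case True
      then show ?thesis using r e by (cases "c = 0"; cases "c' = 0") auto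
    next
      case False
      then have "2 * c + r = 2 * c' + r'" "r < 2" "r' < 2" using r e by auto
      moreover from this have "c = (2 * c + r) div 2" "c' = (2 * c' + r') div 2" by auto
      ultimately have "c = c'" by metis
      then show ?thesis using \<open>2 * c + r = 2 * c' + r'\<close> by simp
    qed
    then show "x = y" using * by simp
  qed
  have sub: "std_tab ` cells (shape j q) \<subseteq> {1..2 * j + q}"
  proof
    fix x assume "x \<in> std_tab ` cells (shape j q)"
    then obtain r c where "c < j" "r < (if c = 0 then q + 2 else 2)" "x = std_tab (r, c)"
      unfolding cells_shape[OF jq] by auto
    then show "x \<in> {1..2 * j + q}" by (auto simp: std_tab_def split: if_splits)
  qed
  have "card (cells (shape j q)) = 2 * j + q"
    unfolding set_cellseq[OF jq, symmetric] distinct_card[OF distinct_cellseq] by (simp add: cellseq_def)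
  then have "card (std_tab ` cells (shape j q)) = card {1..2 * j + q}" using card_image[OF inj] by simp
  then have "std_tab ` cells (shape j q) = {1..2 * j + q}" using sub by (intro card_subset_eq) auto
  then show ?thesis using inj by (simp add: tableaux_def bij_betw_def sum_list_shape)
qed

text \<open>The added singletons leave \<open>pvec\<close> unchanged, since it sees only the
  non-singleton blocks.\<close>

definition full_part :: "(nat \<times> nat \<Rightarrow> nat) \<Rightarrow> nat set set"
  where "full_part t = colpart j q t \<union> (\<lambda>x. {x}) ` {2 * j + q + 1..2 * j + q + s}"

lemma full_part:
  assumes t: "t \<in> tableaux (shape j q)"
  shows "partition_on {1..2 * j + q + s} (full_part t)" "block_type (full_part t) = (j + s, s)"
    "big_blocks (full_part t) = colpart j q t"
proof -
  let ?I = "(\<lambda>x. {x}) ` {2 * j + q + 1..2 * j + q + s}"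
  have big: "big_blocks (colpart j q t) = colpart j q t" by (rule big_blocks_colpart[OF jq t])
  then have c1: "card B \<noteq> 1" if "B \<in> colpart j q t" for B using that by (auto simp: big_blocks_def)
  show "big_blocks (full_part t) = colpart j q t"
    using c1 by (auto simp: full_part_def big_blocks_def)
  have U: "\<Union>(colpart j q t) = {1..2 * j + q}" by (rule Union_colpart[OF jq t])
  have part: "B = C" if B: "B \<in> full_part t" and C: "C \<in> full_part t" and x: "x \<in> B" "x \<in> C" for B C x
  proof (cases "x \<le> 2 * j + q")
    case True
    then have "B \<in> colpart j q t" "C \<in> colpart j q t" using B C x by (auto simp: full_part_def)
    then obtain c c' where "B = t ` colset j q c" "C = t ` colset j q c'" by (auto simp: colpart_def)
    then show ?thesis using colset_image_disjoint[OF jq t] x by metis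
  next
    case False
    then have "B \<notin> colpart j q t" "C \<notin> colpart j q t" using x U by auto
    then show ?thesis using B C x by (auto simp: full_part_def)
  qed
  show "partition_on {1..2 * j + q + s} (full_part t)"
  proof (rule partition_onI)
    show "\<Union>(full_part t) = {1..2 * j + q + s}" using U by (auto simp: full_part_def)
    show "disjnt B C" if "B \<in> full_part t" "C \<in> full_part t" "B \<noteq> C" for B C
      using part that by (auto simp: disjnt_def)
    have "{} \<notin> colpart j q t" using colset_cells(1)[OF jq] by (auto simp: colpart_def)
    then show "{} \<notin> full_part t" by (auto simp: full_part_def)
  qed
  have cj: "card (colpart j q t) = j"
    using distinct_card[OF colpart_enum(1)[OF jq t]] colpart_enum(2)[OF jq t] big by simp
  have fin: "finite (colpart j q t)" by (simp add: colpart_def)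
  have cI: "card ?I = s" by (subst card_image) auto
  have "{x} \<notin> colpart j q t" for x using c1[of "{x}"] by auto
  then have dis: "colpart j q t \<inter> ?I = {}" by blast
  have "card (full_part t) = j + s"
    unfolding full_part_def using fin dis cj cI by (subst card_Un_disjoint) auto
  moreover have "{B \<in> full_part t. card B = 1} = ?I" using c1 by (auto simp: full_part_def)
  ultimately show "block_type (full_part t) = (j + s, s)" using cI by (simp add: block_type_def)
qed

lemma full_part_perm:
  assumes t: "t \<in> tableaux (shape j q)"
  obtains w where "w permutes {1..2 * j + q + s}" "perm_partition w (full_part std_tab) = full_part t"
proof -
  have "set (map std_tab (cellseq j q)) = {1..2 * j + q}" "set (map t (cellseq j q)) = {1..2 * j + q}"
    "distinct (map std_tab (cellseq j q))" "distinct (map t (cellseq j q))"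
    using std_tab t tableaux_shape[OF jq] by blast+
  then obtain w where w: "w permutes {1..2 * j + q}" "map w (map std_tab (cellseq j q)) = map t (cellseq j q)"
    using ex_perm_map[of "map std_tab (cellseq j q)" "map t (cellseq j q)" "{1..2 * j + q}"] by auto
  have "\<forall>x\<in>set (cellseq j q). w (std_tab x) = t x" using w(2) by simp
  then have wt: "w (std_tab x) = t x" if "x \<in> cells (shape j q)" for x
    using that set_cellseq[OF jq] by blast
  have "w ` std_tab ` colset j q c = t ` colset j q c" for c
    unfolding image_image using wt colset_sub[OF jq] by (intro image_cong refl) blast
  then have "(\<lambda>B. w ` B) ` colpart j q std_tab = colpart j q t" by (simp add: colpart_def image_image)
  moreover have "(\<lambda>B. w ` B) ` (\<lambda>x. {x}) ` {2 * j + q + 1..2 * j + q + s} = (\<lambda>x. {x}) ` {2 * j + q + 1..2 * j + q + s}"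
  proof -
    have "w x = x" if "x \<in> {2 * j + q + 1..2 * j + q + s}" for x using that permutes_not_in[OF w(1), of x] by simp
    then show ?thesis unfolding image_image by (intro image_cong refl) auto
  qed
  ultimately have "perm_partition w (full_part std_tab) = full_part t"
    by (simp add: perm_partition_def full_part_def image_Un)
  moreover have "w permutes {1..2 * j + q + s}" using w(1) by (rule permutes_subset) auto
  ultimately show ?thesis using that by blast
qed

text \<open>Every block is an interval, so a point between two elements of a block belongs to it as
  well.\<close>

lemma noncrossing_std: "noncrossing (full_part std_tab)"
proof -
  have conv: "b \<in> A" if A: "A \<in> full_part std_tab" "a \<in> A" "c \<in> A" "a < b" "b < c" for A a b c
  proof -
    have "A \<in> colpart j q std_tab" using A by (auto simp: full_part_def)
    then obtain d where d: "d < j" "A = std_tab ` colset j q d" by (auto simp: colpart_def)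
    have "A = (if d = 0 then {1..q + 2} else {q + 2 * d + 1..q + 2 * d + 2})"
    proof -
      have "x \<in> A \<longleftrightarrow> x \<in> (if d = 0 then {1..q + 2} else {q + 2 * d + 1..q + 2 * d + 2})" for x
      proof -
        have "x \<in> A \<longleftrightarrow> (\<exists>r. r < (if d = 0 then q + 2 else 2) \<and> x = (if d = 0 then r + 1 else q + 2 * d + r + 1))"
        proof -
          have "colset j q d = (\<lambda>r. (r, d)) ` {r. r < (if d = 0 then q + 2 else 2)}"
            using d(1) by (auto simp: colset_mem[OF jq])
          then show ?thesis unfolding d(2) by (simp add: image_image std_tab_def image_iff)
        qed
        also have "\<dots> \<longleftrightarrow> x \<in> (if d = 0 then {1..q + 2} else {q + 2 * d + 1..q + 2 * d + 2})"
        proof (cases "d = 0")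
          case True
          then show ?thesis by (simp, presburger)
        next
          case False
          then show ?thesis by (simp, presburger)
        qed
        finally show ?thesis .
      qed
      then show ?thesis by blast
    qed
    then show ?thesis using A by (auto split: if_splits)
  qed
  have dj: "A = B" if "A \<in> full_part std_tab" "B \<in> full_part std_tab" "x \<in> A" "x \<in> B" for A B x
    using full_part(1)[OF std_tab] that unfolding partition_on_def disjoint_def by blast
  show ?thesis unfolding noncrossing_def using conv dj by (metis insert_subset)
qed

lemma full_part_std_in: "full_part std_tab \<in> NC_typed (2 * j + q + s) (\<lambda>t. fst t = j + s \<and> snd t = s)"
  using full_part[OF std_tab] noncrossing_std by (simp add: NC_typed_def NC_def)

end

section \<open>The induced module\<close>

text \<open>Every function on the unit type is a multiple of the constant 1, so tensoring with the
  trivial module only adds a dummy coordinate.\<close>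

lemma space_outer_tensor_triv:
  fixes M :: "('g, 'b) rep"
  assumes M: "fn.subspace (space M)"
  shows "f \<in> space (outer_tensor M (triv_rep :: ('h, unit) rep)) \<longleftrightarrow> (\<lambda>a. f (a, ())) \<in> space M"
proof
  let ?G = "{(\<lambda>(a, b). v a * w b) | v w. v \<in> space M \<and> w \<in> space (triv_rep :: ('h, unit) rep)}"
  let ?T = "outer_tensor M (triv_rep :: ('h, unit) rep)"
  have sp: "space ?T = fn.span ?G" by (simp add: outer_tensor_def)
  {
    assume "f \<in> space ?T"
    then have "f \<in> fn.span ?G" by (simp only: sp)
    then show "(\<lambda>a. f (a, ())) \<in> space M"
    proof (induction rule: fn.span_induct_alt)
      case base
      then show ?case using fn.subspace_0[OF M] by (simp add: zero_fun_def)
    next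
      case (step c x y)
      then obtain v w where vw: "x = (\<lambda>(a, b). v a * w b)" "v \<in> space M" by blast
      have "(\<lambda>a. (scl c x + y) (a, ())) = scl (c * w ()) v + (\<lambda>a. y (a, ()))"
        by (simp add: vw(1) scl_def fun_eq_iff)
      then show ?case using step vw(2) M by (simp only: fn.subspace_add fn.subspace_scale)
    qed
  }
  assume f: "(\<lambda>a. f (a, ())) \<in> space M"
  have "f = (\<lambda>(a, b). f (a, ()) * (\<lambda>_. 1) b)" by (auto simp: fun_eq_iff)
  then have "f \<in> ?G" using f by (fastforce simp: triv_rep_def)
  then show "f \<in> space ?T" unfolding sp by (rule fn.span_base)
qed

lemma act_outer_tensor_specht:
  "act (outer_tensor (specht lam) triv_rep) (u, v) f = (\<lambda>(T, x). f (map ((`) (inv' u)) T, x))"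
  by (simp add: outer_tensor_def triv_rep_def specht_def)

lemma subspace_specht: "fn.subspace (space (specht lam))"
  by (simp add: space_specht)

abbreviation induced_specht :: "nat list \<Rightarrow> nat \<Rightarrow> nat \<Rightarrow> _"
  where "induced_specht lam m s \<equiv> induced_rep (sym_group m \<times>\<times> sym_group s) (sym_group (m + s))
    (young_embedding m) (outer_tensor (specht lam) triv_rep)"

text \<open>The inverse in the covariance condition meets the inverse in the action of
  \<open>specht\<close> on functions, which leaves plain relabelling by u; the factor v acts
  trivially.\<close>

lemma space_induced_specht:
  fixes F :: "(nat \<Rightarrow> nat) \<times> nat set list \<times> unit \<Rightarrow> rat"
  shows "F \<in> space (induced_specht lam m s) \<longleftrightarrow>
    (\<forall>g. g permutes {1..m + s} \<longrightarrow> (\<lambda>T. F (g, T, ())) \<in> space (specht lam)) \<and>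
    (\<forall>g b. \<not> g permutes {1..m + s} \<longrightarrow> F (g, b) = 0) \<and>
    (\<forall>g u v T. g permutes {1..m + s} \<longrightarrow> u permutes {1..m} \<longrightarrow> v permutes {1..s} \<longrightarrow>
      F (g \<circ> young_embedding m (u, v), T, ()) = F (g, map ((`) u) T, ()))"
proof -
  have inv: "inv\<^bsub>sym_group m \<times>\<times> sym_group s\<^esub> (u, v) = (inv' u, inv' v)"
    if "u permutes {1..m}" "v permutes {1..s}" for u v
    using that by (simp add: sym_group_is_group sym_group_carrier)
  have car: "h \<in> carrier (sym_group m \<times>\<times> sym_group s) \<longleftrightarrow>
      (\<exists>u v. h = (u, v) \<and> u permutes {1..m} \<and> v permutes {1..s})" for h
    by (cases h) (simp add: DirProd_def sym_group_carrier)
  have eq: "(\<lambda>b. F (g \<circ> young_embedding m (u, v), b)) =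
      act (outer_tensor (specht lam) triv_rep) (inv\<^bsub>sym_group m \<times>\<times> sym_group s\<^esub> (u, v)) (\<lambda>b. F (g, b)) \<longleftrightarrow>
    (\<forall>T. F (g \<circ> young_embedding m (u, v), T, ()) = F (g, map ((`) u) T, ()))"
    if "u permutes {1..m}" "v permutes {1..s}" for g u v
    unfolding inv[OF that] act_outer_tensor_specht permutes_inv_inv[OF that(1)]
    by (auto simp: fun_eq_iff)
  let ?M = "outer_tensor (specht lam) (triv_rep :: (nat \<Rightarrow> nat, unit) rep)"
  have "F \<in> space (induced_specht lam m s) \<longleftrightarrow>
    (\<forall>g\<in>carrier (sym_group (m + s)). (\<lambda>b. F (g, b)) \<in> space ?M) \<and>
    (\<forall>g b. g \<notin> carrier (sym_group (m + s)) \<longrightarrow> F (g, b) = 0) \<and>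
    (\<forall>g\<in>carrier (sym_group (m + s)). \<forall>h\<in>carrier (sym_group m \<times>\<times> sym_group s).
      (\<lambda>b. F (g \<circ> young_embedding m h, b)) =
      act ?M (inv\<^bsub>sym_group m \<times>\<times> sym_group s\<^esub> h) (\<lambda>b. F (g, b)))"
    by (simp only: induced_rep_def rep.simps mem_Collect_eq sym_group_mult)
  moreover have "(\<forall>g\<in>carrier (sym_group (m + s)). \<forall>h\<in>carrier (sym_group m \<times>\<times> sym_group s).
      (\<lambda>b. F (g \<circ> young_embedding m h, b)) =
      act ?M (inv\<^bsub>sym_group m \<times>\<times> sym_group s\<^esub> h) (\<lambda>b. F (g, b))) \<longleftrightarrow>
    (\<forall>g u v. g permutes {1..m + s} \<longrightarrow> u permutes {1..m} \<longrightarrow> v permutes {1..s} \<longrightarrow>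
      (\<forall>T. F (g \<circ> young_embedding m (u, v), T, ()) = F (g, map ((`) u) T, ())))"
    unfolding Ball_def sym_group_carrier car using eq by blast
  ultimately show ?thesis
    unfolding Ball_def sym_group_carrier space_outer_tensor_triv[OF subspace_specht] by blast
qed

lemma act_induced_specht:
  assumes "x permutes {1..m + s}"
  shows "act (induced_specht lam m s) x F =
    (\<lambda>(g, b). if g permutes {1..m + s} then F (inv' x \<circ> g, b) else 0)"
proof -
  have "x \<in> carrier (sym_group (m + s))" using assms by (simp only: sym_group_carrier)
  then show ?thesis
    by (simp only: induced_rep_def rep.simps sym_group_inv_equality sym_group_carrier sym_group_mult)
qed

lemma is_rep_induced_specht: "is_rep (sym_group (m + s)) (induced_specht lam m s)"
proof -
  let ?N = "induced_specht lam m s" and ?p = "\<lambda>g. g permutes {1..m + s}"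
  note mem = space_induced_specht
  have S: "fn.subspace (space (specht lam))" by (rule subspace_specht)
  have "fn.subspace (space ?N)"
    unfolding fn.subspace_def
  proof (intro conjI ballI allI)
    have "(\<lambda>T. 0 (g, T, ())) = (0 :: nat set list \<Rightarrow> rat)" for g :: "nat \<Rightarrow> nat" by (simp add: fun_eq_iff)
    then show "0 \<in> space ?N" unfolding mem using fn.subspace_0[OF S] by simp
    fix F assume F: "F \<in> space ?N"
    show "F + F' \<in> space ?N" if "F' \<in> space ?N" for F'
    proof -
      have "(\<lambda>T. (F + F') (g, T, ())) = (\<lambda>T. F (g, T, ())) + (\<lambda>T. F' (g, T, ()))" for g
        by (simp add: fun_eq_iff)
      then show ?thesis using F that fn.subspace_add[OF S] unfolding mem by simp
    qed
    show "scl c F \<in> space ?N" for c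
    proof -
      have "(\<lambda>T. scl c F (g, T, ())) = scl c (\<lambda>T. F (g, T, ()))" for g by (simp add: scl_def)
      then show ?thesis using F fn.subspace_scale[OF S] unfolding mem by (simp add: scl_def)
    qed
  qed
  moreover have "act ?N x F \<in> space ?N" if x: "?p x" and F: "F \<in> space ?N" for x F
  proof -
    have p: "?p (inv' x \<circ> g)" if "?p g" for g using that permutes_inv[OF x] permutes_compose by blast
    have y: "?p (g \<circ> young_embedding m (u, v))" if "?p g" "u permutes {1..m}" "v permutes {1..s}" for g u v
      using that permutes_compose young_embedding_permutes by blast
    show ?thesis
      unfolding act_induced_specht[OF x] mem
      using F[unfolded mem] p y by (simp add: o_assoc del: One_nat_def)
  qed
  moreover have "act ?N x (F + F') = act ?N x F + act ?N x F'" if "?p x" for x F F'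
    by (auto simp: act_induced_specht[OF that] fun_eq_iff)
  moreover have "act ?N x (scl c F) = scl c (act ?N x F)" if "?p x" for x c F
    by (auto simp: act_induced_specht[OF that] scl_def fun_eq_iff)
  moreover have "act ?N id F = F" if F: "F \<in> space ?N" for F
    using F[unfolded mem] by (auto simp: act_induced_specht[OF permutes_id] fun_eq_iff inv_id)
  moreover have "act ?N (x \<circ> y) F = act ?N x (act ?N y F)" if "?p x" "?p y" for x y F
  proof -
    have xy: "?p (x \<circ> y)" using that permutes_compose by blast
    have "inv' (x \<circ> y) = inv' y \<circ> inv' x" using o_inv_distrib permutes_bij that by blast
    moreover have "?p (inv' x \<circ> g)" if "?p g" for g
      using that permutes_inv[OF \<open>?p x\<close>] permutes_compose by blast
    ultimately have "act ?N (x \<circ> y) F z = act ?N x (act ?N y F) z" for z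
      by (cases z) (simp add: act_induced_specht[OF that(1)] act_induced_specht[OF that(2)]
        act_induced_specht[OF xy] o_assoc del: One_nat_def)
    then show ?thesis by blast
  qed
  ultimately show ?thesis
    unfolding is_rep_def sym_group_carrier sym_group_mult sym_group_one
    by (simp add: sym_group_carrier del: One_nat_def)
qed

section \<open>The isomorphism with the induced module\<close>

context
  fixes j q s m n :: nat
  assumes jq: "j = 0 \<longrightarrow> q = 0" and m: "m = 2 * j + q" and n: "n = m + s"
begin

definition tabloids :: "nat set list set"
  where "tabloids = tabloid (shape j q) ` tableaux (shape j q)"

definition NC_ks :: "nat set set set"
  where "NC_ks = NC_typed n (\<lambda>t. fst t = j + s \<and> snd t = s)"

lemma specht_zero_outside:
  assumes "f \<in> space (specht (shape j q))" "T \<notin> tabloids"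
  shows "f T = 0"
  using assms(1) unfolding space_specht
proof (induction rule: fn.span_induct_alt)
  case (step c x y)
  then obtain t where "t \<in> tableaux (shape j q)" "x = polytabloid (shape j q) t" by blast
  then have "x T = 0"
    using assms(2) unfolding tabloids_def by (simp add: polytabloid_eq[OF jq] scl_def tvec_def)
  then show ?case using step by (simp add: scl_def)
qed simp

lemma tabloid_union:
  assumes "T \<in> tabloids" "to_triple T = (Y, Z, rs)"
  shows "Y \<union> Z \<union> set rs = {1..m}"
proof -
  obtain t where t: "t \<in> tableaux (shape j q)" "T = tabloid (shape j q) t"
    using assms(1) unfolding tabloids_def by blast
  then have "row_triple j q t = (Y, Z, rs)" using assms(2) by (simp add: to_triple_tabloid[OF jq])
  then show ?thesis using row_triple_union[OF jq t(1)] unfolding m by blast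
qed

text \<open>The column partition of t may cross, but with singletons added it is a relabelling by
  some w of the noncrossing partition of the standard filling. Acting with w yields its vector up to
  the constant c of \<open>pvec_perm_sign\<close>, and the factor c in v corrects this.\<close>

lemma web_colpart:
  assumes t: "t \<in> tableaux (shape j q)"
  shows "\<exists>v\<in>supp_in NC_ks. \<forall>T. web n v T = pvec (colpart j q t) T"
proof -
  let ?P = "full_part j q s (std_tab q)"
  have P: "?P \<in> NC_ks" unfolding NC_ks_def unfolding n m by (rule full_part_std_in[OF jq])
  then have PN: "?P \<in> NC n" by (simp add: NC_ks_def NC_typed_def)
  obtain w where w: "w permutes {1..n}" "perm_partition w ?P = full_part j q s t"
    using full_part_perm[OF jq t, of s] unfolding n m by blast
  have "finite ?P" by (simp add: full_part_def[OF jq] colpart_def)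
  then obtain c where c: "\<And>T. pvec (perm_partition w ?P) (tact w T) = c * pvec ?P T"
    using pvec_perm_sign[OF w(1)] by blast
  define v where "v = scl c (skein_act n w (basis_vec ?P))"
  have "basis_vec ?P \<in> supp_in NC_ks" using P by (auto simp: supp_in_def basis_vec_def)
  then have "v \<in> supp_in NC_ks" unfolding v_def NC_ks_def using w(1) by (intro supp_in_scl supp_in_skein_act)
  moreover have "web n v T = pvec (colpart j q t) T" for T
  proof -
    have "web n v T = c * pvec ?P (tact (inv' w) T)"
      by (simp only: v_def web_scl web_skein_act[OF w(1)] web_basis[OF PN])
    also have "\<dots> = pvec (perm_partition w ?P) (tact w (tact (inv' w) T))" by (simp only: c)
    also have "\<dots> = pvec (full_part j q s t) T"
      unfolding w(2) tact_comp permutes_inv_o(1)[OF w(1)] tact_id ..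
    also have "\<dots> = pvec (colpart j q t) T"
      using pvec_big_blocks_cong[of "full_part j q s t" "colpart j q t"]
        full_part(3)[OF jq t] big_blocks_colpart[OF jq t] by simp
    finally show ?thesis .
  qed
  ultimately show ?thesis by blast
qed

text \<open>Specht vectors are combinations of polytabloids, each lifted by
  \<open>web_colpart\<close>. The vanishing on triples with other letters is what later keeps the
  contributions of different cosets apart.\<close>

lemma specht_lift:
  assumes "f \<in> space (specht (shape j q))"
  shows "\<exists>v\<in>supp_in NC_ks. (\<forall>T\<in>tabloids. web n v (to_triple T) = f T) \<and>
    (\<forall>Y Z rs. Y \<union> Z \<union> set rs \<noteq> {1..m} \<longrightarrow> web n v (Y, Z, rs) = 0)"
  using assms unfolding space_specht
proof (induction rule: fn.span_induct_alt)
  case base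
  show ?case
  proof (intro bexI[of _ 0] conjI ballI allI impI supp_in_0)
    show "web n 0 (to_triple T) = 0 T" for T unfolding web_0 by (rule zero_fun_apply[symmetric])
    show "web n 0 (Y, Z, rs) = 0" for Y Z rs by (rule web_0)
  qed
next
  case (step c x y)
  then obtain t where t: "t \<in> tableaux (shape j q)" "x = polytabloid (shape j q) t" by blast
  obtain u where u: "u \<in> supp_in NC_ks" "\<And>T. web n u T = pvec (colpart j q t) T"
    using web_colpart[OF t(1)] by blast
  obtain v where v: "v \<in> supp_in NC_ks" "\<forall>T\<in>tabloids. web n v (to_triple T) = y T"
    "\<forall>Y Z rs. Y \<union> Z \<union> set rs \<noteq> {1..m} \<longrightarrow> web n v (Y, Z, rs) = 0"
    using step by blast
  define d where "d = c * wsign (map t (cellseq j q))"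
  have "pvec (colpart j q t) (Y, Z, rs) = 0" if "Y \<union> Z \<union> set rs \<noteq> {1..m}" for Y Z rs
  proof -
    have "\<not> transv (colpart j q t) (Y, Z, rs)"
      using that Union_colpart[OF jq t(1)] big_blocks_colpart[OF jq t(1)] by (simp add: transv_def m)
    then show ?thesis by (simp add: pvec_def)
  qed
  then have "web n (scl d u + v) (Y, Z, rs) = 0" if "Y \<union> Z \<union> set rs \<noteq> {1..m}" for Y Z rs
    using that v(3) by (simp add: web_add web_scl u(2))
  moreover have "web n (scl d u + v) (to_triple T) = (scl c x + y) T" if "T \<in> tabloids" for T
    using that v(2)[rule_format, OF that] unfolding t(2) polytabloid_eq[OF jq t(1)] web_add web_scl u(2)
    by (simp add: scl_def tvec_def d_def tabloids_def)
  moreover have "scl d u + v \<in> supp_in NC_ks" using u(1) v(1) by (intro supp_in_add supp_in_scl)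
  ultimately show ?case by blast
qed

text \<open>Up to a constant, the slice at g is the vector of the non-singleton blocks of the
  relabelled partition \<open>Q\<close>. If these cover {1..m}, \<open>tvec_in_specht\<close>
  applies; otherwise no tabloid has the right letters and the slice is 0.\<close>

lemma pvec_slice:
  assumes P: "P \<in> NC_ks" and g: "g permutes {1..n}"
  shows "(\<lambda>T. if T \<in> tabloids then pvec P (tact g (to_triple T)) else 0) \<in> space (specht (shape j q))"
proof -
  define Q where "Q = perm_partition (inv' g) P"
  have part: "partition_on {1..n} P" and ty: "block_type P = (j + s, s)"
    using P by (auto simp: NC_ks_def NC_typed_def NC_def prod_eq_iff)
  have Q: "partition_on {1..n} Q" using partition_on_perm[OF part permutes_inv[OF g]] by (simp add: Q_def)
  have tyQ: "block_type Q = (j + s, s)"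
    using block_type_perm permutes_inj[OF permutes_inv[OF g]] ty unfolding Q_def by metis
  have gQ: "perm_partition g Q = P"
    unfolding Q_def perm_partition_comp permutes_inv_o(1)[OF g] by simp
  have finQ: "finite Q" using finite_elements[OF _ Q] by simp
  obtain c where c: "\<And>T. pvec P (tact g T) = c * pvec Q T"
    using pvec_perm_sign[OF g finQ] unfolding gQ by metis
  define B where "B = big_blocks Q"
  have BB: "big_blocks B = B" by (auto simp: B_def big_blocks_def)
  have pB: "pvec Q = pvec B" using BB by (intro pvec_big_blocks_cong) (simp add: B_def)
  have "tvec j q B \<in> space (specht (shape j q))"
  proof (cases "\<Union>B = {1..m}")
    case True
    have "partition_on {1..m} B"
    proof (rule partition_onI[OF True])
      fix p p' assume "p \<in> B" "p' \<in> B" "p \<noteq> p'"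
      then show "disjnt p p'" using Q by (auto simp: B_def big_blocks_def partition_on_def disjoint_def disjnt_def)
    qed (use Q in \<open>auto simp: B_def big_blocks_def partition_on_def\<close>)
    moreover have "card B = j"
    proof -
      have "Q = B \<union> {b \<in> Q. card b = 1}" "B \<inter> {b \<in> Q. card b = 1} = {}"
        by (auto simp: B_def big_blocks_def)
      then have "card Q = card B + card {b \<in> Q. card b = 1}"
        using finQ by (metis card_Un_disjoint finite_Un)
      then show ?thesis using tyQ by (simp add: block_type_def)
    qed
    moreover have "card b \<ge> 2" if "b \<in> B" for b
    proof -
      have "finite b" "b \<noteq> {}" using big_blocks_partition(1,2)[OF Q _ that[unfolded B_def]] by auto
      then have "card b \<noteq> 0" by simp
      moreover have "card b \<noteq> 1" using that by (simp add: B_def big_blocks_def)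
      ultimately show ?thesis by linarith
    qed
    ultimately show ?thesis unfolding m by (intro tvec_in_specht[OF jq])
  next
    case False
    have "tvec j q B T = 0" for T
    proof (cases "T \<in> tabloids")
      case True
      obtain Y Z rs where d: "to_triple T = (Y, Z, rs)" by (cases "to_triple T")
      then have "\<not> transv B (to_triple T)" using tabloid_union[OF True d] False BB by (simp add: transv_def)
      then show ?thesis by (simp add: tvec_def pvec_def)
    qed (simp add: tvec_def tabloids_def)
    then have "tvec j q B = 0" by (simp add: fun_eq_iff)
    then show ?thesis using fn.subspace_0[OF subspace_specht] by simp
  qed
  then have "scl c (tvec j q B) \<in> space (specht (shape j q))" by (rule fn.subspace_scale[OF subspace_specht])
  also have "scl c (tvec j q B) = (\<lambda>T. if T \<in> tabloids then pvec P (tact g (to_triple T)) else 0)"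
    by (simp add: scl_def tvec_def c pB tabloids_def fun_eq_iff)
  finally show ?thesis .
qed

text \<open>Frobenius reciprocity: restricting \<open>web n v\<close> to the triples of tabloids on
  {1..m} commutes with the Young subgroup, and the value at g is this restriction for the vector
  g^-1 v.\<close>

definition lift_map :: "(nat set set \<Rightarrow> rat) \<Rightarrow> (nat \<Rightarrow> nat) \<times> nat set list \<times> unit \<Rightarrow> rat"
  where "lift_map v = (\<lambda>(g, T, x). if g permutes {1..n} \<and> T \<in> tabloids then web n v (tact g (to_triple T)) else 0)"

lemma lift_map_in_induced:
  assumes v: "v \<in> supp_in NC_ks"
  shows "lift_map v \<in> space (induced_specht (shape j q) m s)"
  unfolding space_induced_specht unfolding n[symmetric]
proof (intro conjI allI impI)
  fix g assume g: "g permutes {1..n}"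
  have "(\<lambda>T. lift_map v (g, T, ())) = (\<Sum>P\<in>NC n. scl (v P) (\<lambda>T. if T \<in> tabloids then pvec P (tact g (to_triple T)) else 0))"
  proof
    fix T
    have sum_apply: "(\<Sum>x\<in>A. f x) T = (\<Sum>x\<in>A. f x T)" for A and f :: "nat set set \<Rightarrow> nat set list \<Rightarrow> rat"
      by (induction A rule: infinite_finite_induct) auto
    show "lift_map v (g, T, ()) = (\<Sum>P\<in>NC n. scl (v P) (\<lambda>T. if T \<in> tabloids then pvec P (tact g (to_triple T)) else 0)) T"
      using g unfolding sum_apply by (simp add: lift_map_def web_def scl_def del: One_nat_def)
  qed
  also have "\<dots> \<in> space (specht (shape j q))"
  proof (rule fn.subspace_sum[OF subspace_specht])
    fix P
    show "scl (v P) (\<lambda>T. if T \<in> tabloids then pvec P (tact g (to_triple T)) else 0) \<in> space (specht (shape j q))"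
    proof (cases "P \<in> NC_ks")
      case True
      then show ?thesis using pvec_slice[OF _ g] fn.subspace_scale[OF subspace_specht] by blast
    next
      case False
      then have "v P = 0" using v by (simp add: supp_in_def)
      then show ?thesis using fn.subspace_0[OF subspace_specht] by simp
    qed
  qed
  finally show "(\<lambda>T. lift_map v (g, T, ())) \<in> space (specht (shape j q))" .
next
  fix g b assume "\<not> g permutes {1..n}"
  then show "lift_map v (g, b) = 0" by (auto simp: lift_map_def split: prod.splits)
next
  fix g u w T assume g: "g permutes {1..n}" and u: "u permutes {1..m}" and w: "w permutes {1..s}"
  let ?y = "young_embedding m (u, w)"
  have p: "g \<circ> ?y permutes {1..n}"
    using young_embedding_permutes[OF u w] g permutes_compose unfolding n by blast
  have iff: "map ((`) u) T \<in> tabloids \<longleftrightarrow> T \<in> tabloids"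
    using tabloid_act_iff[OF jq u[unfolded m]] by (simp add: tabloids_def)
  show "lift_map v (g \<circ> ?y, T, ()) = lift_map v (g, map ((`) u) T, ())"
  proof (cases "T \<in> tabloids")
    case True
    obtain Y Z rs where d: "to_triple T = (Y, Z, rs)" by (cases "to_triple T")
    \<comment> \<open>All letters of a tabloid are at most m, where the embedding acts by u alone;
      this accounts for the trivial second factor.\<close>
    have "?y x = u x" if "x \<in> Y \<union> Z \<union> set rs" for x
      using that tabloid_union[OF True d] by (simp add: young_embedding_apply)
    then have "tact ?y (to_triple T) = tact u (to_triple T)" unfolding d by (simp add: tact_def cong: image_cong)
    then have "tact (g \<circ> ?y) (to_triple T) = tact g (to_triple (map ((`) u) T))"
      using tabloid_act(2)[OF jq u[unfolded m]] True unfolding tabloids_def by (simp flip: tact_comp)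
    then show ?thesis using True g p iff by (simp add: lift_map_def del: One_nat_def)
  qed (simp add: lift_map_def iff)
qed

text \<open>The s singletons leave exactly m letters for the word, all distinct, so some g carries
  the reading word of the standard filling to it. Thus \<open>lift_map\<close> sees every coordinate
  at which a vector from \<open>NC_ks\<close> is nonzero, and its injectivity reduces to that of
  \<open>web\<close>.\<close>

lemma pvec_reach:
  assumes P: "P \<in> NC_ks" and nz: "pvec P T \<noteq> 0"
  shows "\<exists>g. g permutes {1..n} \<and> (\<exists>T0\<in>tabloids. T = tact g (to_triple T0))"
proof -
  have part: "partition_on {1..n} P" and ty: "block_type P = (j + s, s)"
    using P by (auto simp: NC_ks_def NC_typed_def NC_def prod_eq_iff)
  have finP: "finite P" using finite_elements[OF _ part] by simp
  obtain Y Z rs where T: "T = (Y, Z, rs)" by (cases T)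
  obtain bs where bs: "distinct bs" "set bs = big_blocks P"
    using finite_distinct_list[OF finite_big_blocks[OF part]] by auto
  have tr: "transv P T" and di: "distinct (word_of bs T)" using pvec_nonzeroD[OF nz bs] by auto
  have sing: "{b \<in> P. card b = 1} = (\<lambda>x. {x}) ` ({1..n} - \<Union>(big_blocks P))"
  proof -
    have fin: "finite b" if "b \<in> P" for b
      using that part finite_subset[of b "{1..n}"] by (auto simp: partition_on_def)
    show ?thesis
    proof
      show "{b \<in> P. card b = 1} \<subseteq> (\<lambda>x. {x}) ` ({1..n} - \<Union>(big_blocks P))"
        using partition_on_big_blocks[OF part fin] by (auto simp: big_blocks_def)
      show "(\<lambda>x. {x}) ` ({1..n} - \<Union>(big_blocks P)) \<subseteq> {b \<in> P. card b = 1}"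
        using partition_on_big_blocks[OF part fin] by auto
    qed
  qed
  have sub: "\<Union>(big_blocks P) \<subseteq> {1..n}" using big_blocks_partition(3)[OF part] by blast
  have "card ({1..n} - \<Union>(big_blocks P)) = s"
    using ty arg_cong[OF sing, of card] by (simp add: block_type_def card_image del: One_nat_def)
  then have "card (\<Union>(big_blocks P)) = m"
    using card_Diff_subset[OF finite_subset[OF sub] sub] card_mono[OF _ sub] n by simp
  then have len: "length (word_of bs T) = m"
    using distinct_card[OF di] set_word_of[OF tr bs(2)] by simp
  have lb: "length bs = j"
  proof -
    have "P = big_blocks P \<union> {b \<in> P. card b = 1}" "big_blocks P \<inter> {b \<in> P. card b = 1} = {}"
      by (auto simp: big_blocks_def)
    then have "card P = card (big_blocks P) + card {b \<in> P. card b = 1}"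
      using finP by (metis card_Un_disjoint finite_Un)
    then have "card (big_blocks P) = j" using ty by (simp add: block_type_def)
    then show ?thesis using distinct_card[OF bs(1)] bs(2) by simp
  qed
  then have lr: "length rs = q" using len by (simp add: word_of_def T m)
  let ?t = "std_tab q"
  have t: "?t \<in> tableaux (shape j q)" by (rule std_tab[OF jq])
  then have "distinct (map ?t (cellseq j q))" "set (map ?t (cellseq j q)) = {1..m}"
    using tableaux_shape[OF jq] m by blast+
  moreover have "set (word_of bs T) \<subseteq> {1..n}" using set_word_of[OF tr bs(2)] sub by simp
  moreover have "length (map ?t (cellseq j q)) = m" by (simp add: cellseq_def m)
  ultimately obtain g where g: "g permutes {1..n}" "map g (map ?t (cellseq j q)) = word_of bs T"
    using ex_perm_map[of "map ?t (cellseq j q)" "word_of bs T" "{1..n}"] di len n by auto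
  have split: "map (\<lambda>c. g (?t (0, c))) [0..<j] = map (pick Y) bs"
    "map (\<lambda>c. g (?t (1, c))) [0..<j] = map (pick Z) bs"
    "map (\<lambda>r. g (?t (r + 2, 0))) [0..<q] = rs"
    using g(2) lb lr by (simp_all add: cellseq_def word_of_def T o_def)
  have "tact g (row_triple j q ?t) = T"
  proof -
    have "g ` ?t ` Pair 0 ` {..<j} = set (map (\<lambda>c. g (?t (0, c))) [0..<j])"
      "g ` ?t ` Pair 1 ` {..<j} = set (map (\<lambda>c. g (?t (1, c))) [0..<j])"
      by (simp_all add: image_image atLeast0LessThan)
    then have "g ` ?t ` Pair 0 ` {..<j} = Y" "g ` ?t ` Pair 1 ` {..<j} = Z"
      unfolding split using transv_pick_image[OF tr[unfolded T]] bs(2) by simp_all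
    then show ?thesis using split(3) by (simp add: T tact_def row_triple_def o_def)
  qed
  then show ?thesis using g(1) t to_triple_tabloid[OF jq] unfolding tabloids_def by (metis image_eqI)
qed

lemma lift_map_inj: "inj_on lift_map (supp_in NC_ks)"
proof (rule inj_onI)
  fix v w assume v: "v \<in> supp_in NC_ks" and w: "w \<in> supp_in NC_ks" and eq: "lift_map v = lift_map w"
  have "v - w = 0"
  proof (rule web_eq_0)
    have d: "v - w \<in> supp_in NC_ks" using v w by (rule supp_in_diff)
    then show "v - w \<in> supp_in (NC n)" unfolding NC_ks_def by (rule supp_in_NC_typed)
    fix T
    show "web n (v - w) T = 0"
    proof (cases "\<exists>P\<in>NC_ks. pvec P T \<noteq> 0")
      case True
      then obtain g T0 where g: "g permutes {1..n}" "T0 \<in> tabloids" "T = tact g (to_triple T0)"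
        using pvec_reach by blast
      have "lift_map v (g, T0, ()) = lift_map w (g, T0, ())" by (simp only: eq)
      then show ?thesis using g by (simp add: lift_map_def web_diff del: One_nat_def)
    next
      case False
      then have "(v - w) P * pvec P T = 0" for P using d by (cases "P \<in> NC_ks") (auto simp: supp_in_def)
      then show ?thesis unfolding web_def by (intro sum.neutral ballI)
    qed
  qed
  then show "v = w" by simp
qed

text \<open>Cosets of the Young subgroup correspond to the s-element sets Z, the images of {m+1..n},
  with representatives \<open>gz Z\<close>. For each Z the value of F at \<open>gz Z\<close> is
  lifted to a vector \<open>vz Z\<close>, which is moved by \<open>gz Z\<close>; the sum over Z is
  the preimage. Covariance of both sides reduces the equality to the representatives.\<close>

lemma lift_map_surj:
  assumes F: "F \<in> space (induced_specht (shape j q) m s)"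
  shows "\<exists>v\<in>supp_in NC_ks. lift_map v = F"
proof -
  note memF = F[unfolded space_induced_specht, folded n]
  note F1 = memF[THEN conjunct1, rule_format] and F2 = memF[THEN conjunct2, THEN conjunct1, rule_format]
    and F3 = memF[THEN conjunct2, THEN conjunct2, rule_format]
  let ?C = "{Z. Z \<subseteq> {1..n} \<and> card Z = s}"
  have "\<exists>g. g permutes {1..n} \<and> g ` {m + 1..n} = Z" if "Z \<in> ?C" for Z
  proof -
    have "finite Z" using that finite_subset by blast
    then have "\<exists>g. g permutes {1..n} \<and> map g [m + 1..<n + 1] = sorted_list_of_set Z"
      using that n by (intro ex_perm_map) (auto simp del: upt_Suc)
    then obtain g where g: "g permutes {1..n}" "map g [m + 1..<n + 1] = sorted_list_of_set Z" by blast
    have "g ` set [m + 1..<n + 1] = Z"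
      using arg_cong[OF g(2), of set] \<open>finite Z\<close> by (simp del: set_upt upt_Suc)
    moreover have "set [m + 1..<n + 1] = {m + 1..n}" by auto
    ultimately show ?thesis using g(1) by auto
  qed
  then obtain gz where gz: "\<And>Z. Z \<in> ?C \<Longrightarrow> gz Z permutes {1..n} \<and> gz Z ` {m + 1..n} = Z" by metis
  define lift where "lift Z v \<longleftrightarrow> v \<in> supp_in NC_ks \<and> (\<forall>T\<in>tabloids. web n v (to_triple T) = F (gz Z, T, ())) \<and>
    (\<forall>Y Y' rs. Y \<union> Y' \<union> set rs \<noteq> {1..m} \<longrightarrow> web n v (Y, Y', rs) = 0)" for Z v
  have "\<exists>v. lift Z v" if "Z \<in> ?C" for Z
    using specht_lift[OF F1[of "gz Z"]] gz[OF that] unfolding lift_def by (simp only: Bex_def)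
  then obtain vz where "\<And>Z. Z \<in> ?C \<Longrightarrow> lift Z (vz Z)" by metis
  then have vz: "\<And>Z. Z \<in> ?C \<Longrightarrow> vz Z \<in> supp_in NC_ks"
    "\<And>Z T. Z \<in> ?C \<Longrightarrow> T \<in> tabloids \<Longrightarrow> web n (vz Z) (to_triple T) = F (gz Z, T, ())"
    "\<And>Z Y Y' rs. Z \<in> ?C \<Longrightarrow> Y \<union> Y' \<union> set rs \<noteq> {1..m} \<Longrightarrow> web n (vz Z) (Y, Y', rs) = 0"
    unfolding lift_def by blast+
  define v where "v = (\<Sum>Z\<in>?C. skein_act n (gz Z) (vz Z))"
  have v: "v \<in> supp_in NC_ks"
    unfolding v_def
  proof (rule supp_in_sum)
    fix Z assume "Z \<in> ?C"
    then show "skein_act n (gz Z) (vz Z) \<in> supp_in NC_ks"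
      using gz[of Z] vz(1)[of Z] unfolding NC_ks_def by (intro supp_in_skein_act) auto
  qed
  note memP = lift_map_in_induced[OF v, unfolded space_induced_specht, folded n]
  note P2 = memP[THEN conjunct2, THEN conjunct1, rule_format]
    and P3 = memP[THEN conjunct2, THEN conjunct2, rule_format]
  have finC: "finite ?C" by (rule finite_subset[of _ "Pow {1..n}"]) auto
  have rep: "lift_map v (gz Z, T, ()) = F (gz Z, T, ())" if Z: "Z \<in> ?C" for Z T
  proof (cases "T \<in> tabloids")
    case True
    \<comment> \<open>Translated by the inverse of \<open>gz Z'\<close>, the letters of the triple
      do not fill {1..m}, because the complements of Z and Z' differ; there the lift
      \<open>vz Z'\<close> has coordinate 0.\<close>
    have other: "web n (vz Z') (tact (inv' (gz Z')) (tact (gz Z) (to_triple T))) = 0"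
      if Z': "Z' \<in> ?C" "Z' \<noteq> Z" for Z'
    proof -
      obtain Y Y' rs where d: "to_triple T = (Y, Y', rs)" by (cases "to_triple T")
      let ?w = "inv' (gz Z') \<circ> gz Z"
      have p: "gz Z permutes {1..n}" "gz Z' permutes {1..n}" using gz Z Z' by auto
      have "?w ` {1..m} \<noteq> {1..m}"
      proof
        assume "?w ` {1..m} = {1..m}"
        then have "gz Z' ` inv' (gz Z') ` gz Z ` {1..m} = gz Z' ` {1..m}" by (simp only: image_comp o_assoc)
        then have eq: "gz Z ` {1..m} = gz Z' ` {1..m}"
          using permutes_inv_o(1)[OF p(2)] by (simp only: image_comp o_assoc id_o)
        have m1: "{m + 1..n} = {1..n} - {1..m}" by auto
        have compl: "g ` {m + 1..n} = {1..n} - g ` {1..m}" if "g permutes {1..n}" for g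
          unfolding m1 using image_set_diff[OF permutes_inj[OF that]] permutes_image[OF that] by simp
        have "Z = Z'" using gz[OF Z] gz[OF Z'(1)] compl[OF p(1)] compl[OF p(2)] eq by simp
        then show False using Z'(2) by simp
      qed
      then have "?w ` (Y \<union> Y' \<union> set rs) \<noteq> {1..m}" using tabloid_union[OF True d] by simp
      then have "?w ` Y \<union> ?w ` Y' \<union> set (map ?w rs) \<noteq> {1..m}" by (simp add: image_Un)
      then show ?thesis unfolding tact_comp d using vz(3)[OF Z'(1)] by (simp add: tact_def)
    qed
    have pZ: "gz Z permutes {1..n}" using gz Z by auto
    have "lift_map v (gz Z, T, ()) = web n v (tact (gz Z) (to_triple T))"
      using pZ True by (simp add: lift_map_def del: One_nat_def)
    also have "\<dots> = (\<Sum>Z'\<in>?C. web n (vz Z') (tact (inv' (gz Z')) (tact (gz Z) (to_triple T))))"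
      unfolding v_def web_sum
    proof (rule sum.cong[OF refl])
      fix Z' assume "Z' \<in> ?C"
      then have "gz Z' permutes {1..n}" using gz by blast
      then show "web n (skein_act n (gz Z') (vz Z')) (tact (gz Z) (to_triple T)) =
          web n (vz Z') (tact (inv' (gz Z')) (tact (gz Z) (to_triple T)))"
        by (rule web_skein_act)
    qed
    also have "\<dots> = web n (vz Z) (tact (inv' (gz Z)) (tact (gz Z) (to_triple T)))"
    proof -
      have zero: "(\<Sum>Z'\<in>?C - {Z}. web n (vz Z') (tact (inv' (gz Z')) (tact (gz Z) (to_triple T)))) = 0"
        by (rule sum.neutral) (use other in blast)
      show ?thesis unfolding sum.remove[OF finC Z] zero by (rule add_0_right)
    qed
    also have "\<dots> = F (gz Z, T, ())"
      unfolding tact_comp permutes_inv_o(2)[OF pZ] tact_id by (rule vz(2)[OF Z True])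
    finally show ?thesis .
  next
    case False
    have "gz Z permutes {1..n}" using gz Z by auto
    then have "(\<lambda>T. F (gz Z, T, ())) \<in> space (specht (shape j q))" by (rule F1)
    from specht_zero_outside[OF this False] have "F (gz Z, T, ()) = 0" .
    then show ?thesis using False by (simp add: lift_map_def)
  qed
  have "lift_map v (g, T, ()) = F (g, T, ())" if g: "g permutes {1..n}" for g T
  proof -
    define Z where "Z = g ` {m + 1..n}"
    have Z: "Z \<in> ?C"
    proof -
      have "g ` {m + 1..n} \<subseteq> g ` {1..n}" by (intro image_mono) auto
      then have "Z \<subseteq> {1..n}" using permutes_image[OF g] by (simp add: Z_def)
      moreover have "card Z = s"
        unfolding Z_def using inj_on_subset[OF permutes_inj[OF g] subset_UNIV] n by (simp add: card_image)
      ultimately show ?thesis by simp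
    qed
    \<comment> \<open>Both g and \<open>gz Z\<close> send {m+1..n} to Z, so they differ by an
      element of the Young subgroup.\<close>
    let ?w = "inv' (gz Z) \<circ> g"
    have pZ: "gz Z permutes {1..n}" "gz Z ` {m + 1..n} = Z" using gz[OF Z] by auto
    have w: "?w permutes {1..m + s}" using permutes_compose[OF g permutes_inv[OF pZ(1)]] n by simp
    have "?w ` {m + 1..m + s} = inv' (gz Z) ` Z"
      by (simp only: Z_def n image_comp)
    also have "\<dots> = inv' (gz Z) ` gz Z ` {m + 1..n}" by (simp only: pZ(2))
    also have "\<dots> = {m + 1..m + s}"
      unfolding image_comp permutes_inv_o(2)[OF pZ(1)] by (simp add: n)
    finally obtain u u' where u: "u permutes {1..m}" "u' permutes {1..s}" "?w = young_embedding m (u, u')"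
      using young_embedding_split[OF w] by blast
    have "g = gz Z \<circ> ?w" unfolding o_assoc permutes_inv_o(1)[OF pZ(1)] by simp
    then have ge: "g = gz Z \<circ> young_embedding m (u, u')" using u(3) by simp
    have "lift_map v (g, T, ()) = lift_map v (gz Z, map ((`) u) T, ())"
      unfolding ge by (rule P3[OF pZ(1) u(1,2)])
    also have "\<dots> = F (gz Z, map ((`) u) T, ())" by (rule rep[OF Z])
    also have "\<dots> = F (g, T, ())" unfolding ge by (rule F3[OF pZ(1) u(1,2), symmetric])
    finally show ?thesis .
  qed
  moreover have "lift_map v (g, T, ()) = F (g, T, ())" if "\<not> g permutes {1..n}" for g T
    using F2[OF that] P2[OF that] by simp
  ultimately have "lift_map v (g, T, ()) = F (g, T, ())" for g T by blast
  then have "lift_map v = F" by (auto simp: fun_eq_iff)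
  with v show ?thesis by blast
qed

lemma rep_isomorphic_induced:
  "rep_isomorphic (sym_group n) (skein_rep n NC_ks) (induced_specht (shape j q) m s)"
proof -
  have "is_rep (sym_group n) (skein_rep n NC_ks)" unfolding NC_ks_def by (rule is_rep_skein_rep)
  moreover have "is_rep (sym_group n) (induced_specht (shape j q) m s)"
    unfolding n by (rule is_rep_induced_specht)
  moreover have "bij_betw lift_map (supp_in NC_ks) (space (induced_specht (shape j q) m s))"
    unfolding bij_betw_def using lift_map_inj lift_map_in_induced lift_map_surj by blast
  moreover have "lift_map (v + w) = lift_map v + lift_map w" for v w by (auto simp: lift_map_def web_add fun_eq_iff)
  moreover have "lift_map (scl c v) = scl c (lift_map v)" for c v
    by (simp add: lift_map_def web_scl fun_eq_iff) (simp add: scl_def)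
  moreover have "lift_map (skein_act n x v) = act (induced_specht (shape j q) m s) x (lift_map v)"
    if x: "x permutes {1..n}" for x v
  proof -
    have "inv' x \<circ> g permutes {1..n}" if "g permutes {1..n}" for g
      using that permutes_inv[OF x] permutes_compose by blast
    then show ?thesis
      unfolding act_induced_specht[OF x[unfolded n]] unfolding n[symmetric]
      by (auto simp: lift_map_def web_skein_act[OF x] tact_comp fun_eq_iff simp del: One_nat_def)
  qed
  ultimately show ?thesis
    unfolding rep_isomorphic_def space_skein_rep act_skein_rep
    by (intro conjI exI[of _ lift_map]) (simp_all add: sym_group_carrier del: One_nat_def)
qed

end

lemma V_blocks_singletons_induced:
  assumes ok: "lam_seq_ok n k s"
  shows "rep_isomorphic (sym_group n) (V_blocks_singletons n k s)
    (induced_rep (sym_group (n - s) \<times>\<times> sym_group s) (sym_group n) (young_embedding (n - s))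
      (outer_tensor (specht (filter (\<lambda>x. x > 0) (lam_seq n k s))) triv_rep))"
proof -
  define j where "j = k - s"
  define q where "q = n + s - 2 * k"
  have sk: "s \<le> k" "2 * k \<le> n + s" and sorted: "sorted_wrt (\<ge>) ([j, j] @ replicate q 1)"
    using ok by (auto simp: lam_seq_ok_def lam_seq_def j_def q_def)
  have jq: "j = 0 \<longrightarrow> q = 0" using sorted by (auto simp: sorted_wrt_append)
  have m: "n - s = 2 * j + q" and n: "n = n - s + s" and k: "k = j + s"
    using sk by (auto simp: j_def q_def)
  have "filter (\<lambda>x. x > 0) (lam_seq n k s) = shape j q"
    by (simp only: lam_seq_def shape_def j_def q_def)
  moreover have "V_blocks_singletons n k s = skein_rep n (NC_typed n (\<lambda>t. fst t = j + s \<and> snd t = s))"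
    unfolding k by (simp add: V_blocks_singletons_def NC_eq_NC_typed(3))
  ultimately show ?thesis
    using rep_isomorphic_induced[OF jq m n] n unfolding NC_ks_def[OF jq m n] by simp
qed

theorem theorem5p3:
  shows "(\<forall>n. rep_isomorphic (sym_group n) (V n) (direct_sum (\<lambda>k::nat. V_blocks n k))) \<and>
    (\<forall>n k. rep_isomorphic (sym_group n)
      (V_blocks n k) (direct_sum (\<lambda>s::nat. V_blocks_singletons n k s))) \<and>
    (\<forall>n k s. lam_seq_ok n k s \<longrightarrow>
      rep_isomorphic (sym_group n)
        (V_blocks_singletons n k s)
        (induced_rep (sym_group (n - s) \<times>\<times> sym_group s) (sym_group n) (young_embedding (n - s))
          (outer_tensor (specht (filter (\<lambda>x. x > 0) (lam_seq n k s))) triv_rep)))"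
  using V_decompositions V_blocks_singletons_induced by blast

end
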